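(* Let $P:\mu^{-1}(0)^{rss}\to\mathbb{C}^{2n}\setminus\Delta_n$ be the map $(r,s,i,j)\mapsto(r_{11},\ldots,r_{nn},s'_{11},\ldots,s'_{nn})$, where $$s'_{\iota\iota}=\left[\mathrm{tr}\Big(\prod_{1\le k\le n,\,k\ne\iota} l_k(r)\Big)\right]^{-1}\mathrm{tr}\Big(\prod_{1\le k\le n,\,k\ne\iota} l_k(r)\; s\Big).$$ Then $P$ descends to a set-theoretically bijective homeomorphism $$p:\mu^{-1}(0)^{rss}/\!\!/B\to\mathbb{C}^{2n}\setminus\Delta_n,\qquad \overline{B.(r,s,i,j)}\mapsto(r_{11},\ldots,r_{nn},s'_{11},\ldots,s'_{nn}),$$ where $\overline{B.(r,s,i,j)}$ is the $B$-orbit closure of $(r,s,i,j)$ (representing the point of the quotient that is the image of $(r,s,i,j)$). In fact, $p$ induces an isomorphism of varieties.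
   Context: Let $n\ge 1$, $\mathfrak{g}=\mathfrak{gl}_n(\mathbb{C})$, $B\subset GL_n(\mathbb{C})$ the group of invertible upper triangular matrices, $\mathfrak{b}$ its Lie algebra (upper triangular matrices), $\mathfrak{u}\subset\mathfrak{g}$ the strictly upper triangular matrices. Identify $\mathfrak{b}^*\cong\mathfrak{g}/\mathfrak{u}$ via the trace pairing $(r,s)\mapsto\mathrm{tr}(rs)$; $\overline{v}$ is the class of $v\in\mathfrak{g}$ in $\mathfrak{g}/\mathfrak{u}$; an element of $\mathfrak{b}^*$ has a unique lower triangular representative $s=(s_{\iota\gamma})$. Identify $T^*(\mathfrak{b}\times\mathbb{C}^n)=\mathfrak{b}\times\mathfrak{b}^*\times\mathbb{C}^n\times(\mathbb{C}^n)^*$, with points $(r,s,i,j)$, $i$ a column vector and $j$ a row vector. $B$ acts by $b.(r,s,i,j)=(brb^{-1},\overline{bsb^{-1}},bi,jb^{-1})$. The moment map is $\mu(r,s,i,j)=\overline{[r,s]+ij}\in\mathfrak{b}^*$, and $\mu^{-1}(0)^{rss}=\{(r,s,i,j)\in\mu^{-1}(0): r\text{ has pairwise distinct eigenvalues}\}$. Its coordinate ring is $\mathbb{C}[\mu^{-1}(0)^{rss}]=\mathbb{C}[T^*(\mathfrak{b}\times\mathbb{C}^n)^{rss}]/\langle\mu(r,s,i,j)_{\iota\gamma}:\iota\ge\gamma\rangle$, where $T^*(\mathfrak{b}\times\mathbb{C}^n)^{rss}$ is the open affine locus where $r$ has pairwise distinct eigenvalues (the differences $r_{\nu\nu}-r_{\gamma\gamma}$,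 $\nu\neq\gamma$, are inverted). The affine quotient is $\mu^{-1}(0)^{rss}/\!\!/B=\mathrm{Spec}\,\mathbb{C}[\mu^{-1}(0)^{rss}]^B$. For $r=(r_{\iota\gamma})\in\mathfrak{b}$, $l_k(r)=r-r_{kk}I_n$ (empty product is $I_n$). The trace of an upper triangular matrix times $s\in\mathfrak{g}/\mathfrak{u}$ is well defined. $\Delta_n\subset\mathbb{C}^{2n}$ is such that $$\mathbb{C}^{2n}\setminus\Delta_n=\{(x_{11},\ldots,x_{nn},y_{11},\ldots,y_{nn}): x_{\iota\iota}\ne x_{\gamma\gamma}\text{ whenever }\iota\ne\gamma\}.$$ *)

theory Defs
  imports "HOL-Analysis.Analysis" "HOL-Algebra.QuotRing"
begin

section \<open>Affine varieties through functions and through coordinate rings\<close>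

text \<open>
  The \<open>\<complex>\<close>-algebra of functions on \<open>X\<close> generated by the functions in \<open>G\<close>. Functions are
  extensional (\<^const>\<open>undefined\<close> off \<open>X\<close>), so that equality in the algebra is equality on \<open>X\<close>.
\<close>

inductive_set gen_functions :: "'x set \<Rightarrow> ('x \<Rightarrow> complex) set \<Rightarrow> ('x \<Rightarrow> complex) set"
  for X :: "'x set" and G :: "('x \<Rightarrow> complex) set" where
  const: "(\<lambda>x\<in>X. c) \<in> gen_functions X G"
| gen: "g \<in> G \<Longrightarrow> (\<lambda>x\<in>X. g x) \<in> gen_functions X G"
| add: "f \<in> gen_functions X G \<Longrightarrow> g \<in> gen_functions X G \<Longrightarrow> (\<lambda>x\<in>X. f x + g x) \<in> gen_functions X G"
| mult: "f \<in> gen_functions X G \<Longrightarrow> g \<in> gen_functions X G \<Longrightarrow> (\<lambda>x\<in>X. f x * g x) \<in> gen_functions X G"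

definition function_ring :: "'x set \<Rightarrow> ('x \<Rightarrow> complex) set \<Rightarrow> ('x \<Rightarrow> complex) ring" where
  "function_ring X F =
    \<lparr>carrier = F, mult = (\<lambda>f g. \<lambda>x\<in>X. f x * g x), one = (\<lambda>x\<in>X. 1),
     zero = (\<lambda>x\<in>X. 0), add = (\<lambda>f g. \<lambda>x\<in>X. f x + g x)\<rparr>"

text \<open>The Zariski topology on \<open>X\<close>, with the nonvanishing loci of the functions in \<open>F\<close> as a basis.\<close>

definition zariski :: "'x set \<Rightarrow> ('x \<Rightarrow> complex) set \<Rightarrow> 'x topology" where
  "zariski X F = topology_generated_by {{x \<in> X. f x \<noteq> 0} | f. f \<in> F}"

text \<open>
  The affine variety \<open>Spec R\<close> of a finitely generated \<open>\<complex>\<close>-algebra \<open>R\<close>, in the classical sense: its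
  points are the closed points, that is, the maximal ideals. With \<open>\<kappa> :: \<complex> \<rightarrow> R\<close> the structure map,
  the value of \<open>f \<in> R\<close> at the point \<open>m\<close> is the unique \<open>c\<close> with \<open>f - \<kappa> c \<in> m\<close>.
\<close>

definition Spec_points :: "('a, 'b) ring_scheme \<Rightarrow> 'a set set" where
  "Spec_points R = {m. maximalideal m R}"

definition Spec_topology :: "('a, 'b) ring_scheme \<Rightarrow> 'a set topology" where
  "Spec_topology R = topology_generated_by {{m \<in> Spec_points R. f \<notin> m} | f. f \<in> carrier R}"

definition value_at :: "('a, 'b) ring_scheme \<Rightarrow> (complex \<Rightarrow> 'a) \<Rightarrow> 'a \<Rightarrow> 'a set \<Rightarrow> complex" where
  "value_at R \<kappa> f m = (THE c. f \<ominus>\<^bsub>R\<^esub> \<kappa> c \<in> m)"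

definition Spec_functions :: "('a, 'b) ring_scheme \<Rightarrow> (complex \<Rightarrow> 'a) \<Rightarrow> ('a set \<Rightarrow> complex) set" where
  "Spec_functions R \<kappa> = {value_at R \<kappa> f | f. f \<in> carrier R}"

text \<open>
  \<open>\<phi>\<close> is regular on the open set \<open>U\<close> if it is locally a quotient of global functions from \<open>F\<close>.
  An isomorphism of varieties is a homeomorphism that identifies the sheaves of regular functions.
\<close>

definition regular_on ::
  "'x topology \<Rightarrow> ('x \<Rightarrow> complex) set \<Rightarrow> 'x set \<Rightarrow> ('x \<Rightarrow> complex) \<Rightarrow> bool" where
  "regular_on T F U \<phi> \<longleftrightarrow>
    (\<forall>x\<in>U. \<exists>V f g. openin T V \<and> x \<in> V \<and> V \<subseteq> U \<and> f \<in> F \<and> g \<in> F \<and>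
      (\<forall>y\<in>V. g y \<noteq> 0 \<and> \<phi> y = f y / g y))"

definition variety_isomorphism ::
  "'x topology \<Rightarrow> ('x \<Rightarrow> complex) set \<Rightarrow> 'y topology \<Rightarrow> ('y \<Rightarrow> complex) set \<Rightarrow> ('x \<Rightarrow> 'y) \<Rightarrow> bool" where
  "variety_isomorphism T F T' F' p \<longleftrightarrow>
    homeomorphic_map T T' p \<and>
    (\<forall>V \<phi>. openin T' V \<longrightarrow>
      (regular_on T' F' V \<phi> \<longleftrightarrow> regular_on T F {x \<in> topspace T. p x \<in> V} (\<phi> \<circ> p)))"


section \<open>The Borel group and its action on the cotangent bundle\<close>

text \<open>
  \<open>n = CARD('n)\<close>, and the finite linear order \<open>'n\<close> plays the role of \<open>1 < \<dots> < n\<close>.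
\<close>

type_synonym 'n sqmat = "complex^'n^'n"

definition upper_tri :: "'n::{finite,wellorder} sqmat \<Rightarrow> bool" where
  "upper_tri A \<longleftrightarrow> (\<forall>a c. c < a \<longrightarrow> A $ a $ c = 0)"

definition lower_tri :: "'n::{finite,wellorder} sqmat \<Rightarrow> bool" where
  "lower_tri A \<longleftrightarrow> (\<forall>a c. a < c \<longrightarrow> A $ a $ c = 0)"

definition Borel :: "('n::{finite,wellorder} sqmat) set" where
  "Borel = {b. upper_tri b \<and> invertible b}"

text \<open>
  Elements of \<open>\<bb>\<^sup>* = \<gg>/\<uu>\<close> are represented by their unique lower triangular representative;
  \<open>dual_class v\<close> is the representative of the class of \<open>v\<close>.
\<close>

definition dual_class :: "'n::{finite,wellorder} sqmat \<Rightarrow> 'n sqmat" where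
  "dual_class v = (\<chi> a c. if c \<le> a then v $ a $ c else 0)"

type_synonym 'n point = "'n sqmat \<times> 'n sqmat \<times> (complex^'n) \<times> (complex^'n)"

definition act :: "'n::{finite,wellorder} sqmat \<Rightarrow> 'n point \<Rightarrow> 'n point" where
  "act b = (\<lambda>(r, s, i, j).
    (b ** r ** matrix_inv b, dual_class (b ** s ** matrix_inv b), b *v i, j v* matrix_inv b))"

definition moment :: "'n::{finite,wellorder} point \<Rightarrow> 'n sqmat" where
  "moment = (\<lambda>(r, s, i, j). dual_class (r ** s - s ** r + (\<chi> a c. i $ a * j $ c)))"

definition distinct_eigenvalues :: "'n::finite sqmat \<Rightarrow> bool" where
  "distinct_eigenvalues r \<longleftrightarrow> card {z. \<exists>v. v \<noteq> 0 \<and> r *v v = z *s v} = CARD('n)"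

definition cotangent_rss :: "'n::{finite,wellorder} point set" where
  "cotangent_rss = {(r, s, i, j). upper_tri r \<and> lower_tri s \<and> distinct_eigenvalues r}"

definition mu_zero_rss :: "'n::{finite,wellorder} point set" where
  "mu_zero_rss = {x \<in> cotangent_rss. moment x = 0}"


section \<open>Coordinate rings, invariants and the affine quotient\<close>

text \<open>
  The regular functions on \<open>T\<^sup>*(\<bb> \<times> \<complex>\<^sup>n)\<^sup>r\<^sup>s\<^sup>s\<close>: the polynomial ring in the coordinates, with the
  differences of the diagonal entries of \<open>r\<close> inverted. As the locus is Zariski dense in an affine
  space over \<open>\<complex>\<close>, this localized polynomial ring is the same as its ring of functions on the locus.
\<close>

definition cotangent_coords :: "('n::{finite,wellorder} point \<Rightarrow> complex) set" where
  "cotangent_coords =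
    {(\<lambda>(r, s, i, j). r $ a $ c) | a c. a \<le> c} \<union> {(\<lambda>(r, s, i, j). s $ a $ c) | a c. c \<le> a} \<union>
    {(\<lambda>(r, s, i, j). i $ a) | a. True} \<union> {(\<lambda>(r, s, i, j). j $ a) | a. True} \<union>
    {(\<lambda>(r, s, i, j). inverse (r $ a $ a - r $ c $ c)) | a c. a \<noteq> c}"

definition cotangent_functions :: "('n::{finite,wellorder} point \<Rightarrow> complex) set" where
  "cotangent_functions = gen_functions cotangent_rss cotangent_coords"

definition cotangent_ring :: "('n::{finite,wellorder} point \<Rightarrow> complex) ring" where
  "cotangent_ring = function_ring cotangent_rss cotangent_functions"

text \<open>The ideal generated by the components of the moment map; it is not replaced by its radical.\<close>

definition moment_ideal :: "('n::{finite,wellorder} point \<Rightarrow> complex) set" where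
  "moment_ideal = Idl\<^bsub>cotangent_ring\<^esub> {(\<lambda>x\<in>cotangent_rss. moment x $ a $ c) | a c. c \<le> a}"

definition mu_ring :: "('n::{finite,wellorder} point \<Rightarrow> complex) set ring" where
  "mu_ring = cotangent_ring Quot moment_ideal"

definition act_function ::
  "'n::{finite,wellorder} sqmat \<Rightarrow> ('n point \<Rightarrow> complex) \<Rightarrow> 'n point \<Rightarrow> complex" where
  "act_function b f = (\<lambda>x\<in>cotangent_rss. f (act (matrix_inv b) x))"

text \<open>
  \<open>\<complex>[\<mu>\<^sup>-\<^sup>1(0)\<^sup>r\<^sup>s\<^sup>s]\<^sup>B\<close>. An element of the quotient ring is a coset, and \<open>b\<close> maps a coset to its image.
\<close>

definition invariant_ring :: "('n::{finite,wellorder} point \<Rightarrow> complex) set ring" where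
  "invariant_ring =
    mu_ring\<lparr>carrier := {C \<in> carrier mu_ring. \<forall>b\<in>Borel. act_function b ` C = C}\<rparr>"

definition invariant_const :: "complex \<Rightarrow> ('n::{finite,wellorder} point \<Rightarrow> complex) set" where
  "invariant_const c = moment_ideal +>\<^bsub>cotangent_ring\<^esub> (\<lambda>x\<in>cotangent_rss. c)"

abbreviation quotient_points :: "('n::{finite,wellorder} point \<Rightarrow> complex) set set set" where
  "quotient_points \<equiv> Spec_points invariant_ring"

abbreviation quotient_topology :: "('n::{finite,wellorder} point \<Rightarrow> complex) set set topology" where
  "quotient_topology \<equiv> Spec_topology invariant_ring"

abbreviation quotient_functions ::
  "(('n::{finite,wellorder} point \<Rightarrow> complex) set set \<Rightarrow> complex) set" where
  "quotient_functions \<equiv> Spec_functions invariant_ring invariant_const"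

text \<open>
  The image of \<open>x\<close> in the affine quotient: the ideal of the invariants that vanish at \<open>x\<close>. (On
  \<^const>\<open>mu_zero_rss\<close> all representatives of a coset have the same value.)
\<close>

definition quotient_map_pt ::
  "'n::{finite,wellorder} point \<Rightarrow> ('n point \<Rightarrow> complex) set set" where
  "quotient_map_pt x = {C \<in> carrier invariant_ring. \<forall>f\<in>C. f x = 0}"

definition orbit_closure :: "'n::{finite,wellorder} point \<Rightarrow> 'n point set" where
  "orbit_closure x =
    subtopology (zariski cotangent_rss cotangent_functions) mu_zero_rss
      closure_of ((\<lambda>b. act b x) ` Borel)"


section \<open>The target and the map\<close>

text \<open>\<open>\<complex>\<^sup>2\<^sup>n - \<Delta>\<^sub>n\<close>, an open affine subvariety of \<open>\<complex>\<^sup>2\<^sup>n\<close>\<close>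

type_synonym 'n config_point = "(complex^'n) \<times> (complex^'n)"

definition config_space :: "'n::finite config_point set" where
  "config_space = {(x, y). \<forall>a c. a \<noteq> c \<longrightarrow> x $ a \<noteq> x $ c}"

definition config_coords :: "('n::finite config_point \<Rightarrow> complex) set" where
  "config_coords =
    {(\<lambda>(x, y). x $ a) | a. True} \<union> {(\<lambda>(x, y). y $ a) | a. True} \<union>
    {(\<lambda>(x, y). inverse (x $ a - x $ c)) | a c. a \<noteq> c}"

definition config_functions :: "('n::finite config_point \<Rightarrow> complex) set" where
  "config_functions = gen_functions config_space config_coords"

definition config_ring :: "('n::finite config_point \<Rightarrow> complex) ring" where
  "config_ring = function_ring config_space config_functions"

abbreviation config_topology :: "'n::finite config_point topology" where
  "config_topology \<equiv> zariski config_space config_functions"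

definition l_factor :: "'n::finite \<Rightarrow> 'n sqmat \<Rightarrow> 'n sqmat" where
  "l_factor k r = r - mat (r $ k $ k)"

definition l_product :: "'n::{finite,wellorder} \<Rightarrow> 'n sqmat \<Rightarrow> 'n sqmat" where
  "l_product a r = foldr (\<lambda>k M. l_factor k r ** M) (sorted_list_of_set (UNIV - {a})) (mat 1)"

definition s_prime :: "'n::{finite,wellorder} \<Rightarrow> 'n sqmat \<Rightarrow> 'n sqmat \<Rightarrow> complex" where
  "s_prime a r s = inverse (trace (l_product a r)) * trace (l_product a r ** s)"

definition map_P :: "'n::{finite,wellorder} point \<Rightarrow> 'n config_point" where
  "map_P = (\<lambda>(r, s, i, j). (\<chi> a. r $ a $ a, \<chi> a. s_prime a r s))"

definition comorphism_P ::
  "('n config_point \<Rightarrow> complex) \<Rightarrow> ('n::{finite,wellorder} point \<Rightarrow> complex) set" where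
  "comorphism_P f = moment_ideal +>\<^bsub>cotangent_ring\<^esub> (\<lambda>x\<in>cotangent_rss. f (map_P x))"

end

theory Submission
  imports Defs "HOL-Library.Function_Algebras"
    "HOL-Computational_Algebra.Fundamental_Theorem_Algebra"
begin

text \<open>
  Write \<open>I\<close> for the moment ideal, and let \<open>\<sigma>\<close> send a pair \<open>(x, y)\<close> to the point
  \<open>(diag x, diag y, 0, 0)\<close>. Then \<open>\<sigma>\<close> takes values in \<open>\<mu>\<^sup>-\<^sup>1(0)\<close> and \<open>P \<circ> \<sigma> = id\<close>, so
  \<open>f \<mapsto> f \<circ> P\<close> embeds the functions on the configuration space into the invariants. The substance of the
  theorem is that this embedding is onto: every \<open>f\<close> that is \<open>B\<close>-invariant modulo \<open>I\<close> satisfies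
  \<open>f \<equiv> f \<circ> \<sigma> \<circ> P\<close> modulo \<open>I\<close> (\<open>invariant_normal_form\<close>). As \<open>I\<close> might fail to be radical, it would
  not be enough to compare values at points of \<open>\<mu>\<^sup>-\<^sup>1(0)\<close>; the argument is a chain of congruences.

  \<^item> An upper triangular \<open>r\<close> with distinct diagonal entries is diagonalized by a unipotent matrix \<open>V(r)\<close>
  with entries regular in \<open>r\<close>: row \<open>a\<close> of \<open>V(r)\<close> is row \<open>a\<close> of the spectral projector obtained by
  normalizing \<open>\<Prod>\<^bsub>k \<noteq> a\<^esub> l\<^sub>k(r)\<close>. Invariance concerns constant group elements, but
  \<open>f(b\<cdot>x)\<close> is a finite sum \<open>\<Sum> \<phi>\<^sub>k(b) f\<^sub>k(x)\<close>, and for such sums membership in \<open>I\<close> for all \<open>b\<close> survives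
  the substitution \<open>b = V(r)\<close> (\<open>substitute_parameter\<close>). Hence \<open>f(x) \<equiv> f(V(r)\<cdot>x)\<close>.

  \<^item> When \<open>r\<close> is diagonal, the moment equations read
  \<open>(r\<^bsub>aa\<^esub> - r\<^bsub>cc\<^esub>) s\<^bsub>ac\<^esub> + i\<^sub>a j\<^sub>c = 0\<close> for \<open>c \<le> a\<close>. They determine \<open>s\<close> off the diagonal and give
  \<open>i\<^sub>a j\<^sub>a = 0\<close>.

  \<^item> A one-parameter subgroup of the torus scales \<open>i\<^sub>a\<close> by \<open>t\<close> and \<open>j\<^sub>a\<close> by \<open>t\<^sup>-\<^sup>1\<close>. As \<open>i\<^sub>a j\<^sub>a \<equiv> 0\<close>, the only
  part of \<open>f\<close> of weight zero is its value at \<open>i\<^sub>a = j\<^sub>a = 0\<close>; averaging over roots of unity isolates that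
  part, and invariance says that nothing else is there (\<open>invariant_drop_weight\<close>). Treating the indices
  one after the other kills \<open>i\<close> and \<open>j\<close>, hence also the off-diagonal part of \<open>s\<close>. What remains is
  \<open>\<sigma>(P(x))\<close>, because \<open>s'\<^bsub>aa\<^esub>\<close> is invariant and equals \<open>s\<^bsub>aa\<^esub>\<close> when \<open>r\<close> is diagonal.

  The isomorphism of coordinate rings gives the geometric statements once the maximal ideals of the ring of
  functions on the configuration space are known to be its points (\<open>config_nullstellensatz\<close>). This
  follows from a dimension count: the ring has countable dimension over the uncountable field \<open>\<complex>\<close>.
\<close>

section \<open>Algebras of functions\<close>

text \<open>
  The members of \<open>gen_functions\<close> are extensional. Speaking of restrictions allows functions to be
  written as plain \<open>\<lambda>\<close>-terms.
\<close>

definition regular :: "'x set \<Rightarrow> ('x \<Rightarrow> complex) set \<Rightarrow> ('x \<Rightarrow> complex) \<Rightarrow> bool" where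
  "regular X G f \<longleftrightarrow> restrict f X \<in> gen_functions X G"

lemma regular_cong: "(\<And>x. x \<in> X \<Longrightarrow> f x = g x) \<Longrightarrow> regular X G f \<longleftrightarrow> regular X G g"
  unfolding regular_def by (metis restrict_ext)

lemma gen_functions_extensional: "f \<in> gen_functions X G \<Longrightarrow> f \<in> extensional X"
  by (induction rule: gen_functions.induct) (auto simp: extensional_def)

lemma gen_functions_regular: "f \<in> gen_functions X G \<Longrightarrow> regular X G f"
  unfolding regular_def using gen_functions_extensional[of f X G] by (simp add: extensional_restrict)

lemma regular_const: "regular X G (\<lambda>x. c)"
  unfolding regular_def by (rule gen_functions.const)

lemma regular_gen: "g \<in> G \<Longrightarrow> regular X G g"
  unfolding regular_def by (rule gen_functions.gen)

lemma regular_add: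
  assumes "regular X G f" "regular X G g" shows "regular X G (\<lambda>x. f x + g x)"
proof -
  have "(\<lambda>x\<in>X. restrict f X x + restrict g X x) \<in> gen_functions X G"
    using assms unfolding regular_def by (rule gen_functions.add)
  then show ?thesis unfolding regular_def by (simp cong: restrict_cong)
qed

lemma regular_mult:
  assumes "regular X G f" "regular X G g" shows "regular X G (\<lambda>x. f x * g x)"
proof -
  have "(\<lambda>x\<in>X. restrict f X x * restrict g X x) \<in> gen_functions X G"
    using assms unfolding regular_def by (rule gen_functions.mult)
  then show ?thesis unfolding regular_def by (simp cong: restrict_cong)
qed

lemma regular_uminus: "regular X G f \<Longrightarrow> regular X G (\<lambda>x. - f x)"
  using regular_mult[OF regular_const[of X G "-1"], of f] by simp

lemma regular_diff: "regular X G f \<Longrightarrow> regular X G g \<Longrightarrow> regular X G (\<lambda>x. f x - g x)"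
  using regular_add[OF _ regular_uminus, of X G f g] by simp

lemma regular_sum: "(\<And>k. k \<in> K \<Longrightarrow> regular X G (f k)) \<Longrightarrow> regular X G (\<lambda>x. \<Sum>k\<in>K. f k x)"
  by (induction K rule: infinite_finite_induct) (auto intro: regular_const regular_add)

lemma regular_prod: "(\<And>k. k \<in> K \<Longrightarrow> regular X G (f k)) \<Longrightarrow> regular X G (\<lambda>x. \<Prod>k\<in>K. f k x)"
  by (induction K rule: infinite_finite_induct) (auto intro: regular_const regular_mult)

text \<open>
  The rule \<open>cong\<close> carries the induction from extensional to arbitrary functions.
\<close>

lemma regular_induct [consumes 1, case_names cong const gen add mult]:
  assumes "regular X G f"
    and cong: "\<And>f g. P f \<Longrightarrow> (\<And>x. x \<in> X \<Longrightarrow> f x = g x) \<Longrightarrow> P g"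
    and const: "\<And>c. P (\<lambda>x. c)"
    and gen: "\<And>g. g \<in> G \<Longrightarrow> P g"
    and add: "\<And>f g. regular X G f \<Longrightarrow> P f \<Longrightarrow> regular X G g \<Longrightarrow> P g \<Longrightarrow> P (\<lambda>x. f x + g x)"
    and mult: "\<And>f g. regular X G f \<Longrightarrow> P f \<Longrightarrow> regular X G g \<Longrightarrow> P g \<Longrightarrow> P (\<lambda>x. f x * g x)"
  shows "P f"
proof -
  have "P h" if "h \<in> gen_functions X G" for h
    using that
  proof induction
    case (const c)
    show ?case by (rule cong[OF assms(3)[of c]]) simp
  next
    case (gen g)
    show ?case by (rule cong[OF assms(4)[OF gen]]) simp
  next
    case (add f g)
    show ?case
      by (rule cong[OF assms(5)[OF gen_functions_regular[OF add.hyps(1)] add.IH(1)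
            gen_functions_regular[OF add.hyps(2)] add.IH(2)]]) simp
  next
    case (mult f g)
    show ?case
      by (rule cong[OF assms(6)[OF gen_functions_regular[OF mult.hyps(1)] mult.IH(1)
            gen_functions_regular[OF mult.hyps(2)] mult.IH(2)]]) simp
  qed
  then have "P (restrict f X)" using assms(1) unfolding regular_def by blast
  then show ?thesis by (rule cong) simp
qed

lemma regular_compose:
  assumes f: "regular Y H f"
    and h: "\<And>x. x \<in> X \<Longrightarrow> h x \<in> Y" and gens: "\<And>g. g \<in> H \<Longrightarrow> regular X G (\<lambda>x. g (h x))"
  shows "regular X G (\<lambda>x. f (h x))"
  using f
proof (induction rule: regular_induct)
  case (cong f g)
  have "regular X G (\<lambda>x. f (h x)) \<longleftrightarrow> regular X G (\<lambda>x. g (h x))"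
    by (rule regular_cong) (use cong h in auto)
  then show ?case using cong by simp
next
  case (const c)
  show ?case by (rule regular_const)
next
  case (gen g)
  then show ?case by (rule gens)
next
  case (add f g)
  show ?case by (rule regular_add[OF add.IH])
next
  case (mult f g)
  show ?case by (rule regular_mult[OF mult.IH])
qed

abbreviation function_algebra :: "'x set \<Rightarrow> ('x \<Rightarrow> complex) set \<Rightarrow> ('x \<Rightarrow> complex) ring" where
  "function_algebra X G \<equiv> function_ring X (gen_functions X G)"

lemma carrier_function_algebra: "carrier (function_algebra X G) = gen_functions X G"
  by (simp add: function_ring_def)

lemma restrict_in_algebra: "restrict f X \<in> carrier (function_algebra X G) \<longleftrightarrow> regular X G f"
  by (simp add: function_ring_def regular_def)

lemma algebra_mult: "restrict f X \<otimes>\<^bsub>function_algebra X G\<^esub> restrict g X = (\<lambda>x\<in>X. f x * g x)"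
  by (auto simp add: function_ring_def)

lemma algebra_add: "restrict f X \<oplus>\<^bsub>function_algebra X G\<^esub> restrict g X = (\<lambda>x\<in>X. f x + g x)"
  by (auto simp add: function_ring_def)

lemma in_algebraE:
  assumes "f \<in> carrier (function_algebra X G)"
  obtains g where "f = restrict g X" "regular X G g"
  using assms gen_functions_regular gen_functions_extensional
  by (metis carrier_function_algebra extensional_restrict)

lemma cring_function_algebra: "cring (function_algebra X G)"
proof (rule cringI)
  let ?R = "function_algebra X G"
  show "abelian_group ?R"
  proof (rule abelian_groupI)
    fix f assume "f \<in> carrier ?R"
    then obtain g where g: "f = restrict g X" "regular X G g" by (rule in_algebraE)
    then have "(\<lambda>x\<in>X. - g x) \<in> carrier ?R"
      by (simp add: restrict_in_algebra regular_uminus)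
    moreover have "(\<lambda>x\<in>X. - g x) \<oplus>\<^bsub>?R\<^esub> f = \<zero>\<^bsub>?R\<^esub>"
      by (auto simp: g function_ring_def)
    ultimately show "\<exists>y\<in>carrier ?R. y \<oplus>\<^bsub>?R\<^esub> f = \<zero>\<^bsub>?R\<^esub>" by blast
  qed (simp_all add: function_ring_def gen_functions.intros ac_simps
      extensional_restrict[OF gen_functions_extensional] cong: restrict_cong)
  show "Group.comm_monoid ?R"
    by (rule Group.comm_monoidI)
      (simp_all add: function_ring_def gen_functions.intros ac_simps
      extensional_restrict[OF gen_functions_extensional] cong: restrict_cong)
qed (simp add: function_ring_def algebra_simps cong: restrict_cong)

lemma algebra_uminus:
  assumes "regular X G f"
  shows "\<ominus>\<^bsub>function_algebra X G\<^esub> restrict f X = (\<lambda>x\<in>X. - f x)"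
proof -
  interpret cring "function_algebra X G" by (rule cring_function_algebra)
  have "(\<lambda>x\<in>X. - f x) \<oplus>\<^bsub>function_algebra X G\<^esub> restrict f X = \<zero>\<^bsub>function_algebra X G\<^esub>"
    by (auto simp: function_ring_def)
  then show ?thesis
    using assms by (intro minus_equality) (auto simp: restrict_in_algebra regular_uminus)
qed

lemma algebra_minus:
  assumes "regular X G f" "regular X G g"
  shows "restrict f X \<ominus>\<^bsub>function_algebra X G\<^esub> restrict g X = (\<lambda>x\<in>X. f x - g x)"
  using assms by (simp add: a_minus_def algebra_uminus algebra_add)

context
  fixes X :: "'x set" and G m
  assumes m: "ideal m (function_algebra X G)"
begin

interpretation R: cring "function_algebra X G" by (rule cring_function_algebra)
interpretation ideal m "function_algebra X G" by (rule m)

lemma ideal_regular: "restrict f X \<in> m \<Longrightarrow> regular X G f"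
  using Icarr[of "restrict f X"] by (simp add: restrict_in_algebra)

lemma ideal_memE:
  assumes "f \<in> m" obtains g where "f = restrict g X" "regular X G g" "restrict g X \<in> m"
  using assms in_algebraE[of f X G] Icarr by metis

lemma ideal_zero: "(\<lambda>x\<in>X. 0) \<in> m"
  using zero_closed by (simp add: function_ring_def)

lemma ideal_add: "restrict f X \<in> m \<Longrightarrow> restrict g X \<in> m \<Longrightarrow> (\<lambda>x\<in>X. f x + g x) \<in> m"
  using a_closed[of "restrict f X" "restrict g X"] by (simp add: algebra_add)

lemma ideal_mult: "restrict f X \<in> m \<Longrightarrow> regular X G g \<Longrightarrow> (\<lambda>x\<in>X. g x * f x) \<in> m"
  using I_l_closed[of "restrict f X" "restrict g X"] by (simp add: algebra_mult restrict_in_algebra)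

lemma ideal_uminus: "restrict f X \<in> m \<Longrightarrow> (\<lambda>x\<in>X. - f x) \<in> m"
  using ideal_mult[OF _ regular_const[of X G "-1"], of f] by simp

lemma ideal_diff: "restrict f X \<in> m \<Longrightarrow> restrict g X \<in> m \<Longrightarrow> (\<lambda>x\<in>X. f x - g x) \<in> m"
  using ideal_add[OF _ ideal_uminus, of f g] by simp

lemma ideal_sum:
  "(\<And>k. k \<in> K \<Longrightarrow> restrict (f k) X \<in> m) \<Longrightarrow> (\<lambda>x\<in>X. \<Sum>k\<in>K. f k x) \<in> m"
  by (induction K rule: infinite_finite_induct) (auto intro: ideal_zero ideal_add)

end

lemma regular_zero: "(\<And>x. x \<in> X \<Longrightarrow> f x = 0) \<Longrightarrow> regular X G f"
  using regular_cong[of X f "\<lambda>x. 0" G] regular_const[of X G 0] by simp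

lemma restrict_mem_cong:
  "restrict f X \<in> m \<Longrightarrow> (\<And>x. x \<in> X \<Longrightarrow> f x = g x) \<Longrightarrow> restrict g X \<in> m"
  by (metis restrict_ext)

text \<open>
  The functions with a property that is stable under the ideal operations form an ideal.
\<close>

lemma genideal_induct [consumes 1, case_names carrier cong zero base add mult]:
  assumes "restrict f X \<in> Idl\<^bsub>function_algebra X G\<^esub> S"
    and S: "S \<subseteq> carrier (function_algebra X G)"
    and cong: "\<And>f g. P f \<Longrightarrow> (\<And>x. x \<in> X \<Longrightarrow> f x = g x) \<Longrightarrow> P g"
    and zero: "P (\<lambda>x. 0)"
    and base: "\<And>g. g \<in> S \<Longrightarrow> P g"
    and add: "\<And>f g. P f \<Longrightarrow> P g \<Longrightarrow> P (\<lambda>x. f x + g x)"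
    and mult: "\<And>f g. P f \<Longrightarrow> regular X G g \<Longrightarrow> P (\<lambda>x. g x * f x)"
  shows "P f"
proof -
  let ?R = "function_algebra X G"
  interpret R: cring ?R by (rule cring_function_algebra)
  let ?J = "{h \<in> carrier ?R. P h}"
  have restr: "P (restrict g X)" if "P g" for g
    using that by (rule cong) simp
  have closed: "a \<otimes>\<^bsub>?R\<^esub> x \<in> ?J" if "a \<in> carrier ?R" "x \<in> ?J" for a x
  proof -
    obtain g where g: "a = restrict g X" "regular X G g" using \<open>a \<in> carrier ?R\<close> by (rule in_algebraE)
    have "P (restrict (\<lambda>y. g y * x y) X)"
      using that g(2) by (intro restr mult) auto
    then have "P (a \<otimes>\<^bsub>?R\<^esub> x)"
      by (rule cong) (simp add: g function_ring_def)
    then show ?thesis using that by simp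
  qed
  have J: "ideal ?J ?R"
  proof (rule idealI)
    show "ring ?R" by (rule R.ring_axioms)
    show "subgroup ?J (add_monoid ?R)"
    proof (rule R.add.subgroupI)
      have "P \<zero>\<^bsub>?R\<^esub>" using restr[OF zero] by (simp add: function_ring_def)
      then show "?J \<noteq> {}" using R.zero_closed by blast
      fix h assume h: "h \<in> ?J"
      have neg: "\<ominus>\<^bsub>?R\<^esub> h = (\<ominus>\<^bsub>?R\<^esub> \<one>\<^bsub>?R\<^esub>) \<otimes>\<^bsub>?R\<^esub> h"
        using h by (simp add: R.l_minus)
      show "\<ominus>\<^bsub>?R\<^esub> h \<in> ?J"
        unfolding neg by (rule closed[OF R.a_inv_closed[OF R.one_closed] h])
      fix k assume k: "k \<in> ?J"
      have "P (restrict (\<lambda>x. h x + k x) X)" using h k by (intro restr add) auto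
      then have "P (h \<oplus>\<^bsub>?R\<^esub> k)" by (rule cong) (simp add: function_ring_def)
      then show "h \<oplus>\<^bsub>?R\<^esub> k \<in> ?J" using h k by simp
    qed auto
    fix a x assume "a \<in> ?J" "x \<in> carrier ?R"
    then show "x \<otimes>\<^bsub>?R\<^esub> a \<in> ?J" by (intro closed)
    then show "a \<otimes>\<^bsub>?R\<^esub> x \<in> ?J" using \<open>a \<in> ?J\<close> \<open>x \<in> carrier ?R\<close> by (simp add: R.m_comm)
  qed
  have "S \<subseteq> ?J" using S base by auto
  then have "restrict f X \<in> ?J" using R.genideal_minimal[OF J] assms(1) by blast
  then have "P (restrict f X)" by simp
  then show ?thesis by (rule cong) simp
qed

section \<open>Maximal ideals of countably generated function algebras\<close>

text \<open>
  Gaussian elimination: an unknown with a nonzero coefficient in equation \<open>t\<close> is eliminated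
  together with that equation.
\<close>

lemma underdetermined_system:
  fixes A :: "'c \<Rightarrow> 't \<Rightarrow> complex"
  assumes "finite T" "finite C" "card T < card C"
  shows "\<exists>x. (\<exists>c\<in>C. x c \<noteq> 0) \<and> (\<forall>t\<in>T. (\<Sum>c\<in>C. x c * A c t) = 0)"
  using assms
proof (induction T arbitrary: C A rule: finite_induct)
  case empty
  then have "C \<noteq> {}" by auto
  then obtain c where "c \<in> C" by blast
  then show ?case by (intro exI[of _ "\<lambda>_. 1"]) auto
next
  case (insert t T)
  show ?case
  proof (cases "\<forall>c\<in>C. A c t = 0")
    case True
    have "card T < card C" using insert.hyps insert.prems by simp
    with insert.IH[OF insert.prems(1), of A] obtain x where
      x: "\<exists>c\<in>C. x c \<noteq> 0" "\<forall>t\<in>T. (\<Sum>c\<in>C. x c * A c t) = 0" by blast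
    with True have "\<forall>s\<in>insert t T. (\<Sum>c\<in>C. x c * A c s) = 0" by simp
    with x show ?thesis by blast
  next
    case False
    then obtain d where d: "d \<in> C" "A d t \<noteq> 0" by auto
    define B where "B c s = A c s - A c t / A d t * A d s" for c s
    have "finite (C - {d})" "card T < card (C - {d})"
      using insert.hyps insert.prems d by auto
    then obtain x where x: "\<exists>c\<in>C-{d}. x c \<noteq> 0" "\<And>s. s \<in> T \<Longrightarrow> (\<Sum>c\<in>C-{d}. x c * B c s) = 0"
      using insert.IH[of "C - {d}" B] by blast
    define y where "y c = (if c = d then - (\<Sum>c\<in>C-{d}. x c * A c t / A d t) else x c)" for c
    have eq: "(\<Sum>c\<in>C. y c * A c s) = (\<Sum>c\<in>C-{d}. x c * B c s)" for s
    proof -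
      have "(\<Sum>c\<in>C-{d}. y c * A c s) = (\<Sum>c\<in>C-{d}. x c * A c s)"
        by (rule sum.cong) (auto simp: y_def)
      then have "(\<Sum>c\<in>C. y c * A c s) = y d * A d s + (\<Sum>c\<in>C-{d}. x c * A c s)"
        using sum.remove[OF insert.prems(1) d(1), of "\<lambda>c. y c * A c s"] by simp
      also have "\<dots> = (\<Sum>c\<in>C-{d}. x c * A c s) - (\<Sum>c\<in>C-{d}. x c * A c t / A d t) * A d s"
        by (simp add: y_def)
      also have "\<dots> = (\<Sum>c\<in>C-{d}. x c * A c s - x c * A c t / A d t * A d s)"
        by (simp only: sum_subtractf sum_distrib_right)
      also have "\<dots> = (\<Sum>c\<in>C-{d}. x c * B c s)"
        by (rule sum.cong) (simp_all add: B_def right_diff_distrib)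
      finally show ?thesis .
    qed
    have "\<forall>s\<in>insert t T. (\<Sum>c\<in>C. y c * A c s) = 0"
    proof
      fix s assume "s \<in> insert t T"
      moreover have "B c t = 0" for c using d by (simp add: B_def)
      ultimately show "(\<Sum>c\<in>C. y c * A c s) = 0" using x(2) by (auto simp: eq)
    qed
    moreover have "\<exists>c\<in>C. y c \<noteq> 0" using x(1) by (auto simp: y_def)
    ultimately show ?thesis by blast
  qed
qed

interpretation fun_space: vector_space "\<lambda>(a::complex) (f::'x \<Rightarrow> complex) x. a * f x"
  by standard (auto simp: fun_eq_iff algebra_simps)

definition monomial :: "('x \<Rightarrow> complex) list \<Rightarrow> 'x \<Rightarrow> complex" where
  "monomial l x = prod_list (map (\<lambda>g. g x) l)"

lemma span_closed_under_mult:
  assumes closed: "\<And>f g. f \<in> T \<Longrightarrow> g \<in> T \<Longrightarrow> (\<lambda>x. f x * g x) \<in> T"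
    and "f \<in> fun_space.span T" "g \<in> fun_space.span T"
  shows "(\<lambda>x. f x * g x) \<in> fun_space.span T"
proof -
  have 1: "(\<lambda>x. f x * g x) \<in> fun_space.span T" if "f \<in> T" "g \<in> fun_space.span T" for f g
    using that(2)
  proof (induction rule: fun_space.span_induct_alt)
    case base
    show ?case using fun_space.span_zero[of T] by (simp add: zero_fun_def)
  next
    case (step c h k)
    have "(\<lambda>x. c * (f x * h x)) \<in> fun_space.span T"
      using fun_space.span_scale[OF fun_space.span_base[OF closed[OF that(1) step(1)]]] .
    from fun_space.span_add[OF this step(2)] show ?case
      by (simp add: algebra_simps plus_fun_def)
  qed
  show ?thesis using assms(2)
  proof (induction rule: fun_space.span_induct_alt)
    case base
    show ?case using fun_space.span_zero[of T] by (simp add: zero_fun_def)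
  next
    case (step c h k)
    have "(\<lambda>x. c * (h x * g x)) \<in> fun_space.span T"
      using fun_space.span_scale[OF 1[OF step(1) assms(3)]] .
    from fun_space.span_add[OF this step(2)] show ?case
      by (simp add: algebra_simps plus_fun_def)
  qed
qed

lemma sum_functions_apply: "(\<Sum>t\<in>T. f t) x = (\<Sum>t\<in>T. f t x)"
  for f :: "'t \<Rightarrow> 'x \<Rightarrow> complex"
  by (induction T rule: infinite_finite_induct) auto

text \<open>
  Thus a countably generated algebra has countable dimension.
\<close>

lemma regular_in_monomial_span:
  assumes "regular X G f"
  shows "\<exists>h\<in>fun_space.span (monomial ` lists G). \<forall>x\<in>X. f x = h x"
  using assms
proof (induction rule: regular_induct)
  case (const c)
  have "monomial [] \<in> fun_space.span (monomial ` lists G)"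
    by (intro fun_space.span_base imageI) simp
  then have "(\<lambda>x. c * monomial [] x) \<in> fun_space.span (monomial ` lists G)"
    by (rule fun_space.span_scale)
  moreover have "\<forall>x\<in>X. c = c * monomial [] x" by (simp add: monomial_def)
  ultimately show ?case by (rule bexI[of _ "\<lambda>x. c * monomial [] x", rotated])
next
  case (gen g)
  have "monomial [g] \<in> fun_space.span (monomial ` lists G)"
    by (intro fun_space.span_base imageI) (simp add: gen)
  moreover have "\<forall>x\<in>X. g x = monomial [g] x" by (simp add: monomial_def)
  ultimately show ?case by (rule bexI[of _ "monomial [g]", rotated])
next
  case (add f g)
  then obtain h k where "h\<in>fun_space.span (monomial ` lists G)" "k\<in>fun_space.span (monomial ` lists G)"
    "\<forall>x\<in>X. f x = h x" "\<forall>x\<in>X. g x = k x" by blast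
  then show ?case by (intro bexI[of _ "h + k"]) (auto intro: fun_space.span_add)
next
  case (mult f g)
  then obtain h k where "h\<in>fun_space.span (monomial ` lists G)" "k\<in>fun_space.span (monomial ` lists G)"
    "\<forall>x\<in>X. f x = h x" "\<forall>x\<in>X. g x = k x" by blast
  moreover have "(\<lambda>x. f x * g x) \<in> monomial ` lists G" if "f \<in> monomial ` lists G" "g \<in> monomial ` lists G" for f g
  proof -
    from that obtain l l' where l: "l \<in> lists G" "l' \<in> lists G" "f = monomial l" "g = monomial l'" by blast
    then have "(\<lambda>x. f x * g x) = monomial (l @ l')" by (auto simp: monomial_def)
    moreover have "l @ l' \<in> lists G" using l by simp
    ultimately show ?thesis by (metis imageI)
  qed
  ultimately show ?case
    by (intro bexI[of _ "\<lambda>x. h x * k x"] span_closed_under_mult) auto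
qed auto

text \<open>
  Countably many finite sets of monomials share an uncountable family of functions, so one of
  their spans receives infinitely many members.
\<close>

lemma infinite_regular_in_finite_span:
  assumes "countable G" and "uncountable C" and h: "\<And>c. c \<in> C \<Longrightarrow> regular X G (h c)"
  obtains T D where "finite T" "infinite D" "D \<subseteq> C"
    "\<And>c. c \<in> D \<Longrightarrow> \<exists>k\<in>fun_space.span T. \<forall>x\<in>X. h c x = k x"
proof -
  let ?M = "monomial ` lists G"
  let ?D = "\<lambda>T. {c\<in>C. \<exists>k\<in>fun_space.span T. \<forall>x\<in>X. h c x = k x}"
  have "countable ?M" using assms(1) by simp
  then have cnt: "countable {T. finite T \<and> T \<subseteq> ?M}"
    by (rule countable_Collect_finite_subset)
  have "C \<subseteq> (\<Union>T\<in>{T. finite T \<and> T \<subseteq> ?M}. ?D T)"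
  proof
    fix c assume c: "c \<in> C"
    from regular_in_monomial_span[OF h[OF c]] obtain k where
      k: "k \<in> fun_space.span ?M" "\<forall>x\<in>X. h c x = k x" by blast
    then obtain T r where T: "finite T" "T \<subseteq> ?M" "k = (\<Sum>a\<in>T. (\<lambda>x. r a * a x))"
      by (auto simp: fun_space.span_explicit)
    have "k \<in> fun_space.span T"
      unfolding T(3) by (intro fun_space.span_sum fun_space.span_scale fun_space.span_base)
    with c k T(1,2) show "c \<in> (\<Union>T\<in>{T. finite T \<and> T \<subseteq> ?M}. ?D T)" by auto
  qed
  moreover have "countable (\<Union>T\<in>{T. finite T \<and> T \<subseteq> ?M}. ?D T)"
    if "\<forall>T\<in>{T. finite T \<and> T \<subseteq> ?M}. countable (?D T)"
    using that by (intro countable_UN[OF cnt]) simp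
  ultimately obtain T where T: "finite T" "\<not> countable (?D T)"
    using assms(2) countable_subset by (metis (no_types, lifting) mem_Collect_eq)
  have "infinite (?D T)" using T(2) countable_finite by blast
  show ?thesis
  proof (rule that[OF T(1) \<open>infinite (?D T)\<close>])
    show "?D T \<subseteq> C" by blast
    show "\<exists>k\<in>fun_space.span T. \<forall>x\<in>X. h c x = k x" if "c \<in> ?D T" for c
      using that by simp
  qed
qed

lemma regular_poly: "regular X G g \<Longrightarrow> regular X G (\<lambda>x. poly Q (g x))"
  by (induction Q) (auto intro: regular_const regular_add regular_mult)

text \<open>
  By maximality, \<open>m\<close> and \<open>g\<close> together generate the unit ideal.
\<close>

lemma maximal_ideal_inverse:
  assumes m: "maximalideal m (function_algebra X G)"
    and g: "regular X G g" and not_in: "restrict g X \<notin> m"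
  obtains h where "regular X G h" "(\<lambda>x\<in>X. h x * g x - 1) \<in> m"
proof -
  let ?R = "function_algebra X G"
  interpret R: cring ?R by (rule cring_function_algebra)
  interpret maximalideal m ?R by (rule m)
  let ?J = "m <+>\<^bsub>?R\<^esub> PIdl\<^bsub>?R\<^esub> (restrict g X)"
  have gR: "restrict g X \<in> carrier ?R" using g by (simp add: restrict_in_algebra)
  have J: "ideal ?J ?R"
    by (intro R.add_ideals is_ideal R.cgenideal_ideal gR)
  have mem: "u \<oplus>\<^bsub>?R\<^esub> v \<in> ?J" if "u \<in> m" "v \<in> PIdl\<^bsub>?R\<^esub> (restrict g X)" for u v
    using that by (auto simp: set_add_def')
  have "m \<subseteq> ?J"
  proof
    fix u assume "u \<in> m"
    with mem[OF this, of "\<zero>\<^bsub>?R\<^esub>"] show "u \<in> ?J"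
      using additive_subgroup.zero_closed[OF ideal.axioms(1)[OF R.cgenideal_ideal[OF gR]]] Icarr by simp
  qed
  moreover have "restrict g X \<in> ?J"
    using mem[OF zero_closed R.cgenideal_self[OF gR]] gR by simp
  moreover have "?J \<subseteq> carrier ?R" using ideal.Icarr[OF J] by blast
  ultimately have "?J = carrier ?R" using I_maximal[OF J] not_in by blast
  then have "\<one>\<^bsub>?R\<^esub> \<in> ?J" by simp
  then obtain u v where u: "u \<in> m" and v: "v \<in> PIdl\<^bsub>?R\<^esub> (restrict g X)"
    and uv: "\<one>\<^bsub>?R\<^esub> = u \<oplus>\<^bsub>?R\<^esub> v"
    by (auto simp: set_add_def')
  from v obtain w where w: "w \<in> carrier ?R" "v = w \<otimes>\<^bsub>?R\<^esub> restrict g X"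
    by (auto simp: cgenideal_def)
  obtain h where h: "w = restrict h X" "regular X G h" using w(1) by (rule in_algebraE)
  obtain k where k: "u = restrict k X" using u by (rule ideal_memE[OF is_ideal])
  have "h x * g x - 1 = - k x" if "x \<in> X" for x
  proof -
    have "k x + h x * g x = 1"
      using fun_cong[OF uv, of x] that by (simp add: w h k function_ring_def)
    then have "h x * g x = 1 - k x" by (simp add: eq_diff_eq add.commute)
    then show ?thesis by simp
  qed
  then have "(\<lambda>x\<in>X. h x * g x - 1) = (\<lambda>x\<in>X. - k x)" by (auto cong: restrict_cong)
  moreover have "(\<lambda>x\<in>X. - k x) \<in> m"
    using u unfolding k by (rule ideal_uminus[OF is_ideal])
  ultimately show ?thesis using h(2) that by simp
qed

text \<open>
  Over \<open>\<complex>\<close> the polynomial splits into linear factors, and \<open>m\<close> is prime.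
\<close>

lemma maximal_ideal_root:
  assumes m: "maximalideal m (function_algebra X G)"
    and g: "regular X G g" and Q: "Q \<noteq> 0" "(\<lambda>x\<in>X. poly Q (g x)) \<in> m"
  shows "\<exists>c. (\<lambda>x\<in>X. g x - c) \<in> m"
  using Q
proof (induction "degree Q" arbitrary: Q rule: less_induct)
  case less
  let ?R = "function_algebra X G"
  interpret R: cring ?R by (rule cring_function_algebra)
  interpret maximalideal m ?R by (rule m)
  interpret primeideal m ?R by (rule R.maximalideal_prime[OF m])
  show ?case
  proof (cases "degree Q = 0")
    case True
    then obtain c where c: "Q = [:c:]" by (rule degree_eq_zeroE)
    with less.prems have "c \<noteq> 0" "(\<lambda>x\<in>X. c) \<in> m" by auto
    with ideal_mult[OF is_ideal this(2) regular_const[of X G "inverse c"]]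
    have "\<one>\<^bsub>?R\<^esub> \<in> m" by (simp add: function_ring_def)
    then have "m = carrier ?R" by (rule one_imp_carrier)
    with I_notcarr show ?thesis by blast
  next
    case False
    then have "\<not> constant (poly Q)" by (simp add: constant_degree)
    then obtain z where "poly Q z = 0" using fundamental_theorem_of_algebra by blast
    then obtain Q' where Q': "Q = [:-z, 1:] * Q'" by (auto simp: poly_eq_0_iff_dvd)
    with less.prems have nz: "Q' \<noteq> 0" by auto
    then have deg: "degree Q' < degree Q" unfolding Q' by (subst degree_mult_eq) auto
    have "restrict (\<lambda>x. g x - z) X \<otimes>\<^bsub>?R\<^esub> restrict (\<lambda>x. poly Q' (g x)) X \<in> m"
      using less.prems(2) by (simp add: algebra_mult Q' algebra_simps)
    moreover have "restrict (\<lambda>x. g x - z) X \<in> carrier ?R"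
        "restrict (\<lambda>x. poly Q' (g x)) X \<in> carrier ?R"
      unfolding restrict_in_algebra by (intro regular_diff regular_const regular_poly g)+
    ultimately have "(\<lambda>x\<in>X. g x - z) \<in> m \<or> (\<lambda>x\<in>X. poly Q' (g x)) \<in> m"
      using I_prime by blast
    then show ?thesis using less.hyps[OF deg nz] by blast
  qed
qed

text \<open>
  The Nullstellensatz over an uncountable field. If \<open>g - c\<close> were invertible modulo \<open>m\<close> for every
  \<open>c\<close>, with inverse \<open>h\<^sub>c\<close>, then infinitely many \<open>h\<^sub>c\<close> would lie in one finite-dimensional space and hence be
  linearly dependent. Clearing denominators in a dependence, as in \<open>\<Sum> a\<^sub>c / (g - c) = 0\<close>, yields a
  nonzero polynomial \<open>Q\<close> with \<open>Q(g) \<in> m\<close>.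
\<close>

theorem maximal_ideal_value:
  assumes "countable G" and m: "maximalideal m (function_algebra X G)"
    and g: "regular X G g"
  shows "\<exists>c. (\<lambda>x\<in>X. g x - c) \<in> m"
proof (rule ccontr)
  assume none: "\<nexists>c. (\<lambda>x\<in>X. g x - c) \<in> m"
  have id: "ideal m (function_algebra X G)" using m by (rule maximalideal.axioms(1))
  have "\<exists>h. regular X G h \<and> (\<lambda>x\<in>X. h x * (g x - c) - 1) \<in> m" for c
    using maximal_ideal_inverse[OF m regular_diff[OF g regular_const[of X G c]]] none by blast
  then obtain h where h: "\<And>c. regular X G (h c)"
    and inv: "\<And>c. (\<lambda>x\<in>X. h c x * (g x - c) - 1) \<in> m" by metis
  obtain T D where T: "finite T" and D: "infinite D"
    and span: "\<And>c. c \<in> D \<Longrightarrow> \<exists>k\<in>fun_space.span T. \<forall>x\<in>X. h c x = k x"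
    using infinite_regular_in_finite_span[OF assms(1) uncountable_UNIV_complex, of X h] h by metis
  have "\<exists>A. \<forall>x\<in>X. h c x = (\<Sum>t\<in>T. A t * t x)" if c: "c \<in> D" for c
  proof -
    obtain k where k: "k \<in> fun_space.span T" "\<forall>x\<in>X. h c x = k x" using span[OF c] by blast
    then obtain A where "k = (\<Sum>t\<in>T. (\<lambda>x. A t * t x))"
      using fun_space.span_finite[OF T] by auto
    then have "k x = (\<Sum>t\<in>T. A t * t x)" for x by (simp add: sum_functions_apply)
    with k(2) show ?thesis by auto
  qed
  then obtain A where A: "\<And>c x. c \<in> D \<Longrightarrow> x \<in> X \<Longrightarrow> h c x = (\<Sum>t\<in>T. A c t * t x)" by metis
  obtain C where C: "finite C" "card C = Suc (card T)" "C \<subseteq> D"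
    using infinite_arbitrarily_large[OF D] by metis
  obtain a where a: "\<exists>c\<in>C. a c \<noteq> 0" "\<And>t. t \<in> T \<Longrightarrow> (\<Sum>c\<in>C. a c * A c t) = 0"
    using underdetermined_system[OF T C(1), of A] C(2) by auto
  have relation: "(\<Sum>c\<in>C. a c * h c x) = 0" if "x \<in> X" for x
  proof -
    have "(\<Sum>c\<in>C. a c * h c x) = (\<Sum>c\<in>C. \<Sum>t\<in>T. a c * A c t * t x)"
      using C(3) that by (intro sum.cong) (auto simp: A sum_distrib_left mult.assoc)
    also have "\<dots> = (\<Sum>t\<in>T. (\<Sum>c\<in>C. a c * A c t) * t x)"
      by (subst sum.swap) (simp add: sum_distrib_right)
    finally show ?thesis by (simp add: a(2))
  qed
  \<comment> \<open>The numerator of \<open>\<Sum> a\<^sub>c / (X - c)\<close>; at \<open>c\<close> only its summand of index \<open>c\<close> is nonzero.\<close>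
  define q where "q c = (\<Prod>d\<in>C-{c}. [:-d, 1:])" for c
  define Q where "Q = (\<Sum>c\<in>C. smult (a c) (q c))"
  obtain c where c: "c \<in> C" "a c \<noteq> 0" using a(1) by blast
  have "poly (q d) c = 0" if "d \<in> C" "d \<noteq> c" for d
    using c C(1) that by (auto simp: q_def poly_prod)
  then have "poly Q c = a c * poly (q c) c"
    using c C(1) by (simp add: Q_def poly_sum sum.remove[of C c])
  moreover have "poly (q c) c \<noteq> 0" using C(1) by (auto simp: q_def poly_prod)
  ultimately have "Q \<noteq> 0" using c by auto
  \<comment> \<open>Every factor \<open>h\<^sub>c (g - c) - 1\<close> is in \<open>m\<close>; by the relation among the \<open>h\<^sub>c\<close> the sum is \<open>Q(g)\<close>.\<close>
  have "(\<lambda>x\<in>X. \<Sum>c\<in>C. (- a c * poly (q c) (g x)) * (h c x * (g x - c) - 1)) \<in> m"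
    by (intro ideal_sum[OF id] ideal_mult[OF id inv] regular_mult regular_const regular_poly g)
  moreover have "(\<Sum>c\<in>C. (- a c * poly (q c) (g x)) * (h c x * (g x - c) - 1)) = poly Q (g x)"
    if "x \<in> X" for x
  proof -
    have full: "poly (q c) (g x) * (g x - c) = (\<Prod>d\<in>C. g x - d)" if "c \<in> C" for c
      using C(1) that by (simp add: q_def poly_prod prod.remove[of C c] mult.commute)
    have "(\<Sum>c\<in>C. (- a c * poly (q c) (g x)) * (h c x * (g x - c) - 1))
        = (\<Sum>c\<in>C. a c * poly (q c) (g x) - a c * h c x * (\<Prod>d\<in>C. g x - d))"
      by (rule sum.cong) (simp_all add: full[symmetric] algebra_simps)
    also have "\<dots> = (\<Sum>c\<in>C. a c * poly (q c) (g x)) - (\<Sum>c\<in>C. a c * h c x) * (\<Prod>d\<in>C. g x - d)"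
      by (simp only: sum_subtractf sum_distrib_right)
    finally show ?thesis by (simp add: relation[OF that] Q_def poly_sum)
  qed
  ultimately have "(\<lambda>x\<in>X. poly Q (g x)) \<in> m" by (simp cong: restrict_cong)
  with maximal_ideal_root[OF m g \<open>Q \<noteq> 0\<close>] none show False by blast
qed

section \<open>Triangular matrices\<close>

lemma matrix_entry: "(A ** B) $ a $ c = (\<Sum>k\<in>UNIV. A $ a $ k * B $ k $ c)"
  by (simp add: matrix_matrix_mult_def)

lemma mat_entry: "mat x $ a $ c = (if a = c then x else 0)"
  by (simp add: mat_def)

lemma matrix_diff_ldistrib: "A ** (B - C) = A ** B - A ** (C :: 'a::ring_1^'m^'n)"
  by (simp add: vec_eq_iff matrix_entry right_diff_distrib sum_subtractf)

lemma matrix_diff_rdistrib: "(B - C) ** A = B ** A - (C :: 'a::ring_1^'m^'n) ** A"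
  by (simp add: vec_eq_iff matrix_entry left_diff_distrib sum_subtractf)

lemma matrix_add_rdistrib: "(B + C) ** A = B ** A + (C :: 'a::ring_1^'m^'n) ** A"
  by (simp add: vec_eq_iff matrix_entry distrib_right sum.distrib)

lemma upper_tri_mult: "upper_tri A \<Longrightarrow> upper_tri B \<Longrightarrow> upper_tri (A ** B)"
  unfolding upper_tri_def matrix_entry
  by (intro allI impI sum.neutral ballI) (metis leI less_le_trans mult_eq_0_iff)

lemma upper_tri_mat: "upper_tri (mat x)"
  by (auto simp: upper_tri_def mat_entry)

lemma upper_tri_diff: "upper_tri A \<Longrightarrow> upper_tri B \<Longrightarrow> upper_tri (A - B)"
  by (auto simp: upper_tri_def)

lemma upper_tri_mult_diag:
  assumes "upper_tri A" "upper_tri B" shows "(A ** B) $ a $ a = A $ a $ a * B $ a $ a"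
proof -
  have "A $ a $ k * B $ k $ a = 0" if "k \<noteq> a" for k
    using assms that unfolding upper_tri_def by (metis linorder_neqE mult_eq_0_iff)
  then have "(\<Sum>k\<in>UNIV. A $ a $ k * B $ k $ a) = (\<Sum>k\<in>{a}. A $ a $ k * B $ k $ a)"
    by (intro sum.mono_neutral_right) auto
  then show ?thesis by (simp add: matrix_entry)
qed

text \<open>
  Membership in \<open>\<uu>\<close>, the kernel of \<^const>\<open>dual_class\<close>.
\<close>

definition strict_upper :: "'n::{finite,wellorder} sqmat \<Rightarrow> bool" where
  "strict_upper A \<longleftrightarrow> (\<forall>a c. c \<le> a \<longrightarrow> A $ a $ c = 0)"

lemma strict_upper_mult_left: "upper_tri A \<Longrightarrow> strict_upper B \<Longrightarrow> strict_upper (A ** B)"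
  unfolding upper_tri_def strict_upper_def matrix_entry
  by (intro allI impI sum.neutral ballI) (metis leI order.trans mult_eq_0_iff)

lemma strict_upper_mult_right: "strict_upper A \<Longrightarrow> upper_tri B \<Longrightarrow> strict_upper (A ** B)"
  unfolding upper_tri_def strict_upper_def matrix_entry
  by (intro allI impI sum.neutral ballI) (metis leI le_less_trans mult_eq_0_iff)

lemma strict_upper_diff: "strict_upper A \<Longrightarrow> strict_upper B \<Longrightarrow> strict_upper (A - B)"
  by (auto simp: strict_upper_def)

lemma strict_upper_uminus: "strict_upper A \<Longrightarrow> strict_upper (- A)"
  by (auto simp: strict_upper_def)

lemma dual_class_eq_iff: "dual_class A = dual_class B \<longleftrightarrow> strict_upper (A - B)"
  by (auto simp: dual_class_def strict_upper_def vec_eq_iff)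

lemma dual_class_entry: "dual_class A $ a $ c = (if c \<le> a then A $ a $ c else 0)"
  by (simp add: dual_class_def)

lemma lower_tri_dual_class: "lower_tri (dual_class A)"
  by (auto simp: lower_tri_def dual_class_entry)

lemma dual_class_lower_tri: "lower_tri A \<Longrightarrow> dual_class A = A"
  by (auto simp: lower_tri_def dual_class_entry vec_eq_iff not_le)

lemma dual_class_diff_strict: "strict_upper (A - dual_class A)"
  by (auto simp: strict_upper_def dual_class_entry)

text \<open>
  Conjugation by the Borel group passes to \<open>\<gg>/\<uu>\<close>, because the strictly upper triangular matrices are an
  ideal of the upper triangular ones.
\<close>

lemma dual_class_mult_dual_class:
  assumes "upper_tri A" "upper_tri B"
  shows "dual_class (A ** dual_class S ** B) = dual_class (A ** S ** B)"
proof -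
  have "strict_upper (A ** (S - dual_class S) ** B)"
    using assms by (intro strict_upper_mult_right strict_upper_mult_left dual_class_diff_strict)
  then have "strict_upper (- (A ** (S - dual_class S) ** B))" by (rule strict_upper_uminus)
  then show ?thesis
    by (simp add: dual_class_eq_iff matrix_diff_ldistrib matrix_diff_rdistrib)
qed

lemma trace_mult_strict_upper:
  assumes "upper_tri A" "strict_upper B" shows "trace (A ** B) = 0"
  using strict_upper_mult_left[OF assms] by (simp add: trace_def strict_upper_def)

lemma trace_mult_dual_class:
  assumes "upper_tri A" shows "trace (A ** dual_class S) = trace (A ** S)"
  using trace_mult_strict_upper[OF assms dual_class_diff_strict[of S]]
  by (simp add: matrix_diff_ldistrib trace_sub)

lemma matrix_inv_right: "invertible A \<Longrightarrow> A ** matrix_inv A = mat 1"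
  unfolding invertible_def matrix_inv_def by (metis (mono_tags, lifting) someI_ex)

lemma matrix_inv_left: "invertible A \<Longrightarrow> matrix_inv A ** A = mat 1"
  unfolding invertible_def matrix_inv_def by (metis (mono_tags, lifting) someI_ex)

lemma matrix_inv_unique: "A ** B = mat 1 \<Longrightarrow> matrix_inv A = (B :: 'a::field^'n^'n)"
  by (metis invertible_right_inverse matrix_inv_left matrix_mul_assoc matrix_mul_lid matrix_mul_rid)

lemma invertible_matrix_inv: "invertible A \<Longrightarrow> invertible (matrix_inv A)"
  by (meson invertible_def matrix_inv_left matrix_inv_right)

lemma matrix_inv_matrix_inv: "invertible A \<Longrightarrow> matrix_inv (matrix_inv A) = (A :: 'a::field^'n^'n)"
  by (rule matrix_inv_unique) (rule matrix_inv_left)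

lemma upper_tri_det: "upper_tri A \<Longrightarrow> det A = (\<Prod>a\<in>UNIV. A $ a $ a)"
  by (rule det_upperdiagonal) (simp add: upper_tri_def)

lemma upper_tri_invertible_iff:
  "upper_tri A \<Longrightarrow> invertible A \<longleftrightarrow> (\<forall>a. A $ a $ a \<noteq> 0)"
  by (simp add: invertible_det_nz upper_tri_det)

text \<open>
  In the product \<open>b b\<^sup>-\<^sup>1 = 1\<close>, the lowest nonzero entry below the diagonal in a column of \<open>b\<^sup>-\<^sup>1\<close>
  would be multiplied by a nonzero diagonal entry of \<open>b\<close> only.
\<close>

lemma upper_tri_matrix_inv:
  assumes "b \<in> Borel" shows "upper_tri (matrix_inv b)"
proof (rule ccontr)
  have b: "upper_tri b" "invertible b" using assms by (auto simp: Borel_def)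
  assume "\<not> upper_tri (matrix_inv b)"
  then obtain c where "{a. c < a \<and> matrix_inv b $ a $ c \<noteq> 0} \<noteq> {}" (is "?S \<noteq> {}")
    by (auto simp: upper_tri_def)
  then have "Max ?S \<in> ?S" by (intro Max_in) auto
  then obtain a where a: "a = Max ?S" "c < a" "matrix_inv b $ a $ c \<noteq> 0" by auto
  have "b $ a $ k * matrix_inv b $ k $ c = 0" if "k \<noteq> a" for k
  proof (cases "k < a")
    case True then show ?thesis using b by (simp add: upper_tri_def)
  next
    case False
    with that have "a < k" by simp
    moreover from this have "k \<notin> ?S" using a(1) by (metis Max_ge finite leD)
    ultimately show ?thesis using a(2) by auto
  qed
  then have "(\<Sum>k\<in>UNIV. b $ a $ k * matrix_inv b $ k $ c) = (\<Sum>k\<in>{a}. b $ a $ k * matrix_inv b $ k $ c)"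
    by (intro sum.mono_neutral_right) auto
  moreover have "(b ** matrix_inv b) $ a $ c = 0"
    using a(2) by (simp add: matrix_inv_right[OF b(2)] mat_entry)
  moreover have "b $ a $ a \<noteq> 0" using b upper_tri_invertible_iff by blast
  ultimately show False using a(3) by (simp add: matrix_entry)
qed

lemma matrix_inv_Borel: "b \<in> Borel \<Longrightarrow> matrix_inv b \<in> Borel"
  using upper_tri_matrix_inv[of b] invertible_matrix_inv[of b] by (simp add: Borel_def)

lemma BorelD:
  assumes "b \<in> Borel"
  shows "upper_tri b" "upper_tri (matrix_inv b)" "b ** matrix_inv b = mat 1"
    "matrix_inv b ** b = mat 1" "matrix_inv (matrix_inv b) = b"
  using assms upper_tri_matrix_inv[OF assms]
  by (auto simp: Borel_def matrix_inv_right matrix_inv_left matrix_inv_matrix_inv)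

lemma conj_diag:
  assumes "b \<in> Borel" "upper_tri r"
  shows "(b ** r ** matrix_inv b) $ a $ a = r $ a $ a"
proof -
  note B = BorelD[OF assms(1)]
  have "b $ a $ a * matrix_inv b $ a $ a = 1"
    using upper_tri_mult_diag[OF B(1,2), of a] by (simp add: B mat_entry)
  moreover have "(b ** r ** matrix_inv b) $ a $ a = b $ a $ a * r $ a $ a * matrix_inv b $ a $ a"
    using assms B by (simp add: upper_tri_mult_diag upper_tri_mult)
  ultimately show ?thesis by (simp add: mult.assoc mult.left_commute)
qed

lemma conj_upper_tri:
  "b \<in> Borel \<Longrightarrow> upper_tri r \<Longrightarrow> upper_tri (b ** r ** matrix_inv b)"
  by (simp add: upper_tri_mult BorelD)

lemma distinct_eigenvalues_iff:
  assumes "upper_tri r"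
  shows "distinct_eigenvalues r \<longleftrightarrow> (\<forall>a c. a \<noteq> c \<longrightarrow> r $ a $ a \<noteq> r $ c $ c)"
proof -
  have "(\<exists>v. v \<noteq> 0 \<and> r *v v = z *s v) \<longleftrightarrow> z \<in> range (\<lambda>a. r $ a $ a)" for z
  proof -
    have "(r - mat z) *v v = r *v v - z *s v" for v
      unfolding matrix_vector_mult_diff_rdistrib
      by (simp add: vec_eq_iff matrix_vector_mult_def mat_entry mult_delta_left)
    then have "(\<exists>v. v \<noteq> 0 \<and> r *v v = z *s v) \<longleftrightarrow> \<not> (\<forall>v. (r - mat z) *v v = 0 \<longrightarrow> v = 0)"
      by auto
    \<comment> \<open>For square matrices, injectivity is invertibility, which the diagonal decides.\<close>
    also have "\<dots> \<longleftrightarrow> \<not> invertible (r - mat z)"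
      by (simp add: invertible_left_inverse matrix_left_invertible_ker)
    also have "\<dots> \<longleftrightarrow> z \<in> range (\<lambda>a. r $ a $ a)"
      by (auto simp: upper_tri_invertible_iff[OF upper_tri_diff[OF assms upper_tri_mat]] mat_entry)
    finally show ?thesis .
  qed
  then have "distinct_eigenvalues r \<longleftrightarrow> card (range (\<lambda>a. r $ a $ a)) = CARD('a)"
    by (simp add: distinct_eigenvalues_def)
  also have "\<dots> \<longleftrightarrow> inj (\<lambda>a. r $ a $ a)"
    using eq_card_imp_inj_on[of UNIV "\<lambda>a. r $ a $ a"] card_image[of "\<lambda>a. r $ a $ a" UNIV] by auto
  finally show ?thesis by (auto simp: inj_def)
qed

lemma cotangent_rss_iff:
  "(r, s, i, j) \<in> cotangent_rss \<longleftrightarrow>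
    upper_tri r \<and> lower_tri s \<and> (\<forall>a c. a \<noteq> c \<longrightarrow> r $ a $ a \<noteq> r $ c $ c)"
  by (auto simp: cotangent_rss_def distinct_eigenvalues_iff)

section \<open>Products of the factors l\<close>

text \<open>
  A product over an arbitrary list is accessible to induction; \<^const>\<open>l_product\<close> is the product
  over the increasing list of the indices other than \<open>a\<close>.
\<close>

definition l_list :: "'n::{finite,wellorder} list \<Rightarrow> 'n sqmat \<Rightarrow> 'n sqmat" where
  "l_list xs r = foldr (\<lambda>k M. l_factor k r ** M) xs (mat 1)"

lemma l_list_Nil [simp]: "l_list [] r = mat 1"
  by (simp add: l_list_def)

lemma l_list_Cons [simp]: "l_list (k # xs) r = l_factor k r ** l_list xs r"
  by (simp add: l_list_def)

lemma l_product_l_list: "l_product a r = l_list (sorted_list_of_set (UNIV - {a})) r"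
  by (simp add: l_product_def l_list_def)

lemma l_factor_entry: "l_factor k r $ a $ c = r $ a $ c - (if a = c then r $ k $ k else 0)"
  by (simp add: l_factor_def mat_entry)

lemma l_factor_upper: "upper_tri r \<Longrightarrow> upper_tri (l_factor k r)"
  by (simp add: l_factor_def upper_tri_diff upper_tri_mat)

lemma l_list_upper: "upper_tri r \<Longrightarrow> upper_tri (l_list xs r)"
  by (induction xs) (auto intro: upper_tri_mult upper_tri_mat l_factor_upper)

lemma l_product_upper: "upper_tri r \<Longrightarrow> upper_tri (l_product a r)"
  unfolding l_product_l_list by (rule l_list_upper)

lemma l_list_diag:
  assumes "upper_tri r"
  shows "l_list xs r $ c $ c = (\<Prod>k\<leftarrow>xs. r $ c $ c - r $ k $ k)"
  using assms
  by (induction xs) (auto simp: upper_tri_mult_diag l_list_upper l_factor_upper l_factor_entry mat_entry)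

lemma l_product_diag:
  assumes "upper_tri r"
  shows "l_product a r $ c $ c = (\<Prod>k\<in>UNIV-{a}. r $ c $ c - r $ k $ k)"
  unfolding l_product_l_list l_list_diag[OF assms]
  by (subst prod.distinct_set_conv_list[symmetric]) auto

lemma l_product_diag_other:
  assumes "upper_tri r" "c \<noteq> a"
  shows "l_product a r $ c $ c = 0"
  unfolding l_product_diag[OF assms(1)] using assms(2) by (intro prod_zero) auto

lemma trace_l_product:
  assumes "upper_tri r"
  shows "trace (l_product a r) = (\<Prod>k\<in>UNIV-{a}. r $ a $ a - r $ k $ k)"
proof -
  have "trace (l_product a r) = (\<Sum>c\<in>{a}. l_product a r $ c $ c)"
    unfolding trace_def by (rule sum.mono_neutral_right) (auto simp: l_product_diag_other[OF assms])
  then show ?thesis by (simp add: l_product_diag[OF assms])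
qed

lemma mat_commute: "mat x ** A = A ** (mat x :: 'a::comm_semiring_1^'n^'n)"
  by (simp add: vec_eq_iff matrix_entry mat_entry mult_delta_left mult_delta_right mult.commute)

lemma l_factor_commute: "l_factor k r ** r = r ** l_factor k r"
  by (simp add: l_factor_def matrix_diff_ldistrib matrix_diff_rdistrib mat_commute)

lemma l_factors_commute: "l_factor k r ** l_factor m r = l_factor m r ** l_factor k r"
proof -
  have "l_factor k r ** l_factor m r = l_factor k r ** r - l_factor k r ** mat (r $ m $ m)"
    by (subst (2) l_factor_def) (simp add: matrix_diff_ldistrib)
  also have "\<dots> = r ** l_factor k r - mat (r $ m $ m) ** l_factor k r"
    by (simp only: l_factor_commute mat_commute)
  also have "\<dots> = l_factor m r ** l_factor k r"
    by (simp add: l_factor_def[of m] matrix_diff_rdistrib)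
  finally show ?thesis .
qed

lemma l_list_commute: "l_list xs r ** r = r ** l_list xs r"
proof (induction xs)
  case (Cons k xs)
  have "l_list (k # xs) r ** r = l_factor k r ** (l_list xs r ** r)"
    by (simp add: matrix_mul_assoc)
  also have "\<dots> = (l_factor k r ** r) ** l_list xs r" by (simp add: Cons matrix_mul_assoc)
  finally show ?case by (simp add: l_factor_commute matrix_mul_assoc)
qed simp

lemma l_list_remove1:
  "a \<in> set xs \<Longrightarrow> l_factor a r ** l_list (remove1 a xs) r = l_list xs r"
proof (induction xs)
  case (Cons k xs)
  show ?case
  proof (cases "k = a")
    case False
    with Cons have "l_factor a r ** l_list (remove1 a xs) r = l_list xs r" by simp
    moreover have "l_factor a r ** (l_factor k r ** l_list (remove1 a xs) r)
        = l_factor k r ** (l_factor a r ** l_list (remove1 a xs) r)"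
      by (simp add: matrix_mul_assoc l_factors_commute[of a r k])
    ultimately show ?thesis using False by simp
  qed simp
qed simp

text \<open>
  The Cayley--Hamilton theorem for a triangular matrix, refined for the induction: with decreasing
  \<open>k\<close>, each multiplication by \<open>l\<^sub>k(r)\<close> from the left annihilates row \<open>k\<close> as well, since \<open>l\<^sub>k(r)\<close> is upper
  triangular with vanishing entry at \<open>(k, k)\<close>.
\<close>

lemma l_list_rows_zero:
  assumes "upper_tri r" "sorted_wrt (<) xs" "\<And>k m. k \<in> set xs \<Longrightarrow> k \<le> m \<Longrightarrow> m \<in> set xs" "a \<in> set xs"
  shows "l_list xs r $ a $ c = 0"
  using assms(2-4)
proof (induction xs arbitrary: a c)
  case (Cons k xs)
  have up: "m \<in> set xs" if "l \<in> set xs" "l \<le> m" for l m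
  proof -
    have "m \<in> set (k # xs)" using that Cons.prems(2)[of l m] by simp
    moreover have "k < l" using Cons.prems(1) that by simp
    ultimately show ?thesis using that by auto
  qed
  have "l_factor k r $ a $ m * l_list xs r $ m $ c = 0" for m
  proof (cases "m \<in> set xs")
    case True
    have "l_list xs r $ m $ c = 0"
      by (rule Cons.IH) (use Cons.prems(1) True in \<open>auto intro: up\<close>)
    then show ?thesis by simp
  next
    case False
    then have "m \<le> k" using Cons.prems(2)[of k m] by fastforce
    moreover have "k \<le> a" using Cons.prems(1,3) by auto
    ultimately have "m < a \<or> (m = a \<and> a = k)" by auto
    then show ?thesis using assms(1) by (auto simp: l_factor_entry upper_tri_def)
  qed
  then show ?case unfolding l_list_Cons matrix_entry by (intro sum.neutral) blast
qed simp

text \<open>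
  The product of all \<open>l\<^sub>k(r)\<close> is zero and its factors commute, so the columns and the rows of
  \<open>\<Prod>\<^bsub>k \<noteq> a\<^esub> l\<^sub>k(r)\<close> are right and left eigenvectors of \<open>r\<close>.
\<close>

lemma l_product_eigen:
  assumes "upper_tri r"
  shows "r ** l_product a r = mat (r $ a $ a) ** l_product a r"
    and "l_product a r ** r = mat (r $ a $ a) ** l_product a r"
proof -
  have "l_factor a r ** l_product a r = l_list (sorted_list_of_set UNIV) r"
    unfolding l_product_l_list by (simp add: sorted_list_of_set_remove l_list_remove1)
  also have "\<dots> = 0"
    by (simp add: vec_eq_iff) (intro allI l_list_rows_zero[OF assms]; simp)
  finally show 1: "r ** l_product a r = mat (r $ a $ a) ** l_product a r"
    by (simp add: l_factor_def matrix_diff_rdistrib)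
  show "l_product a r ** r = mat (r $ a $ a) ** l_product a r"
    unfolding 1[symmetric] by (simp add: l_product_l_list l_list_commute)
qed

lemma l_list_conj:
  assumes "b \<in> Borel" "upper_tri r"
  shows "l_list xs (b ** r ** matrix_inv b) = b ** l_list xs r ** matrix_inv b"
proof -
  note B = BorelD[OF assms(1)]
  have f: "l_factor k (b ** r ** matrix_inv b) = b ** l_factor k r ** matrix_inv b" for k
  proof -
    have "b ** mat x ** matrix_inv b = mat x" for x :: complex
      by (metis B(3) mat_commute matrix_mul_assoc matrix_mul_rid)
    then show ?thesis
      by (simp add: l_factor_def conj_diag[OF assms] matrix_diff_ldistrib matrix_diff_rdistrib)
  qed
  show ?thesis
  proof (induction xs)
    case Nil
    then show ?case by (simp add: B)
  next
    case (Cons k xs)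
    have "(b ** l_factor k r ** matrix_inv b) ** (b ** l_list xs r ** matrix_inv b)
      = b ** l_factor k r ** (matrix_inv b ** b) ** l_list xs r ** matrix_inv b"
      by (simp only: matrix_mul_assoc)
    then show ?case using Cons by (simp add: f B matrix_mul_assoc)
  qed
qed

text \<open>
  Conjugation in the Borel group preserves the diagonal of \<open>r\<close>, hence conjugates the \<open>l\<^sub>k(r)\<close>; the
  trace of their product with \<open>s\<close> sees \<open>s\<close> only modulo \<open>\<uu>\<close>.
\<close>

lemma s_prime_conj:
  assumes "b \<in> Borel" "upper_tri r"
  shows "s_prime a (b ** r ** matrix_inv b) (dual_class (b ** s ** matrix_inv b)) = s_prime a r s"
proof -
  note B = BorelD[OF assms(1)]
  have conj: "l_product a (b ** r ** matrix_inv b) = b ** l_product a r ** matrix_inv b"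
    by (simp add: l_product_l_list l_list_conj[OF assms])
  have tr: "trace (b ** M ** matrix_inv b) = trace M" for M
    by (metis B(4) matrix_mul_assoc matrix_mul_rid trace_mul_sym)
  have "trace ((b ** l_product a r ** matrix_inv b) ** dual_class (b ** s ** matrix_inv b))
     = trace ((b ** l_product a r ** matrix_inv b) ** (b ** s ** matrix_inv b))"
    by (intro trace_mult_dual_class conj_upper_tri assms l_product_upper)
  also have "(b ** l_product a r ** matrix_inv b) ** (b ** s ** matrix_inv b)
     = b ** l_product a r ** (matrix_inv b ** b) ** s ** matrix_inv b"
    by (simp only: matrix_mul_assoc)
  also have "\<dots> = b ** (l_product a r ** s) ** matrix_inv b" by (simp add: B matrix_mul_assoc)
  finally show ?thesis by (simp add: s_prime_def conj tr)
qed

lemma l_list_diagonal: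
  assumes "\<And>a c. a \<noteq> c \<Longrightarrow> r $ a $ c = 0" "a \<noteq> c"
  shows "l_list xs r $ a $ c = 0"
  using assms(2)
proof (induction xs arbitrary: a c)
  case (Cons k xs)
  have "l_factor k r $ a $ m * l_list xs r $ m $ c = 0" for m
    using Cons by (cases "m = a") (auto simp: l_factor_entry assms(1))
  then show ?case unfolding l_list_Cons matrix_entry by (intro sum.neutral) blast
qed (simp add: mat_entry)

text \<open>
  For diagonal \<open>r\<close> the product of the \<open>l\<^sub>k(r)\<close> is a multiple of the matrix unit at \<open>(a, a)\<close>.
\<close>

lemma s_prime_diagonal:
  assumes diag: "\<And>a c. a \<noteq> c \<Longrightarrow> r $ a $ c = 0"
    and distinct: "\<And>a c. a \<noteq> c \<Longrightarrow> r $ a $ a \<noteq> r $ c $ c"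
  shows "s_prime a r s = s $ a $ a"
proof -
  have up: "upper_tri r" using diag by (auto simp: upper_tri_def)
  have "l_product a r $ c $ k = (if c = a \<and> k = a then trace (l_product a r) else 0)" for c k
    using l_list_diagonal[of r c k] diag l_product_diag_other[OF up, of c a]
      trace_l_product[OF up, of a] l_product_diag[OF up, of a a]
    by (auto simp: l_product_l_list)
  then have "(l_product a r ** s) $ c $ c = (if c = a then trace (l_product a r) * s $ a $ a else 0)" for c
    by (cases "c = a") (simp_all add: matrix_entry mult_delta_left)
  then have "trace (l_product a r ** s) = trace (l_product a r) * s $ a $ a"
    unfolding trace_def[of "l_product a r ** s"] by simp
  moreover have "trace (l_product a r) \<noteq> 0"
    using distinct by (auto simp: trace_l_product[OF up])
  ultimately show ?thesis by (simp add: s_prime_def)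
qed

section \<open>Diagonalization over the locus of distinct eigenvalues\<close>

definition inverse_gap_product :: "'n::{finite,wellorder} \<Rightarrow> 'n sqmat \<Rightarrow> complex" where
  "inverse_gap_product a r = (\<Prod>k\<in>UNIV-{a}. inverse (r $ a $ a - r $ k $ k))"

text \<open>
  Row \<open>a\<close>, respectively column \<open>a\<close>, of the spectral projector
  \<open>\<Prod>\<^bsub>k \<noteq> a\<^esub> l\<^sub>k(r) / (r\<^bsub>aa\<^esub> - r\<^bsub>kk\<^esub>)\<close>: the left and right eigenvectors of \<open>r\<close> with \<open>a\<close>-th entry \<open>1\<close>.
\<close>

definition row_basis :: "'n::{finite,wellorder} sqmat \<Rightarrow> 'n sqmat" where
  "row_basis r = (\<chi> a c. inverse_gap_product a r * l_product a r $ a $ c)"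

definition column_basis :: "'n::{finite,wellorder} sqmat \<Rightarrow> 'n sqmat" where
  "column_basis r = (\<chi> c a. inverse_gap_product a r * l_product a r $ c $ a)"

definition diag_mat :: "complex^'n::finite \<Rightarrow> 'n sqmat" where
  "diag_mat v = (\<chi> a c. if a = c then v $ a else 0)"

lemma diag_mat_mult: "(diag_mat d ** A) $ a $ c = d $ a * A $ a $ c"
  "(A ** diag_mat d) $ a $ c = A $ a $ c * d $ c"
  by (simp_all add: matrix_entry diag_mat_def mult_delta_left mult_delta_right)

lemma mat_mult_entry: "(mat x ** A) $ a $ c = x * A $ a $ c"
  by (simp add: matrix_entry mat_entry mult_delta_left mult_delta_right)

context
  fixes r :: "'n::{finite,wellorder} sqmat"
  assumes up: "upper_tri r" and distinct: "\<And>a c. a \<noteq> c \<Longrightarrow> r $ a $ a \<noteq> r $ c $ c"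
begin

lemma inverse_gap_product_mult: "inverse_gap_product a r * l_product a r $ a $ a = 1"
  using distinct unfolding inverse_gap_product_def l_product_diag[OF up] prod.distrib[symmetric]
  by (intro prod.neutral) auto

lemma row_basis_upper: "upper_tri (row_basis r)"
  using l_product_upper[OF up] by (simp add: upper_tri_def row_basis_def)

lemma row_basis_mult: "row_basis r ** r = diag_mat (\<chi> a. r $ a $ a) ** row_basis r"
proof -
  have "(row_basis r ** r) $ a $ c = inverse_gap_product a r * (l_product a r ** r) $ a $ c" for a c
    by (simp add: matrix_entry row_basis_def sum_distrib_left mult.assoc)
  then have "(row_basis r ** r) $ a $ c = r $ a $ a * row_basis r $ a $ c" for a c
    by (simp add: l_product_eigen[OF up] mat_mult_entry row_basis_def)
  then show ?thesis
    by (simp add: vec_eq_iff diag_mat_mult)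
qed

lemma row_column_basis: "row_basis r ** column_basis r = mat 1"
proof -
  have "(row_basis r ** column_basis r) $ a $ c = (if a = c then 1 else 0)" for a c
  proof (cases "a = c")
    case False
    \<comment> \<open>With a left eigenvector for \<open>r\<^bsub>aa\<^esub>\<close> and a right one for \<open>r\<^bsub>cc\<^esub>\<close>, their pairing through \<open>r\<close> is computed in two ways.\<close>
    let ?e = "(row_basis r ** column_basis r) $ a $ c"
    have e: "(row_basis r ** M ** column_basis r) $ a $ c
       = inverse_gap_product a r * inverse_gap_product c r * (l_product a r ** M ** l_product c r) $ a $ c" for M
      by (simp add: matrix_entry row_basis_def column_basis_def sum_distrib_left sum_distrib_right algebra_simps)
    have "(row_basis r ** r ** column_basis r) $ a $ c = r $ a $ a * ?e"
      using e[of r] e[of "mat 1"] by (simp add: l_product_eigen[OF up] mat_mult_entry matrix_mul_assoc[symmetric])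
    moreover have "(row_basis r ** r ** column_basis r) $ a $ c = r $ c $ c * ?e"
    proof -
      have "l_product a r ** r ** l_product c r = mat (r $ c $ c) ** (l_product a r ** l_product c r)"
        by (metis l_product_eigen(1)[OF up] mat_commute matrix_mul_assoc)
      then show ?thesis using e[of r] e[of "mat 1"] by (simp add: mat_mult_entry)
    qed
    ultimately have "?e = 0" using distinct[OF False] by auto
    then show ?thesis using False by simp
  next
    case True
    have "(row_basis r ** column_basis r) $ a $ a = row_basis r $ a $ a * column_basis r $ a $ a"
      by (rule upper_tri_mult_diag[OF row_basis_upper])
        (use l_product_upper[OF up] in \<open>simp add: upper_tri_def column_basis_def\<close>)
    then show ?thesis using True inverse_gap_product_mult by (simp add: row_basis_def column_basis_def)
  qed
  then show ?thesis by (simp add: vec_eq_iff mat_entry)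
qed

lemma row_basis_Borel: "row_basis r \<in> Borel"
  using row_basis_upper row_column_basis by (auto simp: Borel_def invertible_right_inverse)

lemma matrix_inv_row_basis: "matrix_inv (row_basis r) = column_basis r"
  by (rule matrix_inv_unique[OF row_column_basis])

lemma row_basis_diagonalizes:
  "row_basis r ** r ** matrix_inv (row_basis r) = diag_mat (\<chi> a. r $ a $ a)"
  by (simp add: row_basis_mult matrix_inv_row_basis matrix_mul_assoc[symmetric] row_column_basis)

end

section \<open>The action and the moment map\<close>

lemma act_cotangent_rss:
  assumes "b \<in> Borel" "x \<in> cotangent_rss" shows "act b x \<in> cotangent_rss"
proof -
  obtain r s i j where x: "x = (r, s, i, j)" by (cases x) auto
  with assms(2) have "upper_tri r" "\<And>a c. a \<noteq> c \<Longrightarrow> r $ a $ a \<noteq> r $ c $ c"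
    by (auto simp: cotangent_rss_iff)
  then show ?thesis
    using assms(1) by (simp add: x act_def cotangent_rss_iff conj_upper_tri lower_tri_dual_class conj_diag)
qed

lemma act_matrix_inv:
  assumes "b \<in> Borel" "x \<in> cotangent_rss" shows "act (matrix_inv b) (act b x) = x"
proof -
  note B = BorelD[OF assms(1)]
  obtain r s i j where x: "x = (r, s, i, j)" by (cases x) auto
  have conj: "matrix_inv b ** (b ** M ** matrix_inv b) ** b = M" for M
  proof -
    have "matrix_inv b ** (b ** M ** matrix_inv b) ** b
      = (matrix_inv b ** b) ** M ** (matrix_inv b ** b)" by (simp only: matrix_mul_assoc)
    then show ?thesis by (simp add: B)
  qed
  have "lower_tri s" using assms(2) by (simp add: x cotangent_rss_iff)
  moreover have "dual_class (matrix_inv b ** dual_class (b ** s ** matrix_inv b) ** b)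
      = dual_class (matrix_inv b ** (b ** s ** matrix_inv b) ** b)"
    by (rule dual_class_mult_dual_class[OF B(2,1)])
  ultimately show ?thesis
    by (simp add: x act_def B conj dual_class_lower_tri matrix_vector_mul_assoc vector_matrix_mul_assoc)
qed

lemma map_P_act:
  assumes "b \<in> Borel" "x \<in> cotangent_rss" shows "map_P (act b x) = map_P x"
proof -
  obtain r s i j where x: "x = (r, s, i, j)" by (cases x) auto
  with assms(2) have "upper_tri r" by (auto simp: cotangent_rss_iff)
  then show ?thesis by (simp add: x act_def map_P_def conj_diag s_prime_conj assms(1))
qed

lemma map_P_config: "x \<in> cotangent_rss \<Longrightarrow> map_P x \<in> config_space"
  by (cases x) (auto simp: map_P_def config_space_def cotangent_rss_iff)

lemma outer_conj:
  "b ** (\<chi> a c. i $ a * j $ c) ** b' = (\<chi> a c. (b *v i) $ a * (j v* b') $ c)"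
  for b b' :: "'n::finite sqmat"
  by (simp add: vec_eq_iff matrix_entry matrix_vector_mult_def vector_matrix_mult_def
      sum_distrib_left sum_distrib_right algebra_simps)

text \<open>
  Replacing \<open>b s b\<^sup>-\<^sup>1\<close> by its lower triangular representative changes it by an element of \<open>\<uu>\<close>, and
  commutators of \<open>\<bb>\<close> with \<open>\<uu>\<close> stay in \<open>\<uu>\<close>.
\<close>

lemma moment_act:
  assumes "b \<in> Borel" "x \<in> cotangent_rss"
  shows "moment (act b x) = dual_class (b ** moment x ** matrix_inv b)"
proof -
  note B = BorelD[OF assms(1)]
  obtain r s i j where x: "x = (r, s, i, j)" by (cases x) auto
  have r: "upper_tri r" using assms(2) by (simp add: x cotangent_rss_iff)
  let ?c = "\<lambda>M. b ** M ** matrix_inv b" and ?o = "\<chi> a c. i $ a * j $ c"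
  define u where "u = ?c s - dual_class (?c s)"
  have mult: "?c M ** ?c N = ?c (M ** N)" for M N
  proof -
    have "?c M ** ?c N = b ** M ** (matrix_inv b ** b) ** N ** matrix_inv b"
      by (simp only: matrix_mul_assoc)
    then show ?thesis by (simp add: B matrix_mul_assoc)
  qed
  have u: "strict_upper u" unfolding u_def by (rule dual_class_diff_strict)
  then have su: "strict_upper (u ** ?c r - ?c r ** u)"
    by (intro strict_upper_diff strict_upper_mult_left strict_upper_mult_right conj_upper_tri assms(1) r)
  have o: "?c ?o = (\<chi> a c. (b *v i) $ a * (j v* matrix_inv b) $ c)" by (rule outer_conj)
  have "?c r ** dual_class (?c s) - dual_class (?c s) ** ?c r + ?c ?o
      = ?c (r ** s - s ** r + ?o) + (u ** ?c r - ?c r ** u)"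
    by (simp add: u_def matrix_diff_ldistrib matrix_diff_rdistrib matrix_add_ldistrib matrix_add_rdistrib mult)
  then have "moment (act b x) = dual_class (?c (r ** s - s ** r + ?o) + (u ** ?c r - ?c r ** u))"
    by (simp add: moment_def act_def x o)
  also have "\<dots> = dual_class (?c (r ** s - s ** r + ?o))"
    using su by (simp add: dual_class_eq_iff)
  also have "\<dots> = dual_class (?c (dual_class (r ** s - s ** r + ?o)))"
    by (rule dual_class_mult_dual_class[OF B(1,2), symmetric])
  finally show ?thesis by (simp add: moment_def x)
qed

lemma moment_diag:
  "moment (diag_mat d, s, i, j) $ a $ c = (if c \<le> a then (d $ a - d $ c) * s $ a $ c + i $ a * j $ c else 0)"
  by (simp add: moment_def dual_class_entry diag_mat_mult algebra_simps)

section \<open>Congruences modulo the moment ideal\<close>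

abbreviation r_of :: "'n point \<Rightarrow> 'n sqmat" where "r_of x \<equiv> fst x"
abbreviation s_of :: "'n point \<Rightarrow> 'n sqmat" where "s_of x \<equiv> fst (snd x)"
abbreviation i_of :: "'n point \<Rightarrow> complex^'n" where "i_of x \<equiv> fst (snd (snd x))"
abbreviation j_of :: "'n point \<Rightarrow> complex^'n" where "j_of x \<equiv> snd (snd (snd x))"

abbreviation reg :: "('n::{finite,wellorder} point \<Rightarrow> complex) \<Rightarrow> bool" where
  "reg \<equiv> regular cotangent_rss cotangent_coords"

text \<open>
  \<open>null f\<close> says that \<open>f\<close> is zero in the coordinate ring of \<open>\<mu>\<^sup>-\<^sup>1(0)\<^sup>r\<^sup>s\<^sup>s\<close>. This is a priori stronger than
  vanishing on that set, as the moment ideal might fail to be radical.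
\<close>

definition null :: "('n::{finite,wellorder} point \<Rightarrow> complex) \<Rightarrow> bool" where
  "null f \<longleftrightarrow> restrict f cotangent_rss \<in> moment_ideal"

lemma cotangent_coords_eq:
  "cotangent_coords = {\<lambda>x. r_of x $ a $ c | a c. a \<le> c} \<union> {\<lambda>x. s_of x $ a $ c | a c. c \<le> a} \<union>
    {\<lambda>x. i_of x $ a | a. True} \<union> {\<lambda>x. j_of x $ a | a. True} \<union>
    {\<lambda>x. inverse (r_of x $ a $ a - r_of x $ c $ c) | a c. a \<noteq> c}"
  by (simp add: cotangent_coords_def case_prod_beta')

lemma cotangent_ring_algebra: "cotangent_ring = function_algebra cotangent_rss cotangent_coords"
  by (simp add: cotangent_ring_def cotangent_functions_def)

lemma cotangent_rssD:
  assumes "x \<in> cotangent_rss"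
  shows "upper_tri (r_of x)" "lower_tri (s_of x)" "\<And>a c. a \<noteq> c \<Longrightarrow> r_of x $ a $ a \<noteq> r_of x $ c $ c"
  using assms by (cases x; simp add: cotangent_rss_iff)+

lemma reg_r: "reg (\<lambda>x. r_of x $ a $ c)"
proof (cases "a \<le> c")
  case True
  then show ?thesis by (intro regular_gen) (auto simp: cotangent_coords_eq)
next
  case False
  show ?thesis
    by (rule regular_zero) (use False cotangent_rssD(1) in \<open>force simp: upper_tri_def not_le\<close>)
qed

lemma reg_s: "reg (\<lambda>x. s_of x $ a $ c)"
proof (cases "c \<le> a")
  case True
  then show ?thesis by (intro regular_gen) (auto simp: cotangent_coords_eq)
next
  case False
  show ?thesis
    by (rule regular_zero) (use False cotangent_rssD(2) in \<open>force simp: lower_tri_def not_le\<close>)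
qed

lemma reg_i: "reg (\<lambda>x. i_of x $ a)"
  by (intro regular_gen) (auto simp: cotangent_coords_eq)

lemma reg_j: "reg (\<lambda>x. j_of x $ a)"
  by (intro regular_gen) (auto simp: cotangent_coords_eq)

lemma reg_gap: "a \<noteq> c \<Longrightarrow> reg (\<lambda>x. inverse (r_of x $ a $ a - r_of x $ c $ c))"
  by (intro regular_gen) (auto simp: cotangent_coords_eq)

lemma moment_entry:
  "moment x $ a $ c = (if c \<le> a then (\<Sum>k\<in>UNIV. r_of x $ a $ k * s_of x $ k $ c)
     - (\<Sum>k\<in>UNIV. s_of x $ a $ k * r_of x $ k $ c) + i_of x $ a * j_of x $ c else 0)"
  by (cases x) (simp add: moment_def dual_class_entry matrix_entry)

lemma reg_moment: "reg (\<lambda>x. moment x $ a $ c)"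
  unfolding moment_entry
  by (cases "c \<le> a") (auto intro!: regular_add regular_diff regular_sum regular_mult regular_const
      reg_r reg_s reg_i reg_j)

abbreviation moment_gens :: "('n::{finite,wellorder} point \<Rightarrow> complex) set" where
  "moment_gens \<equiv> {(\<lambda>x\<in>cotangent_rss. moment x $ a $ c) | a c. c \<le> a}"

lemma moment_gens_carrier:
  "moment_gens \<subseteq> carrier (function_algebra cotangent_rss cotangent_coords)"
  by (auto simp: restrict_in_algebra reg_moment)

lemma moment_ideal_ideal: "ideal moment_ideal (function_algebra cotangent_rss cotangent_coords)"
  unfolding moment_ideal_def cotangent_ring_algebra
  by (rule ring.genideal_ideal[OF cring.axioms(1)[OF cring_function_algebra] moment_gens_carrier])

lemma moment_gens_subset: "moment_gens \<subseteq> moment_ideal"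
  unfolding moment_ideal_def cotangent_ring_algebra
  by (rule ring.genideal_self[OF cring.axioms(1)[OF cring_function_algebra] moment_gens_carrier])

lemma null_cong: "(\<And>x. x \<in> cotangent_rss \<Longrightarrow> f x = g x) \<Longrightarrow> null f \<longleftrightarrow> null g"
  unfolding null_def by (metis restrict_ext)

lemma null_zero: "null (\<lambda>x. 0)"
  unfolding null_def by (rule ideal_zero[OF moment_ideal_ideal])
lemma null_add: "null f \<Longrightarrow> null g \<Longrightarrow> null (\<lambda>x. f x + g x)"
  unfolding null_def by (rule ideal_add[OF moment_ideal_ideal])
lemma null_uminus: "null f \<Longrightarrow> null (\<lambda>x. - f x)"
  unfolding null_def by (rule ideal_uminus[OF moment_ideal_ideal])
lemma null_mult: "reg g \<Longrightarrow> null f \<Longrightarrow> null (\<lambda>x. g x * f x)"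
  unfolding null_def by (rule ideal_mult[OF moment_ideal_ideal])
lemma null_sum: "(\<And>k. k \<in> K \<Longrightarrow> null (f k)) \<Longrightarrow> null (\<lambda>x. \<Sum>k\<in>K. f k x)"
  unfolding null_def by (rule ideal_sum[OF moment_ideal_ideal])
lemma null_reg: "null f \<Longrightarrow> reg f"
  unfolding null_def by (rule ideal_regular[OF moment_ideal_ideal])

lemma null_moment: "null (\<lambda>x. moment x $ a $ c)"
proof (cases "c \<le> a")
  case True
  then show ?thesis using moment_gens_subset unfolding null_def by blast
qed (simp add: moment_entry null_zero)

lemma null_conj_moment:
  assumes "\<And>a c. reg (\<lambda>x. B x $ a $ c)" "\<And>a c. reg (\<lambda>x. B' x $ a $ c)"
  shows "null (\<lambda>x. (B x ** moment x ** B' x) $ a $ c)"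
proof -
  have "null (\<lambda>x. \<Sum>k\<in>UNIV. \<Sum>l\<in>UNIV. (B x $ a $ l * B' x $ k $ c) * moment x $ l $ k)"
    by (intro null_sum null_mult regular_mult assms null_moment)
  moreover have "(\<Sum>k\<in>UNIV. \<Sum>l\<in>UNIV. (B x $ a $ l * B' x $ k $ c) * moment x $ l $ k)
     = (B x ** moment x ** B' x) $ a $ c" for x
    by (simp add: matrix_entry sum_distrib_left sum_distrib_right ac_simps)
  ultimately show ?thesis by simp
qed

lemma null_induct [consumes 1, case_names cong zero moment add mult]:
  assumes "null f"
    and "\<And>f g. P f \<Longrightarrow> (\<And>x. x \<in> cotangent_rss \<Longrightarrow> f x = g x) \<Longrightarrow> P g"
    and "P (\<lambda>x. 0)"
    and "\<And>a c. P (\<lambda>x. moment x $ a $ c)"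
    and "\<And>f g. P f \<Longrightarrow> P g \<Longrightarrow> P (\<lambda>x. f x + g x)"
    and "\<And>f g. P f \<Longrightarrow> reg g \<Longrightarrow> P (\<lambda>x. g x * f x)"
  shows "P f"
  using assms(1) unfolding null_def moment_ideal_def cotangent_ring_algebra
proof (induction rule: genideal_induct)
  case (base g)
  then obtain a c where g: "g = (\<lambda>x\<in>cotangent_rss. moment x $ a $ c)" by blast
  show ?case unfolding g by (rule assms(2)[OF assms(4)[of a c]]) simp
qed (use assms moment_gens_carrier in blast)+

lemma null_vanishes:
  assumes "null f" "x \<in> mu_zero_rss" shows "f x = 0"
  using assms(1)
proof (induction rule: null_induct)
  case (cong f g)
  then show ?case using assms(2) by (auto simp: mu_zero_rss_def)
next
  case (moment a c)
  then show ?case using assms(2) by (auto simp: mu_zero_rss_def)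
qed auto

definition morphism :: "('n::{finite,wellorder} point \<Rightarrow> 'n point) \<Rightarrow> bool" where
  "morphism \<Phi> \<longleftrightarrow> (\<forall>x\<in>cotangent_rss. \<Phi> x \<in> cotangent_rss) \<and>
    (\<forall>g\<in>cotangent_coords. reg (\<lambda>x. g (\<Phi> x)))"

lemma reg_morphism: "reg f \<Longrightarrow> morphism \<Phi> \<Longrightarrow> reg (\<lambda>x. f (\<Phi> x))"
  unfolding morphism_def by (rule regular_compose) auto

text \<open>
  The pullback along \<open>\<Phi>\<close> preserves the moment ideal as soon as it does so on the generators.
\<close>

lemma null_morphism:
  assumes "null f" "morphism \<Phi>" "\<And>a c. null (\<lambda>x. moment (\<Phi> x) $ a $ c)"
  shows "null (\<lambda>x. f (\<Phi> x))"
  using assms(1)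
proof (induction rule: null_induct)
  case (cong f g)
  then have "null (\<lambda>x. f (\<Phi> x)) \<longleftrightarrow> null (\<lambda>x. g (\<Phi> x))"
    by (intro null_cong) (use assms(2) in \<open>auto simp: morphism_def\<close>)
  then show ?case using cong by simp
next
  case (mult f g)
  then show ?case by (intro null_mult reg_morphism[OF _ assms(2)])
qed (auto intro: null_zero null_add assms(3))

lemma null_mult_diff:
  assumes "null (\<lambda>x. f x - f' x)" "null (\<lambda>x. g x - g' x)" "reg g" "reg f'"
  shows "null (\<lambda>x. f x * g x - f' x * g' x)"
proof -
  have "null (\<lambda>x. g x * (f x - f' x) + f' x * (g x - g' x))"
    using assms by (intro null_add null_mult)
  then show ?thesis by (simp add: algebra_simps)
qed

lemma null_add_diff:
  assumes "null (\<lambda>x. f x - f' x)" "null (\<lambda>x. g x - g' x)"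
  shows "null (\<lambda>x. (f x + g x) - (f' x + g' x))"
  using null_add[OF assms] by (simp add: algebra_simps)

lemma null_trans:
  assumes "null (\<lambda>x. f x - g x)" "null (\<lambda>x. g x - h x)"
  shows "null (\<lambda>x. f x - h x)"
  using null_add[OF assms] by simp

lemma null_sym: "null (\<lambda>x. f x - g x) \<Longrightarrow> null (\<lambda>x. g x - f x)"
  using null_uminus[of "\<lambda>x. f x - g x"] by simp

text \<open>
  Congruences are compatible with sums and products, so it suffices to compare coordinates.
\<close>

lemma null_diff_morphisms:
  assumes "reg f" and m: "morphism \<Phi>" "morphism \<Psi>"
    and coords: "\<And>g. g \<in> cotangent_coords \<Longrightarrow> null (\<lambda>x. g (\<Phi> x) - g (\<Psi> x))"
  shows "null (\<lambda>x. f (\<Phi> x) - f (\<Psi> x))"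
  using assms(1)
proof (induction rule: regular_induct)
  case (cong f g)
  then have "null (\<lambda>x. f (\<Phi> x) - f (\<Psi> x)) \<longleftrightarrow> null (\<lambda>x. g (\<Phi> x) - g (\<Psi> x))"
    by (intro null_cong) (use m in \<open>auto simp: morphism_def\<close>)
  then show ?case using cong by simp
next
  case (const c)
  then show ?case by (simp add: null_zero)
next
  case (gen g)
  then show ?case by (rule coords)
next
  case (add f g)
  then show ?case by (intro null_add_diff)
next
  case (mult f g)
  show ?case
    by (rule null_mult_diff[OF mult.IH reg_morphism[OF mult.hyps(2) m(1)] reg_morphism[OF mult.hyps(1) m(2)]])
qed

section \<open>Substituting a regular map for the group element\<close>

text \<open>
  By induction on the number of summands: at a parameter \<open>d\<close> with \<open>\<phi>\<^sub>n(d) \<noteq> 0\<close> the hypothesis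
  expresses \<open>f\<^sub>n\<close> modulo \<open>m\<close> through the other \<open>f\<^sub>i\<close>, which eliminates it for all parameters at once.
\<close>

lemma substitute_parameter_sum:
  fixes \<phi> :: "nat \<Rightarrow> 'b \<Rightarrow> complex"
  assumes m: "ideal m (function_algebra X G)" and v: "v \<in> X \<rightarrow> B"
    and "\<And>b. b \<in> B \<Longrightarrow> (\<lambda>x\<in>X. \<Sum>i<n. \<phi> i b * f i x) \<in> m"
    and "\<And>i. i < n \<Longrightarrow> regular X G (\<lambda>x. \<phi> i (v x))"
  shows "(\<lambda>x\<in>X. \<Sum>i<n. \<phi> i (v x) * f i x) \<in> m"
  using assms(3,4)
proof (induction n arbitrary: \<phi>)
  case 0
  show ?case unfolding lessThan_0 sum.empty by (rule ideal_zero[OF m])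
next
  case (Suc n)
  show ?case
  proof (cases "\<exists>b\<in>B. \<phi> n b \<noteq> 0")
    case False
    have IH: "(\<lambda>x\<in>X. \<Sum>i<n. \<phi> i (v x) * f i x) \<in> m"
    proof (rule Suc.IH)
      fix b assume "b \<in> B"
      show "(\<lambda>x\<in>X. \<Sum>i<n. \<phi> i b * f i x) \<in> m"
        by (rule restrict_mem_cong[OF Suc.prems(1)[OF \<open>b \<in> B\<close>]]) (use False \<open>b \<in> B\<close> in simp)
    qed (use Suc.prems(2) in simp)
    have zero: "\<phi> n (v x) = 0" if "x \<in> X" for x using False v that by auto
    from IH show ?thesis by (rule restrict_mem_cong) (simp add: zero)
  next
    case True
    then obtain d where d: "d \<in> B" "\<phi> n d \<noteq> 0" by blast
    \<comment> \<open>\<open>E\<close> is the relation at \<open>d\<close>, and \<open>\<psi>\<close> are the coefficients after subtracting the multiple of \<open>E\<close> that cancels \<open>f\<^sub>n\<close>.\<close>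
    define E where "E x = (\<Sum>i<Suc n. \<phi> i d * f i x)" for x
    have E: "restrict E X \<in> m" using Suc.prems(1)[OF d(1)] unfolding E_def .
    define \<psi> where "\<psi> i b = \<phi> i b - \<phi> n b / \<phi> n d * \<phi> i d" for i b
    have split: "(\<Sum>i<Suc n. \<phi> i b * f i x) = (\<Sum>i<n. \<psi> i b * f i x) + \<phi> n b / \<phi> n d * E x" for b x
    proof -
      have "\<phi> n b / \<phi> n d * E x = (\<Sum>i<n. \<phi> n b / \<phi> n d * \<phi> i d * f i x) + \<phi> n b * f n x"
        using d(2) by (simp add: E_def distrib_left sum_distrib_left mult.assoc)
      then show ?thesis by (simp add: \<psi>_def left_diff_distrib sum_subtractf)
    qed
    have "(\<lambda>x\<in>X. \<Sum>i<n. \<psi> i (v x) * f i x) \<in> m"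
    proof (rule Suc.IH)
      fix b assume b: "b \<in> B"
      have "(\<lambda>x\<in>X. (\<Sum>i<Suc n. \<phi> i b * f i x) - \<phi> n b / \<phi> n d * E x) \<in> m"
        by (intro ideal_diff[OF m] ideal_mult[OF m] Suc.prems(1) b E regular_const)
      then show "(\<lambda>x\<in>X. \<Sum>i<n. \<psi> i b * f i x) \<in> m"
        by (rule restrict_mem_cong) (simp only: split add_diff_cancel_right')
    next
      fix i assume "i < n"
      then show "regular X G (\<lambda>x. \<psi> i (v x))"
        using regular_diff[OF Suc.prems(2)[of i] regular_mult[OF Suc.prems(2)[of n]
              regular_const[of X G "\<phi> i d / \<phi> n d"]]]
        by (simp add: \<psi>_def)
    qed
    moreover have "(\<lambda>x\<in>X. \<phi> n (v x) / \<phi> n d * E x) \<in> m"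
      using ideal_mult[OF m E regular_mult[OF Suc.prems(2)[of n] regular_const[of X G "inverse (\<phi> n d)"]]]
      by (rule restrict_mem_cong) (simp_all add: divide_inverse)
    ultimately show ?thesis unfolding split by (rule ideal_add[OF m])
  qed
qed

text \<open>
  Families with separated variables. The regularity of \<open>\<phi> \<circ> v\<close> makes the substitution of \<open>v x\<close> for
  the parameter meaningful in the algebra.
\<close>

definition separated :: "'x set \<Rightarrow> ('x \<Rightarrow> complex) set \<Rightarrow> 'b set \<Rightarrow> ('x \<Rightarrow> 'b) \<Rightarrow> ('b \<Rightarrow> 'x \<Rightarrow> complex) \<Rightarrow> bool" where
  "separated X G B v F \<longleftrightarrow> (\<exists>L. (\<forall>(\<phi>, f)\<in>set L. regular X G (\<lambda>x. \<phi> (v x)) \<and> regular X G f) \<and>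
     (\<forall>b\<in>B. \<forall>x\<in>X. F b x = (\<Sum>(\<phi>, f)\<leftarrow>L. \<phi> b * f x)))"

lemma substitute_parameter:
  assumes "separated X G B v F" and m: "ideal m (function_algebra X G)" and v: "v \<in> X \<rightarrow> B"
    and F: "\<And>b. b \<in> B \<Longrightarrow> (\<lambda>x\<in>X. F b x) \<in> m"
  shows "(\<lambda>x\<in>X. F (v x) x) \<in> m"
proof -
  obtain L where L: "\<And>\<phi> f. (\<phi>, f) \<in> set L \<Longrightarrow> regular X G (\<lambda>x. \<phi> (v x)) \<and> regular X G f"
    and sum: "\<And>b x. b \<in> B \<Longrightarrow> x \<in> X \<Longrightarrow> F b x = (\<Sum>(\<phi>, f)\<leftarrow>L. \<phi> b * f x)"
    using assms(1) unfolding separated_def by blast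
  define \<phi> f where "\<phi> i = fst (L ! i)" and "f i = snd (L ! i)" for i
  have eq: "F b x = (\<Sum>i<length L. \<phi> i b * f i x)" if "b \<in> B" "x \<in> X" for b x
    using that by (simp add: sum sum_list_sum_nth \<phi>_def f_def case_prod_beta atLeast0LessThan)
  have "(\<lambda>x\<in>X. \<Sum>i<length L. \<phi> i (v x) * f i x) \<in> m"
  proof (rule substitute_parameter_sum[OF m v])
    fix b assume "b \<in> B"
    show "(\<lambda>x\<in>X. \<Sum>i<length L. \<phi> i b * f i x) \<in> m"
      by (rule restrict_mem_cong[OF F[OF \<open>b \<in> B\<close>]]) (rule eq[OF \<open>b \<in> B\<close>])
  next
    fix i assume "i < length L"
    then have "(\<phi> i, f i) \<in> set L" by (simp add: \<phi>_def f_def)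
    then show "regular X G (\<lambda>x. \<phi> i (v x))" using L by blast
  qed
  then show ?thesis
    by (rule restrict_mem_cong) (use eq v in \<open>auto simp: Pi_iff\<close>)
qed

lemma separated_regular:
  assumes "separated X G B v F" and v: "v \<in> X \<rightarrow> B"
  shows "regular X G (\<lambda>x. F (v x) x)"
proof -
  obtain L where L: "\<forall>(\<phi>, f)\<in>set L. regular X G (\<lambda>x. \<phi> (v x)) \<and> regular X G f"
    and sum: "\<And>b x. b \<in> B \<Longrightarrow> x \<in> X \<Longrightarrow> F b x = (\<Sum>(\<phi>, f)\<leftarrow>L. \<phi> b * f x)"
    using assms(1) unfolding separated_def by blast
  have "regular X G (\<lambda>x. \<Sum>(\<phi>, f)\<leftarrow>L. \<phi> (v x) * f x)"
    using L by (induction L) (auto intro!: regular_const regular_add regular_mult)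
  moreover have "regular X G (\<lambda>x. F (v x) x) \<longleftrightarrow> regular X G (\<lambda>x. \<Sum>(\<phi>, f)\<leftarrow>L. \<phi> (v x) * f x)"
    by (rule regular_cong) (use v in \<open>intro sum; auto\<close>)
  ultimately show ?thesis by simp
qed

lemma separated_regular_fixed:
  assumes "separated X G B v F" "b \<in> B" shows "regular X G (F b)"
proof -
  obtain L where L: "\<forall>(\<phi>, f)\<in>set L. regular X G (\<lambda>x. \<phi> (v x)) \<and> regular X G f"
    and sum: "\<And>b x. b \<in> B \<Longrightarrow> x \<in> X \<Longrightarrow> F b x = (\<Sum>(\<phi>, f)\<leftarrow>L. \<phi> b * f x)"
    using assms(1) unfolding separated_def by blast
  have "regular X G (\<lambda>x. \<Sum>(\<phi>, f)\<leftarrow>L. \<phi> b * f x)"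
    using L by (induction L) (auto intro!: regular_const regular_add regular_mult)
  moreover have "regular X G (F b) \<longleftrightarrow> regular X G (\<lambda>x. \<Sum>(\<phi>, f)\<leftarrow>L. \<phi> b * f x)"
    by (rule regular_cong) (rule sum[OF assms(2)])
  ultimately show ?thesis by simp
qed

lemma separated_cong:
  "(\<And>b x. b \<in> B \<Longrightarrow> x \<in> X \<Longrightarrow> F b x = F' b x) \<Longrightarrow> separated X G B v F \<longleftrightarrow> separated X G B v F'"
  unfolding separated_def by (auto cong: ball_cong)

lemma separated_function: "regular X G f \<Longrightarrow> separated X G B v (\<lambda>b. f)"
  unfolding separated_def by (intro exI[of _ "[(\<lambda>b. 1, f)]"]) (auto intro: regular_const)

lemma separated_parameter: "regular X G (\<lambda>x. \<phi> (v x)) \<Longrightarrow> separated X G B v (\<lambda>b x. \<phi> b)"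
  unfolding separated_def by (intro exI[of _ "[(\<phi>, \<lambda>x. 1)]"]) (auto intro: regular_const)

lemma separated_add:
  assumes "separated X G B v F" "separated X G B v F'"
  shows "separated X G B v (\<lambda>b x. F b x + F' b x)"
proof -
  obtain L L' where "\<forall>(\<phi>, f)\<in>set L. regular X G (\<lambda>x. \<phi> (v x)) \<and> regular X G f"
    "\<forall>b\<in>B. \<forall>x\<in>X. F b x = (\<Sum>(\<phi>, f)\<leftarrow>L. \<phi> b * f x)"
    "\<forall>(\<phi>, f)\<in>set L'. regular X G (\<lambda>x. \<phi> (v x)) \<and> regular X G f"
    "\<forall>b\<in>B. \<forall>x\<in>X. F' b x = (\<Sum>(\<phi>, f)\<leftarrow>L'. \<phi> b * f x)"
    using assms unfolding separated_def by blast
  then show ?thesis unfolding separated_def by (intro exI[of _ "L @ L'"]) auto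
qed

lemma separated_mult:
  assumes "separated X G B v F" "separated X G B v F'"
  shows "separated X G B v (\<lambda>b x. F b x * F' b x)"
proof -
  obtain L L' where L: "\<forall>(\<phi>, f)\<in>set L. regular X G (\<lambda>x. \<phi> (v x)) \<and> regular X G f"
    "\<forall>b\<in>B. \<forall>x\<in>X. F b x = (\<Sum>(\<phi>, f)\<leftarrow>L. \<phi> b * f x)"
    "\<forall>(\<phi>, f)\<in>set L'. regular X G (\<lambda>x. \<phi> (v x)) \<and> regular X G f"
    "\<forall>b\<in>B. \<forall>x\<in>X. F' b x = (\<Sum>(\<phi>, f)\<leftarrow>L'. \<phi> b * f x)"
    using assms unfolding separated_def by blast
  define M where "M L = concat (map (\<lambda>(\<phi>, f). map (\<lambda>(\<psi>, g). (\<lambda>b. \<phi> b * \<psi> b, \<lambda>x. f x * g x)) L') L)"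
    for L :: "(('b \<Rightarrow> complex) \<times> ('a \<Rightarrow> complex)) list"
  have "(\<Sum>(\<phi>, f)\<leftarrow>M L. \<phi> b * f x) = (\<Sum>(\<phi>, f)\<leftarrow>L. \<phi> b * f x) * (\<Sum>(\<phi>, f)\<leftarrow>L'. \<phi> b * f x)" for b x
  proof (induction L)
    case Nil
    then show ?case by (simp add: M_def)
  next
    case (Cons p L)
    obtain \<phi> f where p: "p = (\<phi>, f)" by (cases p)
    have "(\<Sum>(\<phi>, f)\<leftarrow>map (\<lambda>(\<psi>, g). (\<lambda>b. \<phi> b * \<psi> b, \<lambda>x. f x * g x)) L'. \<phi> b * f x)
      = \<phi> b * f x * (\<Sum>(\<phi>, f)\<leftarrow>L'. \<phi> b * f x)"
      by (induction L') (auto simp: algebra_simps)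
    then show ?case using Cons by (simp add: M_def p distrib_right)
  qed
  moreover have "\<forall>(\<phi>, f)\<in>set (M L). regular X G (\<lambda>x. \<phi> (v x)) \<and> regular X G f"
    using L(1,3) by (fastforce simp: M_def intro!: regular_mult)
  ultimately show ?thesis unfolding separated_def using L(2,4) by (intro exI[of _ "M L"]) auto
qed

lemma separated_sum:
  "(\<And>k. k \<in> K \<Longrightarrow> separated X G B v (F k)) \<Longrightarrow> separated X G B v (\<lambda>b x. \<Sum>k\<in>K. F k b x)"
  by (induction K rule: infinite_finite_induct)
    (auto intro: separated_add separated_function[OF regular_const])

section \<open>Reduction to diagonal r\<close>

lemma act_components:
  "r_of (act b x) = b ** r_of x ** matrix_inv b"
  "s_of (act b x) = dual_class (b ** s_of x ** matrix_inv b)"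
  "i_of (act b x) = b *v i_of x"
  "j_of (act b x) = j_of x v* matrix_inv b"
  by (cases x; simp add: act_def)+

abbreviation diagonalizer :: "'n::{finite,wellorder} point \<Rightarrow> 'n sqmat" where
  "diagonalizer x \<equiv> row_basis (r_of x)"

lemma diagonalizer_Borel: "diagonalizer \<in> cotangent_rss \<rightarrow> Borel"
  using row_basis_Borel cotangent_rssD(1,3) by blast

lemma reg_l_list: "reg (\<lambda>x. l_list ks (r_of x) $ a $ c)"
proof (induction ks arbitrary: a c)
  case Nil
  then show ?case by (simp add: regular_const)
next
  case (Cons k ks)
  have "reg (\<lambda>x. l_factor k (r_of x) $ a $ m)" for m
    unfolding l_factor_entry by (cases "a = m") (auto intro!: regular_diff reg_r)
  then show ?case unfolding l_list_Cons matrix_entry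
    by (intro regular_sum regular_mult Cons)
qed

lemma reg_inverse_gap_product: "reg (\<lambda>x. inverse_gap_product a (r_of x))"
  unfolding inverse_gap_product_def by (intro regular_prod reg_gap) auto

lemma reg_diagonalizer: "reg (\<lambda>x. diagonalizer x $ a $ c)"
  unfolding row_basis_def by (simp add: l_product_l_list regular_mult reg_inverse_gap_product reg_l_list)

lemma reg_matrix_inv_diagonalizer: "reg (\<lambda>x. matrix_inv (diagonalizer x) $ c $ a)"
proof -
  have "reg (\<lambda>x. matrix_inv (diagonalizer x) $ c $ a) \<longleftrightarrow> reg (\<lambda>x. column_basis (r_of x) $ c $ a)"
    by (intro regular_cong) (simp add: matrix_inv_row_basis cotangent_rssD)
  then show ?thesis
    by (simp add: column_basis_def l_product_l_list regular_mult reg_inverse_gap_product reg_l_list)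
qed

lemma coords_cases:
  assumes "g \<in> cotangent_coords"
  obtains (r) a c where "g = (\<lambda>x. r_of x $ a $ c)" | (s) a c where "g = (\<lambda>x. s_of x $ a $ c)" "c \<le> a"
    | (i) a where "g = (\<lambda>x. i_of x $ a)" | (j) a where "g = (\<lambda>x. j_of x $ a)"
    | (gap) a c where "a \<noteq> c" "g = (\<lambda>x. inverse (r_of x $ a $ a - r_of x $ c $ c))"
  using assms unfolding cotangent_coords_eq
  by (elim UnE CollectE exE conjE) (rule that; assumption)+

abbreviation sep :: "('n::{finite,wellorder} sqmat \<Rightarrow> 'n point \<Rightarrow> complex) \<Rightarrow> bool" where
  "sep \<equiv> separated cotangent_rss cotangent_coords Borel diagonalizer"

lemma sep_conj:
  assumes "\<And>a c. reg (\<lambda>x. M x $ a $ c)"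
  shows "sep (\<lambda>b x. (b ** M x ** matrix_inv b) $ a $ c)"
  unfolding matrix_entry
  by (intro separated_sum separated_mult separated_function assms
      separated_parameter[of _ _ "\<lambda>b. b $ _ $ _"] separated_parameter[of _ _ "\<lambda>b. matrix_inv b $ _ $ _"]
      reg_diagonalizer reg_matrix_inv_diagonalizer)

text \<open>
  The entries of \<open>b r b\<^sup>-\<^sup>1\<close> are sums of products of entries of \<open>b\<close>, \<open>r\<close> and \<open>b\<^sup>-\<^sup>1\<close>, and the inverted
  differences of diagonal entries do not depend on \<open>b\<close>.
\<close>

lemma separated_act:
  assumes "reg f" shows "sep (\<lambda>b x. f (act b x))"
  using assms
proof (induction rule: regular_induct)
  case (cong f g)
  have "sep (\<lambda>b x. f (act b x)) \<longleftrightarrow> sep (\<lambda>b x. g (act b x))"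
    by (intro separated_cong cong(2) act_cotangent_rss)
  then show ?case using cong(1) by simp
next
  case (const c)
  show ?case by (rule separated_function[OF regular_const])
next
  case (gen g)
  from gen show ?case
  proof (cases rule: coords_cases)
    case (r a c)
    then show ?thesis by (simp add: act_components sep_conj reg_r)
  next
    case (s a c)
    then show ?thesis by (simp add: act_components sep_conj reg_s dual_class_entry)
  next
    case (i a)
    have "sep (\<lambda>b x. \<Sum>k\<in>UNIV. b $ a $ k * i_of x $ k)"
      by (intro separated_sum separated_mult separated_function reg_i
          separated_parameter[of _ _ "\<lambda>b. b $ _ $ _"] reg_diagonalizer)
    then show ?thesis by (simp add: i act_components matrix_vector_mult_def)
  next
    case (j a)
    have "sep (\<lambda>b x. \<Sum>k\<in>UNIV. j_of x $ k * matrix_inv b $ k $ a)"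
      by (intro separated_sum separated_mult separated_function reg_j
          separated_parameter[of _ _ "\<lambda>b. matrix_inv b $ _ $ _"] reg_matrix_inv_diagonalizer)
    then show ?thesis by (simp add: j act_components vector_matrix_mult_def)
  next
    case (gap a c)
    have "sep (\<lambda>b x. g (act b x)) \<longleftrightarrow> sep (\<lambda>b x. g x)"
      by (intro separated_cong) (simp add: gap act_components conj_diag cotangent_rssD)
    then show ?thesis using separated_function[OF regular_gen[OF gen]] by simp
  qed
next
  case (add f g)
  show ?case by (rule separated_add[OF add.IH])
next
  case (mult f g)
  show ?case by (rule separated_mult[OF mult.IH])
qed

definition diagonalized :: "'n::{finite,wellorder} point \<Rightarrow> 'n point" where
  "diagonalized x = act (diagonalizer x) x"

text \<open>
  The coset of \<open>f\<close> modulo the moment ideal is \<open>B\<close>-invariant.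
\<close>

definition invariant_mod_moment :: "('n::{finite,wellorder} point \<Rightarrow> complex) \<Rightarrow> bool" where
  "invariant_mod_moment f \<longleftrightarrow> reg f \<and> (\<forall>b\<in>Borel. null (\<lambda>x. f (act b x) - f x))"

lemma morphism_diagonalized: "morphism diagonalized"
  unfolding morphism_def
proof (intro conjI ballI)
  show "diagonalized x \<in> cotangent_rss" if "x \<in> cotangent_rss" for x
    unfolding diagonalized_def using diagonalizer_Borel that by (intro act_cotangent_rss) auto
  show "reg (\<lambda>x. g (diagonalized x))" if "g \<in> cotangent_coords" for g
    unfolding diagonalized_def
    by (rule separated_regular[OF separated_act[OF regular_gen[OF that]] diagonalizer_Borel])
qed

lemma invariant_diagonalized:
  assumes "invariant_mod_moment f" shows "null (\<lambda>x. f (diagonalized x) - f x)"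
proof -
  have "reg f" and inv: "\<And>b. b \<in> Borel \<Longrightarrow> null (\<lambda>x. f (act b x) - f x)"
    using assms by (auto simp: invariant_mod_moment_def)
  have "sep (\<lambda>b x. f (act b x) + - f x)"
    by (intro separated_add separated_act separated_function regular_uminus \<open>reg f\<close>)
  then have "sep (\<lambda>b x. f (act b x) - f x)" by simp
  then show ?thesis unfolding null_def diagonalized_def
    by (rule substitute_parameter[OF _ moment_ideal_ideal diagonalizer_Borel])
      (use inv in \<open>simp add: null_def\<close>)
qed

lemma null_moment_diagonalized: "null (\<lambda>x. moment (diagonalized x) $ a $ c)"
proof -
  have "null (\<lambda>x. (diagonalizer x ** moment x ** matrix_inv (diagonalizer x)) $ a $ c)"
    by (intro null_conj_moment reg_diagonalizer reg_matrix_inv_diagonalizer)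
  moreover have "null (\<lambda>x. moment (diagonalized x) $ a $ c) \<longleftrightarrow>
     null (\<lambda>x. if c \<le> a then (diagonalizer x ** moment x ** matrix_inv (diagonalizer x)) $ a $ c else 0)"
    using diagonalizer_Borel
    by (intro null_cong) (auto simp: diagonalized_def moment_act dual_class_entry Pi_iff)
  ultimately show ?thesis by (cases "c \<le> a") (simp_all add: null_zero)
qed

lemma r_of_diagonalized:
  "x \<in> cotangent_rss \<Longrightarrow> r_of (diagonalized x) = diag_mat (\<chi> a. r_of x $ a $ a)"
  by (simp add: diagonalized_def act_components row_basis_diagonalizes cotangent_rssD)

abbreviation diag_i :: "'n::{finite,wellorder} \<Rightarrow> 'n point \<Rightarrow> complex" where
  "diag_i a x \<equiv> i_of (diagonalized x) $ a"
abbreviation diag_j :: "'n::{finite,wellorder} \<Rightarrow> 'n point \<Rightarrow> complex" where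
  "diag_j a x \<equiv> j_of (diagonalized x) $ a"
abbreviation inv_gap :: "'n::{finite,wellorder} \<Rightarrow> 'n \<Rightarrow> 'n point \<Rightarrow> complex" where
  "inv_gap a c x \<equiv> inverse (r_of x $ a $ a - r_of x $ c $ c)"

lemma moment_diagonalized:
  assumes "x \<in> cotangent_rss"
  shows "moment (diagonalized x) $ a $ c = (if c \<le> a then
    (r_of x $ a $ a - r_of x $ c $ c) * s_of (diagonalized x) $ a $ c + diag_i a x * diag_j c x else 0)"
proof -
  have "diagonalized x = (diag_mat (\<chi> a. r_of x $ a $ a), s_of (diagonalized x),
      i_of (diagonalized x), j_of (diagonalized x))"
    using r_of_diagonalized[OF assms] by (metis prod.collapse)
  then have "moment (diagonalized x) $ a $ c = moment (diag_mat (\<chi> a. r_of x $ a $ a), s_of (diagonalized x),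
      i_of (diagonalized x), j_of (diagonalized x)) $ a $ c"
    by (rule arg_cong)
  then show ?thesis by (simp only: moment_diag vec_lambda_beta)
qed

lemma null_diag_i_diag_j: "null (\<lambda>x. diag_i a x * diag_j a x)"
proof -
  have "null (\<lambda>x. moment (diagonalized x) $ a $ a) \<longleftrightarrow> null (\<lambda>x. diag_i a x * diag_j a x)"
    by (rule null_cong) (simp add: moment_diagonalized)
  then show ?thesis by (simp add: null_moment_diagonalized)
qed

text \<open>
  After diagonalization, the moment equations express the off-diagonal entries of \<open>s\<close> through \<open>i\<close>
  and \<open>j\<close>. In \<open>scaled \<zeta> \<eta> x\<close> these entries are replaced by their solutions, and \<open>i\<close>, \<open>j\<close> are scaled
  coordinatewise. For \<open>\<zeta> = \<eta> = 1\<close> this is congruent to \<open>diagonalized x\<close>; for \<open>\<zeta> = \<eta> = 0\<close> it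
  depends on \<open>P x\<close> only; and torus elements move between different scalings.
\<close>

definition scaled :: "('n::{finite,wellorder} \<Rightarrow> complex) \<Rightarrow> ('n \<Rightarrow> complex) \<Rightarrow> 'n point \<Rightarrow> 'n point" where
  "scaled \<zeta> \<eta> x = (diag_mat (\<chi> a. r_of x $ a $ a),
     \<chi> a c. if a = c then s_of (diagonalized x) $ a $ a
       else if c < a then - (\<zeta> a * diag_i a x) * (\<eta> c * diag_j c x) * inv_gap a c x else 0,
     \<chi> a. \<zeta> a * diag_i a x, \<chi> a. \<eta> a * diag_j a x)"

lemma reg_diag_i: "reg (diag_i a)"
  using reg_morphism[OF reg_i morphism_diagonalized] .
lemma reg_diag_j: "reg (diag_j a)"
  using reg_morphism[OF reg_j morphism_diagonalized] .
lemma reg_s_diagonalized: "reg (\<lambda>x. s_of (diagonalized x) $ a $ c)"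
  using reg_morphism[OF reg_s morphism_diagonalized] .

lemma diag_mat_entry: "diag_mat v $ a $ c = (if a = c then v $ a else 0)"
  by (simp add: diag_mat_def)

lemma morphism_scaled: "morphism (scaled \<zeta> \<eta>)"
  unfolding morphism_def
proof (intro conjI ballI)
  show "scaled \<zeta> \<eta> x \<in> cotangent_rss" if "x \<in> cotangent_rss" for x
    using cotangent_rssD[OF that]
    by (auto simp: scaled_def cotangent_rss_iff upper_tri_def lower_tri_def diag_mat_entry)
  fix g :: "'a point \<Rightarrow> complex" assume "g \<in> cotangent_coords"
  then show "reg (\<lambda>x. g (scaled \<zeta> \<eta> x))"
  proof (cases rule: coords_cases)
    case (r a c)
    then show ?thesis by (cases "a = c") (auto simp: scaled_def diag_mat_entry regular_const reg_r)
  next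
    case (s a c)
    show ?thesis
    proof (cases "a = c")
      case False
      then have "c < a" using s(2) by simp
      from False have "reg (\<lambda>x. - (\<zeta> a * diag_i a x) * (\<eta> c * diag_j c x) * inv_gap a c x)"
        by (intro regular_mult regular_uminus reg_diag_i reg_diag_j reg_gap regular_const)
      then show ?thesis using False s(1) \<open>c < a\<close> by (simp add: scaled_def)
    qed (simp add: s scaled_def reg_s_diagonalized)
  next
    case (i a)
    then show ?thesis by (auto simp: scaled_def intro!: regular_mult reg_diag_i regular_const)
  next
    case (j a)
    then show ?thesis by (auto simp: scaled_def intro!: regular_mult reg_diag_j regular_const)
  next
    case (gap a c)
    then show ?thesis by (simp add: scaled_def diag_mat_entry reg_gap)
  qed
qed

lemma null_moment_scaled: "null (\<lambda>x. moment (scaled \<zeta> \<eta> x) $ a $ c)"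
proof -
  have "moment (scaled \<zeta> \<eta> x) $ a $ c = (if a = c then (\<zeta> a * \<eta> a) * (diag_i a x * diag_j a x) else 0)"
    if "x \<in> cotangent_rss" for x
    using cotangent_rssD(3)[OF that, of a c]
    by (auto simp: scaled_def moment_diag field_simps)
  then have "null (\<lambda>x. moment (scaled \<zeta> \<eta> x) $ a $ c) \<longleftrightarrow>
      null (\<lambda>x. if a = c then (\<zeta> a * \<eta> a) * (diag_i a x * diag_j a x) else 0)"
    by (rule null_cong)
  then show ?thesis
    by (cases "a = c") (simp_all add: null_zero null_mult[OF regular_const null_diag_i_diag_j])
qed

text \<open>
  The difference of the two off-diagonal entries of \<open>s\<close> is a multiple of an entry of the moment
  map.
\<close>

lemma null_diagonalized_scaled:
  assumes "reg f" shows "null (\<lambda>x. f (diagonalized x) - f (scaled (\<lambda>_. 1) (\<lambda>_. 1) x))"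
  using assms morphism_diagonalized morphism_scaled
proof (rule null_diff_morphisms)
  fix g :: "'a point \<Rightarrow> complex" assume "g \<in> cotangent_coords"
  then show "null (\<lambda>x. g (diagonalized x) - g (scaled (\<lambda>_. 1) (\<lambda>_. 1) x))"
  proof (cases rule: coords_cases)
    case (r a c)
    have "null (\<lambda>x. g (diagonalized x) - g (scaled (\<lambda>_. 1) (\<lambda>_. 1) x)) \<longleftrightarrow> null (\<lambda>x::'a point. 0)"
      by (rule null_cong) (simp add: r scaled_def r_of_diagonalized)
    then show ?thesis by (simp add: null_zero)
  next
    case (s a c)
    show ?thesis
    proof (cases "a = c")
      case True
      then show ?thesis by (simp add: s scaled_def null_zero)
    next
      case False
      have "null (\<lambda>x. g (diagonalized x) - g (scaled (\<lambda>_. 1) (\<lambda>_. 1) x)) \<longleftrightarrow>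
          null (\<lambda>x. inv_gap a c x * moment (diagonalized x) $ a $ c)"
      proof (rule null_cong)
        fix x :: "'a point" assume x: "x \<in> cotangent_rss"
        have "c < a" using False s(2) by simp
        moreover have "r_of x $ a $ a - r_of x $ c $ c \<noteq> 0"
          using cotangent_rssD(3)[OF x False] by simp
        ultimately show "g (diagonalized x) - g (scaled (\<lambda>_. 1) (\<lambda>_. 1) x)
            = inv_gap a c x * moment (diagonalized x) $ a $ c"
          using False by (simp add: s scaled_def moment_diagonalized[OF x] field_simps)
      qed
      then show ?thesis using False by (simp add: null_mult reg_gap null_moment_diagonalized)
    qed
  next
    case (gap a c)
    have "null (\<lambda>x. g (diagonalized x) - g (scaled (\<lambda>_. 1) (\<lambda>_. 1) x)) \<longleftrightarrow> null (\<lambda>x::'a point. 0)"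
      by (rule null_cong) (simp add: gap scaled_def r_of_diagonalized)
    then show ?thesis by (simp add: null_zero)
  qed (simp_all add: scaled_def null_zero)
qed

section \<open>Torus weights\<close>

definition torus :: "'n::{finite,wellorder} \<Rightarrow> complex \<Rightarrow> 'n sqmat" where
  "torus a t = diag_mat (\<chi> k. if k = a then t else 1)"

lemma torus_mult: "t \<noteq> 0 \<Longrightarrow> torus a t ** torus a (inverse t) = mat 1"
  by (simp add: vec_eq_iff torus_def diag_mat_mult) (simp add: diag_mat_entry mat_entry)

lemma torus_Borel: "t \<noteq> 0 \<Longrightarrow> torus a t \<in> Borel"
  using torus_mult[of t a]
  by (auto simp: Borel_def invertible_right_inverse upper_tri_def torus_def diag_mat_entry)

lemma matrix_inv_torus: "t \<noteq> 0 \<Longrightarrow> matrix_inv (torus a t) = torus a (inverse t)"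
  by (rule matrix_inv_unique[OF torus_mult])

lemma diag_mat_vector:
  "diag_mat v *v w = (\<chi> k. v $ k * w $ k)" "w v* diag_mat v = (\<chi> k. w $ k * v $ k)"
  by (simp_all add: vec_eq_iff matrix_vector_mult_def vector_matrix_mult_def diag_mat_def
      mult_delta_left mult_delta_right)

lemma act_torus_scaled:
  assumes "x \<in> cotangent_rss" "t \<noteq> 0"
  shows "act (torus a t) (scaled \<zeta> \<eta> x) = scaled (\<zeta>(a := t * \<zeta> a)) (\<eta>(a := inverse t * \<eta> a)) x"
proof -
  show ?thesis using assms(2)
    unfolding act_def scaled_def prod.case matrix_inv_torus[OF assms(2)] unfolding torus_def
    by (auto simp: diag_mat_vector vec_eq_iff diag_mat_mult diag_mat_entry dual_class_entry)
qed

lemma invariant_torus: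
  assumes "invariant_mod_moment f" "t \<noteq> 0"
  shows "null (\<lambda>x. f (scaled (\<zeta>(a := t * \<zeta> a)) (\<eta>(a := inverse t * \<eta> a)) x) - f (scaled \<zeta> \<eta> x))"
proof -
  have "null (\<lambda>x. f (act (torus a t) x) - f x)"
    using assms torus_Borel by (auto simp: invariant_mod_moment_def)
  from null_morphism[OF this morphism_scaled null_moment_scaled]
  have "null (\<lambda>x. f (act (torus a t) (scaled \<zeta> \<eta> x)) - f (scaled \<zeta> \<eta> x))" .
  moreover have "null (\<lambda>x. f (act (torus a t) (scaled \<zeta> \<eta> x)) - f (scaled \<zeta> \<eta> x)) \<longleftrightarrow>
      null (\<lambda>x. f (scaled (\<zeta>(a := t * \<zeta> a)) (\<eta>(a := inverse t * \<eta> a)) x) - f (scaled \<zeta> \<eta> x))"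
    by (rule null_cong) (simp add: act_torus_scaled assms)
  ultimately show ?thesis by simp
qed

text \<open>
  Polynomials in a weight parameter with regular coefficients. The bound on the degrees is uniform
  in the point, so that one root of unity serves for all points.
\<close>

definition poly_family :: "('n::{finite,wellorder} point \<Rightarrow> complex poly) \<Rightarrow> bool" where
  "poly_family p \<longleftrightarrow> (\<forall>k. reg (\<lambda>x. coeff (p x) k)) \<and> (\<exists>N. \<forall>x. degree (p x) \<le> N)"

lemma poly_family_const: "reg f \<Longrightarrow> poly_family (\<lambda>x. [:f x:])"
  unfolding poly_family_def
proof (intro conjI allI exI)
  fix k assume "reg f"
  then show "reg (\<lambda>x. coeff [:f x:] k)" by (cases k) (auto simp: regular_const)
qed simp

lemma poly_family_add: "poly_family p \<Longrightarrow> poly_family q \<Longrightarrow> poly_family (\<lambda>x. p x + q x)"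
  unfolding poly_family_def coeff_add
  by (auto intro: regular_add) (meson degree_add_le max.cobounded1 max.cobounded2 le_trans)

lemma poly_family_mult: "poly_family p \<Longrightarrow> poly_family q \<Longrightarrow> poly_family (\<lambda>x. p x * q x)"
  unfolding poly_family_def coeff_mult
  by (auto intro!: regular_sum regular_mult) (meson degree_mult_le add_mono le_trans)

lemma poly_family_pCons: "poly_family p \<Longrightarrow> reg f \<Longrightarrow> poly_family (\<lambda>x. pCons (f x) (p x))"
proof -
  assume p: "poly_family p" and f: "reg f"
  have "reg (\<lambda>x. coeff (pCons (f x) (p x)) k)" for k
    using p f by (cases k) (auto simp: poly_family_def)
  moreover obtain N where "\<And>x. degree (p x) \<le> N" using p by (auto simp: poly_family_def)
  then have "\<forall>x. degree (pCons (f x) (p x)) \<le> Suc N"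
    by (meson Suc_le_mono degree_pCons_le le_trans)
  ultimately show ?thesis unfolding poly_family_def by blast
qed

lemma reg_poly_family:
  assumes "poly_family p" shows "reg (\<lambda>x. poly (p x) t)"
proof -
  obtain N where N: "\<And>x. degree (p x) \<le> N" using assms unfolding poly_family_def by blast
  have "poly (p x) t = (\<Sum>k\<le>N. coeff (p x) k * t ^ k)" for x
    unfolding poly_altdef by (rule sum.mono_neutral_left) (use N[of x] in \<open>auto simp: coeff_eq_0\<close>)
  then show ?thesis using assms
    by (auto simp: poly_family_def intro!: regular_sum regular_mult regular_const)
qed

text \<open>
  An expansion in \<open>t\<close> modulo the moment ideal, in which positive powers of \<open>t\<close> carry a factor \<open>i\<^sub>a\<close>
  and negative ones a factor \<open>j\<^sub>a\<close>. This form is stable under products, because mixed terms contain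
  \<open>i\<^sub>a j\<^sub>a\<close>.
\<close>

definition weight_expansion where
  "weight_expansion a \<zeta> \<eta> f p q \<longleftrightarrow> poly_family p \<and> poly_family q \<and> (\<forall>t. t \<noteq> 0 \<longrightarrow>
     null (\<lambda>x. f (scaled (\<zeta>(a := t)) (\<eta>(a := inverse t)) x)
       - (f (scaled (\<zeta>(a := 0)) (\<eta>(a := 0)) x)
          + (t * diag_i a x * poly (p x) t + inverse t * diag_j a x * poly (q x) (inverse t)))))"

lemma weight_expansion_exact:
  assumes "poly_family p" "poly_family q"
    and eq: "\<And>x t. x \<in> cotangent_rss \<Longrightarrow> t \<noteq> 0 \<Longrightarrow> f (scaled (\<zeta>(a := t)) (\<eta>(a := inverse t)) x) =
       f (scaled (\<zeta>(a := 0)) (\<eta>(a := 0)) x)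
          + (t * diag_i a x * poly (p x) t + inverse t * diag_j a x * poly (q x) (inverse t))"
  shows "weight_expansion a \<zeta> \<eta> f p q"
  unfolding weight_expansion_def
proof (intro conjI allI impI assms(1,2))
  fix t :: complex assume "t \<noteq> 0"
  show "null (\<lambda>x. f (scaled (\<zeta>(a := t)) (\<eta>(a := inverse t)) x)
       - (f (scaled (\<zeta>(a := 0)) (\<eta>(a := 0)) x)
          + (t * diag_i a x * poly (p x) t + inverse t * diag_j a x * poly (q x) (inverse t))))"
    by (rule iffD2[OF null_cong null_zero]) (simp add: eq \<open>t \<noteq> 0\<close>)
qed

lemma weight_expansion_constant:
  assumes "\<And>x t. x \<in> cotangent_rss \<Longrightarrow> t \<noteq> 0 \<Longrightarrow>
    f (scaled (\<zeta>(a := t)) (\<eta>(a := inverse t)) x) = f (scaled (\<zeta>(a := 0)) (\<eta>(a := 0)) x)"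
  shows "weight_expansion a \<zeta> \<eta> f (\<lambda>x. [:0:]) (\<lambda>x. [:0:])"
proof (rule weight_expansion_exact[OF poly_family_const[OF regular_const] poly_family_const[OF regular_const]])
  fix x :: "'a point" and t :: complex assume "x \<in> cotangent_rss" "t \<noteq> 0"
  from assms[OF this] show "f (scaled (\<zeta>(a := t)) (\<eta>(a := inverse t)) x) =
      f (scaled (\<zeta>(a := 0)) (\<eta>(a := 0)) x)
      + (t * diag_i a x * poly [:0:] t + inverse t * diag_j a x * poly [:0:] (inverse t))"
    by simp
qed

lemma weight_expansion_exists:
  assumes "reg f" shows "\<exists>p q. weight_expansion a \<zeta> \<eta> f p q"
  using assms
proof (induction rule: regular_induct)
  case (cong f g)
  have eq: "f (scaled z e x) = g (scaled z e x)" if "x \<in> cotangent_rss" for z e x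
    using that cong(2) morphism_scaled unfolding morphism_def by blast
  have "null (\<lambda>x. f (scaled z e x) - (f (scaled z' e' x) + h x)) \<longleftrightarrow>
      null (\<lambda>x. g (scaled z e x) - (g (scaled z' e' x) + h x))" for z e z' e' h
    by (rule null_cong) (simp only: eq)
  then have "weight_expansion a \<zeta> \<eta> f p q \<longleftrightarrow> weight_expansion a \<zeta> \<eta> g p q" for p q
    unfolding weight_expansion_def by (simp only:)
  then show ?case using cong(1) by simp
next
  case (const c)
  show ?case by (rule exI, rule exI, rule weight_expansion_constant) simp
next
  case (gen g)
  then show ?case
  proof (cases rule: coords_cases)
    case (r k c)
    show ?thesis by (rule exI, rule exI, rule weight_expansion_constant) (simp add: r scaled_def)
  next
    case (gap k c)
    show ?thesis by (rule exI, rule exI, rule weight_expansion_constant) (simp add: gap scaled_def)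
  next
    case (i k)
    show ?thesis
    proof (cases "k = a")
      case True
      have "weight_expansion a \<zeta> \<eta> g (\<lambda>x. [:1:]) (\<lambda>x. [:0:])"
        by (rule weight_expansion_exact[OF poly_family_const poly_family_const])
          (simp_all add: regular_const i True scaled_def)
      then show ?thesis by blast
    next
      case False
      show ?thesis by (rule exI, rule exI, rule weight_expansion_constant) (simp add: False i scaled_def)
    qed
  next
    case (j k)
    show ?thesis
    proof (cases "k = a")
      case True
      have "weight_expansion a \<zeta> \<eta> g (\<lambda>x. [:0:]) (\<lambda>x. [:1:])"
        by (rule weight_expansion_exact[OF poly_family_const poly_family_const])
          (simp_all add: regular_const j True scaled_def)
      then show ?thesis by blast
    next
      case False
      show ?thesis by (rule exI, rule exI, rule weight_expansion_constant) (simp add: False j scaled_def)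
    qed
  next
    case (s k c)
    consider "k = c \<or> (k \<noteq> a \<and> c \<noteq> a)" | "k = a" "c < a" | "c = a" "a < k" using s(2) by force
    then show ?thesis
    proof cases
      case 1
      show ?thesis by (rule exI, rule exI, rule weight_expansion_constant) (use 1 in \<open>auto simp: s scaled_def\<close>)
    next
      case 2
      have "reg (\<lambda>x. - (\<eta> c * diag_j c x) * inv_gap a c x)"
        using 2 by (intro regular_mult regular_uminus regular_const reg_diag_j reg_gap) simp
      then have "weight_expansion a \<zeta> \<eta> g (\<lambda>x. [:- (\<eta> c * diag_j c x) * inv_gap a c x:]) (\<lambda>x. [:0:])"
        by (rule weight_expansion_exact[OF poly_family_const poly_family_const[OF regular_const]])
          (use 2 in \<open>simp add: s(1) scaled_def less_imp_neq less_imp_neq[symmetric] algebra_simps\<close>)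
      then show ?thesis by blast
    next
      case 3
      have "reg (\<lambda>x. - (\<zeta> k * diag_i k x) * inv_gap k a x)"
        using 3 by (intro regular_mult regular_uminus regular_const reg_diag_i reg_gap) simp
      then have "weight_expansion a \<zeta> \<eta> g (\<lambda>x. [:0:]) (\<lambda>x. [:- (\<zeta> k * diag_i k x) * inv_gap k a x:])"
        by (rule weight_expansion_exact[OF poly_family_const[OF regular_const] poly_family_const])
          (use 3 in \<open>simp add: s(1) scaled_def less_imp_neq less_imp_neq[symmetric] algebra_simps\<close>)
      then show ?thesis by blast
    qed
  qed
next
  case (add f g)
  then obtain p q p' q' where fg: "weight_expansion a \<zeta> \<eta> f p q" "weight_expansion a \<zeta> \<eta> g p' q'"
    by blast
  have "weight_expansion a \<zeta> \<eta> (\<lambda>x. f x + g x) (\<lambda>x. p x + p' x) (\<lambda>x. q x + q' x)"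
    unfolding weight_expansion_def
  proof (intro conjI allI impI)
    fix t :: complex assume "t \<noteq> 0"
    with fg have "null (\<lambda>x. f (scaled (\<zeta>(a := t)) (\<eta>(a := inverse t)) x)
       - (f (scaled (\<zeta>(a := 0)) (\<eta>(a := 0)) x)
          + (t * diag_i a x * poly (p x) t + inverse t * diag_j a x * poly (q x) (inverse t))))"
      "null (\<lambda>x. g (scaled (\<zeta>(a := t)) (\<eta>(a := inverse t)) x)
       - (g (scaled (\<zeta>(a := 0)) (\<eta>(a := 0)) x)
          + (t * diag_i a x * poly (p' x) t + inverse t * diag_j a x * poly (q' x) (inverse t))))"
      by (auto simp: weight_expansion_def)
    from null_add[OF this]
    show "null (\<lambda>x. (f (scaled (\<zeta>(a := t)) (\<eta>(a := inverse t)) x) + g (scaled (\<zeta>(a := t)) (\<eta>(a := inverse t)) x))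
       - (f (scaled (\<zeta>(a := 0)) (\<eta>(a := 0)) x) + g (scaled (\<zeta>(a := 0)) (\<eta>(a := 0)) x)
          + (t * diag_i a x * poly (p x + p' x) t + inverse t * diag_j a x * poly (q x + q' x) (inverse t))))"
      by (simp add: algebra_simps)
  qed (use fg in \<open>auto simp: weight_expansion_def intro: poly_family_add\<close>)
  then show ?case by blast
next
  case (mult f g)
  then obtain p q p' q' where fg: "weight_expansion a \<zeta> \<eta> f p q" "weight_expansion a \<zeta> \<eta> g p' q'"
    by blast
  then have pf: "poly_family p" "poly_family q" "poly_family p'" "poly_family q'"
    by (auto simp: weight_expansion_def)
  define f0 g0 where "f0 x = f (scaled (\<zeta>(a := 0)) (\<eta>(a := 0)) x)"
    and "g0 x = g (scaled (\<zeta>(a := 0)) (\<eta>(a := 0)) x)" for x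
  have reg0: "reg f0" "reg g0" unfolding f0_def g0_def
    by (rule reg_morphism[OF mult.hyps(1) morphism_scaled]) (rule reg_morphism[OF mult.hyps(2) morphism_scaled])
  define P Q where "P x = [:f0 x:] * p' x + [:g0 x:] * p x + pCons 0 ([:diag_i a x:] * (p x * p' x))"
    and "Q x = [:f0 x:] * q' x + [:g0 x:] * q x + pCons 0 ([:diag_j a x:] * (q x * q' x))" for x
  have "weight_expansion a \<zeta> \<eta> (\<lambda>x. f x * g x) P Q"
    unfolding weight_expansion_def
  proof (intro conjI allI impI)
    show "poly_family P" "poly_family Q" unfolding P_def Q_def
      by (intro poly_family_add poly_family_mult poly_family_pCons poly_family_const pf reg0
          reg_diag_i reg_diag_j regular_const)+
    fix t :: complex assume t: "t \<noteq> 0"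
    define F F' where "F x = f (scaled (\<zeta>(a := t)) (\<eta>(a := inverse t)) x)"
      and "F' x = f0 x + (t * diag_i a x * poly (p x) t + inverse t * diag_j a x * poly (q x) (inverse t))" for x
    define G G' where "G x = g (scaled (\<zeta>(a := t)) (\<eta>(a := inverse t)) x)"
      and "G' x = g0 x + (t * diag_i a x * poly (p' x) t + inverse t * diag_j a x * poly (q' x) (inverse t))" for x
    \<comment> \<open>The mixed terms, up to the factor \<open>i\<^sub>a j\<^sub>a\<close>: there the powers \<open>t\<close> and \<open>t\<^sup>-\<^sup>1\<close> in front cancel.\<close>
    define E where "E x = poly (p x) t * poly (q' x) (inverse t) + poly (p' x) t * poly (q x) (inverse t)" for x
    have "null (\<lambda>x. F x - F' x)" "null (\<lambda>x. G x - G' x)"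
      using fg t by (auto simp: weight_expansion_def F_def F'_def G_def G'_def f0_def g0_def)
    moreover have "reg G" unfolding G_def by (rule reg_morphism[OF mult.hyps(2) morphism_scaled])
    moreover have "reg F'" unfolding F'_def
      by (intro regular_add regular_mult reg0 regular_const reg_diag_i reg_diag_j reg_poly_family pf)
    ultimately have "null (\<lambda>x. F x * G x - F' x * G' x)" by (rule null_mult_diff)
    moreover have "null (\<lambda>x. E x * (diag_i a x * diag_j a x))" unfolding E_def
      by (intro null_mult null_diag_i_diag_j regular_add regular_mult reg_poly_family pf)
    ultimately have "null (\<lambda>x. F x * G x - F' x * G' x + E x * (diag_i a x * diag_j a x))" by (rule null_add)
    moreover have "F x * G x - F' x * G' x + E x * (diag_i a x * diag_j a x) = F x * G x
       - (f0 x * g0 x + (t * diag_i a x * poly (P x) t + inverse t * diag_j a x * poly (Q x) (inverse t)))" for x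
      using t by (simp add: F'_def G'_def E_def P_def Q_def field_simps)
    ultimately have "null (\<lambda>x. F x * G x
       - (f0 x * g0 x + (t * diag_i a x * poly (P x) t + inverse t * diag_j a x * poly (Q x) (inverse t))))"
      by (simp only:)
    then show "null (\<lambda>x. f (scaled (\<zeta>(a := t)) (\<eta>(a := inverse t)) x) * g (scaled (\<zeta>(a := t)) (\<eta>(a := inverse t)) x)
       - (f (scaled (\<zeta>(a := 0)) (\<eta>(a := 0)) x) * g (scaled (\<zeta>(a := 0)) (\<eta>(a := 0)) x)
          + (t * diag_i a x * poly (P x) t + inverse t * diag_j a x * poly (Q x) (inverse t))))"
      unfolding F_def G_def f0_def g0_def .
  qed
  then show ?case by blast
qed


section \<open>Averaging over roots of unity\<close>

lemma sum_powers_root_of_unity: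
  fixes z :: complex
  assumes "z ^ N = 1" "z \<noteq> 1" shows "(\<Sum>m<N. z ^ m) = 0"
  using assms by (simp add: geometric_sum)

lemma exp_root_of_unity:
  assumes "0 < k" "k < N"
  defines "\<omega> \<equiv> exp (2 * of_real pi * \<i> * of_nat 1 / of_nat N)"
  shows "\<omega> ^ N = 1" "\<omega> ^ k \<noteq> 1"
proof -
  have pow: "\<omega> ^ m = exp (2 * of_real pi * \<i> * of_nat m / of_nat N)" for m
    unfolding \<omega>_def exp_of_nat_mult[symmetric] by (simp add: algebra_simps)
  show "\<omega> ^ N = 1" unfolding pow using assms(2) by (subst complex_root_unity_eq_1) auto
  show "\<omega> ^ k \<noteq> 1" unfolding pow
    using assms(1,2) by (subst complex_root_unity_eq_1) (auto dest: dvd_imp_le)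
qed

lemma sum_weight_roots:
  fixes p :: "complex poly" and \<omega> :: complex
  assumes "\<omega> ^ N = 1" "\<And>k. 0 < k \<Longrightarrow> k < N \<Longrightarrow> \<omega> ^ k \<noteq> 1" "Suc (degree p) < N"
  shows "(\<Sum>m<N. \<omega> ^ m * poly p (\<omega> ^ m)) = 0"
proof -
  have "(\<Sum>m<N. \<omega> ^ m * poly p (\<omega> ^ m)) = (\<Sum>m<N. \<Sum>k\<le>degree p. coeff p k * (\<omega> ^ Suc k) ^ m)"
    by (simp add: poly_altdef sum_distrib_left power_mult_distrib power_commutes mult.left_commute
        flip: power_mult power_add add: mult.commute)
  also have "\<dots> = (\<Sum>k\<le>degree p. coeff p k * (\<Sum>m<N. (\<omega> ^ Suc k) ^ m))"
    by (subst sum.swap) (simp add: sum_distrib_left)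
  also have "\<dots> = 0"
  proof (intro sum.neutral ballI)
    fix k assume "k \<in> {..degree p}"
    then have "\<omega> ^ Suc k \<noteq> 1" using assms(3) by (intro assms(2)) auto
    moreover have "(\<omega> ^ Suc k) ^ N = 1" using assms(1) by (metis power_commuting_commutes power_mult mult.commute power_one)
    ultimately have "(\<Sum>m<N. (\<omega> ^ Suc k) ^ m) = 0" by (intro sum_powers_root_of_unity)
    then show "coeff p k * (\<Sum>m<N. (\<omega> ^ Suc k) ^ m) = 0" by (simp only: mult_zero_right)
  qed
  finally show ?thesis .
qed

text \<open>
  By invariance \<open>f(scaled \<zeta> \<eta> x)\<close> is congruent to its expansion at every \<open>t \<noteq> 0\<close>. Averaging \<open>t\<close> over
  the \<open>N\<close>-th roots of unity, with \<open>N\<close> above all degrees, removes every nonzero power of \<open>t\<close> and leaves the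
  constant term.
\<close>

lemma invariant_drop_weight:
  assumes inv: "invariant_mod_moment f" and one: "\<zeta> a = 1" "\<eta> a = 1"
  shows "null (\<lambda>x. f (scaled \<zeta> \<eta> x) - f (scaled (\<zeta>(a := 0)) (\<eta>(a := 0)) x))"
proof -
  have "reg f" using inv by (simp add: invariant_mod_moment_def)
  then obtain p q where pq: "weight_expansion a \<zeta> \<eta> f p q" using weight_expansion_exists by blast
  then have pf: "poly_family p" "poly_family q" by (auto simp: weight_expansion_def)
  obtain M1 M2 where M: "\<And>x. degree (p x) \<le> M1" "\<And>x. degree (q x) \<le> M2"
    using pf unfolding poly_family_def by blast
  define N where "N = M1 + M2 + 2"
  define \<omega> where "\<omega> = exp (2 * of_real pi * \<i> * of_nat 1 / of_nat N)"
  have \<omega>: "\<omega> ^ N = 1" "\<And>k. 0 < k \<Longrightarrow> k < N \<Longrightarrow> \<omega> ^ k \<noteq> 1"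
    using exp_root_of_unity[of _ N] exp_root_of_unity(1)[of 1 N] by (auto simp: \<omega>_def N_def)
  have nz: "\<omega> \<noteq> 0" by (simp add: \<omega>_def)
  define F F0 where "F x = f (scaled \<zeta> \<eta> x)" and "F0 x = f (scaled (\<zeta>(a := 0)) (\<eta>(a := 0)) x)" for x
  define U V where "U m x = \<omega> ^ m * poly (p x) (\<omega> ^ m)"
    and "V m x = inverse \<omega> ^ m * poly (q x) (inverse \<omega> ^ m)" for m x
  have "null (\<lambda>x. F x - (F0 x + (diag_i a x * U m x + diag_j a x * V m x)))" for m
  proof -
    let ?t = "\<omega> ^ m"
    have "?t \<noteq> 0" using nz by simp
    have "null (\<lambda>x. f (scaled (\<zeta>(a := ?t)) (\<eta>(a := inverse ?t)) x) - F x)"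
      using invariant_torus[OF inv \<open>?t \<noteq> 0\<close>, of \<zeta> a \<eta>] one by (simp add: F_def)
    then have 1: "null (\<lambda>x. F x - f (scaled (\<zeta>(a := ?t)) (\<eta>(a := inverse ?t)) x))" by (rule null_sym)
    have "null (\<lambda>x. f (scaled (\<zeta>(a := ?t)) (\<eta>(a := inverse ?t)) x) - (F0 x
        + (?t * diag_i a x * poly (p x) ?t + inverse ?t * diag_j a x * poly (q x) (inverse ?t))))"
      using pq \<open>?t \<noteq> 0\<close> unfolding weight_expansion_def F0_def by blast
    from null_trans[OF 1 this] show ?thesis
      by (simp add: U_def V_def power_inverse mult.assoc mult.left_commute)
  qed
  then have "null (\<lambda>x. \<Sum>m<N. F x - (F0 x + (diag_i a x * U m x + diag_j a x * V m x)))"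
    by (rule null_sum)
  moreover have "(\<Sum>m<N. F x - (F0 x + (diag_i a x * U m x + diag_j a x * V m x))) = of_nat N * (F x - F0 x)" for x
  proof -
    have U: "(\<Sum>m<N. U m x) = 0" unfolding U_def
      by (rule sum_weight_roots[OF \<omega>]) (use M(1)[of x] in \<open>simp_all add: N_def\<close>)
    have V: "(\<Sum>m<N. V m x) = 0" unfolding V_def
    proof (rule sum_weight_roots)
      show "inverse \<omega> ^ N = 1" by (simp only: power_inverse \<omega>(1) inverse_1)
      show "inverse \<omega> ^ k \<noteq> 1" if "0 < k" "k < N" for k
        using \<omega>(2)[OF that] by (simp add: power_inverse)
      show "Suc (degree (q x)) < N" using M(2)[of x] by (simp add: N_def)
    qed
    have "(\<Sum>m<N. F x - (F0 x + (diag_i a x * U m x + diag_j a x * V m x))) =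
       (\<Sum>m<N. F x - F0 x) - (diag_i a x * (\<Sum>m<N. U m x) + diag_j a x * (\<Sum>m<N. V m x))"
      by (simp only: sum_subtractf sum.distrib sum_distrib_left diff_diff_eq)
    then show ?thesis by (simp add: U V)
  qed
  ultimately have "null (\<lambda>x. of_nat N * (F x - F0 x))" by simp
  from null_mult[OF regular_const this, of "inverse (of_nat N)"]
  have "null (\<lambda>x. F x - F0 x)" by (simp add: N_def mult.assoc[symmetric] del: of_nat_Suc of_nat_add)
  then show ?thesis by (simp add: F_def F0_def)
qed

text \<open>
  The section \<open>\<sigma>\<close> of \<open>P\<close>; its values lie in \<open>\<mu>\<^sup>-\<^sup>1(0)\<close>, as \<open>r\<close> and \<open>s\<close> commute and \<open>i = j = 0\<close>.
\<close>

definition section_point :: "'n::{finite,wellorder} config_point \<Rightarrow> 'n point" where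
  "section_point = (\<lambda>(x, y). (diag_mat x, diag_mat y, 0, 0))"

text \<open>
  \<open>P\<close> is constant on orbits, and at \<open>diagonalized x\<close> its second component is the diagonal of \<open>s\<close>.
\<close>

lemma scaled_zero:
  assumes x: "x \<in> cotangent_rss" shows "scaled (\<lambda>_. 0) (\<lambda>_. 0) x = section_point (map_P x)"
proof -
  have "map_P x = map_P (diagonalized x)"
    unfolding diagonalized_def using diagonalizer_Borel x by (intro map_P_act[symmetric]) auto
  moreover have "snd (map_P (diagonalized x)) $ a = s_of (diagonalized x) $ a $ a" for a
  proof -
    have "snd (map_P (diagonalized x)) $ a = s_prime a (r_of (diagonalized x)) (s_of (diagonalized x))"
      by (simp add: map_P_def case_prod_beta')
    also have "\<dots> = s_of (diagonalized x) $ a $ a"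
      by (rule s_prime_diagonal) (use cotangent_rssD(3)[OF x] in \<open>simp_all add: r_of_diagonalized[OF x] diag_mat_entry\<close>)
    finally show ?thesis .
  qed
  ultimately have "snd (map_P x) $ a = s_of (diagonalized x) $ a $ a" for a by simp
  moreover have "fst (map_P x) $ a = r_of x $ a $ a" for a
    by (simp add: map_P_def case_prod_beta')
  ultimately show ?thesis
    by (simp add: scaled_def section_point_def case_prod_beta' vec_eq_iff diag_mat_entry)
qed

text \<open>
  Diagonalization, then solving the moment equations, then one torus coordinate at a time.
\<close>

theorem invariant_normal_form:
  assumes inv: "invariant_mod_moment f"
  shows "null (\<lambda>x. f x - f (section_point (map_P x)))"
proof -
  have "reg f" using inv by (simp add: invariant_mod_moment_def)
  let ?\<zeta> = "\<lambda>S k. if k \<in> S then 0 else 1 :: complex"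
  have drop: "null (\<lambda>x. f (scaled (\<lambda>_. 1) (\<lambda>_. 1) x) - f (scaled (?\<zeta> S) (?\<zeta> S) x))" for S
    using finite[of S]
  proof (induction S rule: finite_induct)
    case empty
    then show ?case by (simp add: null_zero)
  next
    case (insert a S)
    have "(?\<zeta> S)(a := 0) = ?\<zeta> (insert a S)" by auto
    then show ?case
      using null_trans[OF insert.IH invariant_drop_weight[OF inv, of "?\<zeta> S" a "?\<zeta> S"]] insert.hyps
      by simp
  qed
  have "null (\<lambda>x. f x - f (scaled (\<lambda>_. 0) (\<lambda>_. 0) x))"
    using null_trans[OF null_sym[OF invariant_diagonalized[OF inv]]
        null_trans[OF null_diagonalized_scaled[OF \<open>reg f\<close>] drop[of UNIV]]]
    by simp
  moreover have "null (\<lambda>x. f x - f (scaled (\<lambda>_. 0) (\<lambda>_. 0) x)) \<longleftrightarrow> null (\<lambda>x. f x - f (section_point (map_P x)))"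
    by (rule null_cong) (simp only: scaled_zero)
  ultimately show ?thesis by simp
qed

section \<open>The spectrum of a ring isomorphic to an algebra of functions\<close>

definition point_ideal :: "'y set \<Rightarrow> ('y \<Rightarrow> complex) set \<Rightarrow> 'y \<Rightarrow> ('y \<Rightarrow> complex) set" where
  "point_ideal Y H y = {f \<in> carrier (function_algebra Y H). f y = 0}"

lemma point_ideal_mem:
  "y \<in> Y \<Longrightarrow> restrict f Y \<in> point_ideal Y H y \<longleftrightarrow> regular Y H f \<and> f y = 0"
  by (auto simp: point_ideal_def restrict_in_algebra)

text \<open>
  A function that does not vanish at \<open>y\<close> differs by a nonzero constant from one that does.
\<close>

lemma maximal_point_ideal:
  assumes y: "y \<in> Y" shows "maximalideal (point_ideal Y H y) (function_algebra Y H)"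
proof -
  let ?R = "function_algebra Y H" and ?M = "point_ideal Y H y"
  interpret R: cring ?R by (rule cring_function_algebra)
  have M: "ideal ?M ?R"
  proof (rule idealI)
    show "ring ?R" by (rule R.ring_axioms)
    show "subgroup ?M (add_monoid ?R)"
    proof (rule R.add.subgroupI)
      show "?M \<subseteq> carrier ?R" by (auto simp: point_ideal_def)
      have "(\<lambda>y\<in>Y. 0) \<in> ?M" using point_ideal_mem[OF y] regular_const by blast
      then show "?M \<noteq> {}" by blast
      fix f assume f: "f \<in> ?M"
      then obtain f' where f': "f = restrict f' Y" "regular Y H f'"
        by (auto simp: point_ideal_def elim: in_algebraE)
      have "f' y = 0" using f y by (simp add: f' point_ideal_mem)
      then show "\<ominus>\<^bsub>?R\<^esub> f \<in> ?M"
        unfolding f'(1) algebra_uminus[OF f'(2)] point_ideal_mem[OF y] by (simp add: regular_uminus f'(2))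
      fix g assume g: "g \<in> ?M"
      then show "f \<oplus>\<^bsub>?R\<^esub> g \<in> ?M" using f y R.a_closed[of f g] by (simp add: point_ideal_def function_ring_def)
    qed
    fix f g assume "f \<in> ?M" "g \<in> carrier ?R"
    then show "g \<otimes>\<^bsub>?R\<^esub> f \<in> ?M" "f \<otimes>\<^bsub>?R\<^esub> g \<in> ?M"
      using y R.m_closed[of f g] R.m_closed[of g f] by (simp_all add: point_ideal_def function_ring_def)
  qed
  show ?thesis
  proof (rule maximalidealI[OF M])
    have "\<one>\<^bsub>?R\<^esub> \<notin> ?M" using y by (simp add: point_ideal_def function_ring_def)
    then show "carrier ?R \<noteq> ?M" using R.one_closed by blast
    fix J assume J: "ideal J ?R" "?M \<subseteq> J" "J \<subseteq> carrier ?R"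
    show "J = ?M \<or> J = carrier ?R"
    proof (cases "J \<subseteq> ?M")
      case False
      then obtain f where f: "f \<in> J" "f \<notin> ?M" by blast
      then obtain g where g: "f = restrict g Y" "regular Y H g" "restrict g Y \<in> J"
        using ideal_memE[OF J(1)] by metis
      have nz: "g y \<noteq> 0" using f y g by (simp add: point_ideal_mem)
      have "restrict (\<lambda>x. g x - g y) Y \<in> ?M"
        unfolding point_ideal_mem[OF y] by (simp add: regular_diff regular_const g)
      then have "restrict (\<lambda>x. g x - g y) Y \<in> J" using J(2) by blast
      from ideal_diff[OF J(1) g(3) this] have "restrict (\<lambda>x. g x - (g x - g y)) Y \<in> J" .
      from ideal_mult[OF J(1) this regular_const[of Y H "inverse (g y)"]]
      have "restrict (\<lambda>x. inverse (g y) * (g x - (g x - g y))) Y \<in> J" .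
      moreover have "restrict (\<lambda>x. inverse (g y) * (g x - (g x - g y))) Y = \<one>\<^bsub>?R\<^esub>"
        using nz by (simp add: function_ring_def)
      ultimately have "\<one>\<^bsub>?R\<^esub> \<in> J" by simp
      then show ?thesis using ideal.one_imp_carrier[OF J(1)] by blast
    qed (use J in blast)
  qed
qed

lemma maximalideal_vimage:
  assumes "ring R" "ring S" and h: "h \<in> ring_iso R S" and m: "maximalideal m S"
  shows "maximalideal {r \<in> carrier R. h r \<in> m} R"
proof -
  interpret h: ring_hom_ring R S h
    using assms by (intro ring_hom_ringI2) (auto simp: ring_iso_def)
  define k where "k = inv_into (carrier R) h"
  have "k \<in> ring_iso S R" unfolding k_def by (rule ring_iso_set_sym[OF assms(1) h])
  then interpret k: ring_hom_ring S R k
    using assms by (intro ring_hom_ringI2) (auto simp: ring_iso_def)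
  have bij: "bij_betw h (carrier R) (carrier S)" using h by (simp add: ring_iso_def)
  have hk: "h (k s) = s" if "s \<in> carrier S" for s
    unfolding k_def using bij that by (rule bij_betw_inv_into_right)
  have kh: "k (h r) = r" if "r \<in> carrier R" for r
    unfolding k_def using bij that by (rule bij_betw_inv_into_left)
  interpret maximalideal m S by (rule m)
  show ?thesis
  proof (rule maximalidealI)
    show "ideal {r \<in> carrier R. h r \<in> m} R" by (rule h.ideal_vimage[OF is_ideal])
    show "carrier R \<noteq> {r \<in> carrier R. h r \<in> m}"
    proof
      assume "carrier R = {r \<in> carrier R. h r \<in> m}"
      then have "h \<one>\<^bsub>R\<^esub> \<in> m" by (metis (mono_tags, lifting) h.R.one_closed mem_Collect_eq)
      then show False using one_imp_carrier I_notcarr by simp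
    qed
    fix J assume J: "ideal J R" "{r \<in> carrier R. h r \<in> m} \<subseteq> J" "J \<subseteq> carrier R"
    let ?J = "{s \<in> carrier S. k s \<in> J}"
    have "ideal ?J S" by (rule k.ideal_vimage[OF J(1)])
    moreover have "m \<subseteq> ?J" using J(2) Icarr hk k.hom_closed by auto
    ultimately have "?J = m \<or> ?J = carrier S" using I_maximal by blast
    moreover have vimage: "{r \<in> carrier R. h r \<in> ?J} = J" using J(3) kh h.hom_closed by auto
    ultimately have "{r \<in> carrier R. h r \<in> m} = J \<or> {r \<in> carrier R. h r \<in> carrier S} = J"
      by metis
    then show "J = {r \<in> carrier R. h r \<in> m} \<or> J = carrier R" using h.hom_closed by blast
  qed
qed

text \<open>
  A \<open>\<complex>\<close>-algebra \<open>A\<close> that is isomorphic to an algebra of functions on \<open>Y\<close>. If these functions satisfy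
  the Nullstellensatz and separate points, then \<open>Spec A\<close> is \<open>Y\<close> as a variety.
\<close>

locale spectrum_iso =
  fixes Y :: "'y set" and H and A :: "('a, 'b) ring_scheme" and \<kappa> const
  assumes A: "ring A" and \<kappa>: "\<kappa> \<in> ring_iso (function_algebra Y H) A"
    and const: "\<And>c. const c = \<kappa> (\<lambda>y\<in>Y. c)"
    and nullstellensatz: "\<And>m. maximalideal m (function_algebra Y H) \<Longrightarrow> \<exists>y\<in>Y. m = point_ideal Y H y"
    and separates: "\<And>y z. y \<in> Y \<Longrightarrow> z \<in> Y \<Longrightarrow> (\<And>f. regular Y H f \<Longrightarrow> f y = f z) \<Longrightarrow> y = z"
begin

abbreviation "R \<equiv> function_algebra Y H"

sublocale R: cring R by (rule cring_function_algebra)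
sublocale A: ring A by (rule A)
sublocale \<kappa>: ring_hom_ring R A \<kappa>
  using \<kappa> A R.ring_axioms by (intro ring_hom_ringI2) (auto simp: ring_iso_def)

lemma bij: "bij_betw \<kappa> (carrier R) (carrier A)"
  using \<kappa> by (simp add: ring_iso_def)

definition pt :: "'y \<Rightarrow> 'a set" where "pt y = \<kappa> ` point_ideal Y H y"

lemma mem_pt:
  assumes "f \<in> carrier R" shows "\<kappa> f \<in> pt y \<longleftrightarrow> f y = 0"
proof -
  have "\<kappa> f \<in> \<kappa> ` point_ideal Y H y \<longleftrightarrow> f \<in> point_ideal Y H y"
    by (rule inj_on_image_mem_iff[OF bij_betw_imp_inj_on[OF bij] assms]) (auto simp: point_ideal_def)
  then show ?thesis using assms by (simp add: pt_def point_ideal_def)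
qed

lemma Spec_points_eq: "Spec_points A = pt ` Y"
proof (intro equalityI subsetI)
  fix m assume "m \<in> Spec_points A"
  then have m: "maximalideal m A" by (simp add: Spec_points_def)
  obtain y where y: "y \<in> Y" "{f \<in> carrier R. \<kappa> f \<in> m} = point_ideal Y H y"
    using nullstellensatz[OF maximalideal_vimage[OF R.ring_axioms A \<kappa> m]] by blast
  have "m \<subseteq> carrier A" using ideal.Icarr[OF maximalideal.axioms(1)[OF m]] by blast
  then have "m \<subseteq> \<kappa> ` carrier R" unfolding bij_betw_imp_surj_on[OF bij] .
  then have "m = \<kappa> ` {f \<in> carrier R. \<kappa> f \<in> m}" by fast
  then have "m = pt y" unfolding y(2) pt_def .
  then show "m \<in> pt ` Y" using y(1) by blast
next
  fix m assume "m \<in> pt ` Y"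
  then obtain y where y: "y \<in> Y" "m = pt y" by blast
  let ?k = "inv_into (carrier R) \<kappa>"
  have "maximalideal {C \<in> carrier A. ?k C \<in> point_ideal Y H y} A"
    by (rule maximalideal_vimage[OF A R.ring_axioms ring_iso_set_sym[OF R.ring_axioms \<kappa>] maximal_point_ideal[OF y(1)]])
  moreover have "{C \<in> carrier A. ?k C \<in> point_ideal Y H y} = pt y"
    unfolding pt_def
  proof (intro equalityI subsetI)
    fix C assume "C \<in> {C \<in> carrier A. ?k C \<in> point_ideal Y H y}"
    then show "C \<in> \<kappa> ` point_ideal Y H y"
      using bij_betw_inv_into_right[OF bij, of C] by (metis (mono_tags, lifting) imageI mem_Collect_eq)
  next
    fix C assume "C \<in> \<kappa> ` point_ideal Y H y"
    then obtain f where f: "f \<in> point_ideal Y H y" "C = \<kappa> f" by blast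
    then have "f \<in> carrier R" by (simp add: point_ideal_def)
    then show "C \<in> {C \<in> carrier A. ?k C \<in> point_ideal Y H y}"
      using f bij_betw_inv_into_left[OF bij, of f] by simp
  qed
  ultimately show "m \<in> Spec_points A" by (simp add: Spec_points_def y)
qed

lemma inj_pt: "inj_on pt Y"
proof (rule inj_onI)
  fix y z assume yz: "y \<in> Y" "z \<in> Y" "pt y = pt z"
  show "y = z"
  proof (rule separates[OF yz(1,2)])
    fix f assume f: "regular Y H f"
    then have "(\<lambda>x\<in>Y. f x - f y) \<in> carrier R"
      by (simp only: restrict_in_algebra regular_diff regular_const)
    from mem_pt[OF this, of y] mem_pt[OF this, of z] yz show "f y = f z" by simp
  qed
qed

definition coord :: "'a set \<Rightarrow> 'y" where "coord = inv_into Y pt"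

lemma coord_pt: "y \<in> Y \<Longrightarrow> coord (pt y) = y"
  unfolding coord_def by (rule inv_into_f_f[OF inj_pt])

lemma bij_coord: "bij_betw coord (Spec_points A) Y"
  unfolding coord_def Spec_points_eq by (intro bij_betw_inv_into inj_on_imp_bij_betw inj_pt)

lemma value_at_pt:
  assumes "f \<in> carrier R" "y \<in> Y" shows "value_at A const (\<kappa> f) (pt y) = f y"
proof -
  obtain g where g: "f = restrict g Y" "regular Y H g" using assms(1) by (rule in_algebraE)
  have "\<kappa> f \<ominus>\<^bsub>A\<^esub> const c \<in> pt y \<longleftrightarrow> f y = c" for c
  proof -
    have c: "(\<lambda>y\<in>Y. c) \<in> carrier R" by (simp only: restrict_in_algebra regular_const)
    have "\<kappa> f \<ominus>\<^bsub>A\<^esub> const c = \<kappa> (f \<ominus>\<^bsub>R\<^esub> (\<lambda>y\<in>Y. c))"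
      using assms c by (simp add: const a_minus_def)
    also have "f \<ominus>\<^bsub>R\<^esub> (\<lambda>y\<in>Y. c) = (\<lambda>y\<in>Y. g y - c)"
      unfolding g(1) by (rule algebra_minus[OF g(2) regular_const])
    finally have "\<kappa> f \<ominus>\<^bsub>A\<^esub> const c = \<kappa> (\<lambda>y\<in>Y. g y - c)" .
    moreover have "(\<lambda>y\<in>Y. g y - c) \<in> carrier R"
      by (simp only: restrict_in_algebra regular_diff regular_const g)
    ultimately show ?thesis using assms(2) by (simp add: mem_pt g)
  qed
  then show ?thesis by (simp add: value_at_def)
qed

lemma topspace_Spec: "topspace (Spec_topology A) = Spec_points A"
proof -
  have "m \<in> \<Union>{{m \<in> Spec_points A. f \<notin> m} | f. f \<in> carrier A}" if m: "m \<in> Spec_points A" for m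
  proof -
    have "maximalideal m A" using m by (simp add: Spec_points_def)
    then have "\<one>\<^bsub>A\<^esub> \<notin> m"
      using ideal.one_imp_carrier maximalideal.axioms(1) maximalideal.I_notcarr by metis
    then show ?thesis using m A.one_closed by blast
  qed
  then show ?thesis unfolding Spec_topology_def topology_generated_by_topspace by blast
qed

lemma topspace_zariski: "topspace (zariski Y (gen_functions Y H)) = Y"
proof -
  have "(\<lambda>y\<in>Y. 1) \<in> gen_functions Y H" by (rule gen_functions.const)
  moreover have "Y = {y \<in> Y. (\<lambda>y\<in>Y. 1) y \<noteq> (0::complex)}" by auto
  ultimately have "Y \<in> {{y \<in> Y. f y \<noteq> 0} | f. f \<in> gen_functions Y H}" by blast
  then show ?thesis unfolding zariski_def topology_generated_by_topspace by blast
qed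

lemma homeomorphic_maps_coord:
  "homeomorphic_maps (Spec_topology A) (zariski Y (gen_functions Y H)) coord pt"
  unfolding homeomorphic_maps_def
proof (intro conjI)
  show "continuous_map (Spec_topology A) (zariski Y (gen_functions Y H)) coord"
    unfolding zariski_def
  proof (rule continuous_on_generated_topo)
    fix U assume "U \<in> {{y \<in> Y. f y \<noteq> 0} | f. f \<in> gen_functions Y H}"
    then obtain f where f: "f \<in> carrier R" "U = {y \<in> Y. f y \<noteq> 0}" by (auto simp: function_ring_def)
    have "coord -` U \<inter> topspace (Spec_topology A) = {m \<in> Spec_points A. \<kappa> f \<notin> m}"
      unfolding topspace_Spec Spec_points_eq using f coord_pt mem_pt by auto
    moreover have "openin (Spec_topology A) {m \<in> Spec_points A. \<kappa> f \<notin> m}"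
      unfolding Spec_topology_def using f(1) \<kappa>.hom_closed by (intro topology_generated_by_Basis) blast
    ultimately show "openin (Spec_topology A) (coord -` U \<inter> topspace (Spec_topology A))" by simp
  next
    show "coord ` topspace (Spec_topology A) \<subseteq> \<Union>{{y \<in> Y. f y \<noteq> 0} | f. f \<in> gen_functions Y H}"
      using topspace_zariski bij_betw_imp_surj_on[OF bij_coord]
      unfolding topspace_Spec zariski_def topology_generated_by_topspace by simp
  qed
  show "continuous_map (zariski Y (gen_functions Y H)) (Spec_topology A) pt"
    unfolding Spec_topology_def
  proof (rule continuous_on_generated_topo)
    fix U assume "U \<in> {{m \<in> Spec_points A. C \<notin> m} | C. C \<in> carrier A}"
    then obtain C where C: "C \<in> carrier A" "U = {m \<in> Spec_points A. C \<notin> m}" by blast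
    then obtain f where f: "f \<in> carrier R" "C = \<kappa> f" using bij_betw_imp_surj_on[OF bij] by blast
    have "pt -` U \<inter> topspace (zariski Y (gen_functions Y H)) = {y \<in> Y. f y \<noteq> 0}"
      unfolding topspace_zariski C(2) f(2) Spec_points_eq using f mem_pt by auto
    moreover have "openin (zariski Y (gen_functions Y H)) {y \<in> Y. f y \<noteq> 0}"
      unfolding zariski_def using f(1) unfolding carrier_function_algebra
      by (intro topology_generated_by_Basis) blast
    ultimately show "openin (zariski Y (gen_functions Y H)) (pt -` U \<inter> topspace (zariski Y (gen_functions Y H)))"
      by simp
  next
    show "pt ` topspace (zariski Y (gen_functions Y H)) \<subseteq> \<Union>{{m \<in> Spec_points A. C \<notin> m} | C. C \<in> carrier A}"
      using topspace_Spec Spec_points_eq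
      unfolding topspace_zariski Spec_topology_def topology_generated_by_topspace by simp
  qed
  show "\<forall>m\<in>topspace (Spec_topology A). pt (coord m) = m"
    unfolding topspace_Spec Spec_points_eq using coord_pt by auto
  show "\<forall>y\<in>topspace (zariski Y (gen_functions Y H)). coord (pt y) = y"
    unfolding topspace_zariski using coord_pt by auto
qed

lemma Spec_functions_pullback:
  assumes "\<phi> \<in> Spec_functions A const"
  shows "\<exists>f\<in>carrier R. \<phi> = value_at A const (\<kappa> f)"
proof -
  obtain C where C: "C \<in> carrier A" "\<phi> = value_at A const C"
    using assms unfolding Spec_functions_def by (elim CollectE exE conjE) (rule that)
  then have "C \<in> \<kappa> ` carrier R" unfolding bij_betw_imp_surj_on[OF bij] by simp
  then show ?thesis using C(2) by blast
qed

theorem variety_isomorphism_coord: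
  "variety_isomorphism (Spec_topology A) (Spec_functions A const)
     (zariski Y (gen_functions Y H)) (gen_functions Y H) coord"
  unfolding variety_isomorphism_def
proof (intro conjI allI impI)
  let ?T = "Spec_topology A" and ?Z = "zariski Y (gen_functions Y H)"
  show "homeomorphic_map ?T ?Z coord"
    using homeomorphic_maps_coord homeomorphic_map_maps by blast
  have cont: "continuous_map ?T ?Z coord" "continuous_map ?Z ?T pt"
    using homeomorphic_maps_coord by (auto simp: homeomorphic_maps_def)
  fix V \<phi> assume V: "openin ?Z V"
  then have VY: "V \<subseteq> Y" using openin_subset topspace_zariski by metis
  show "regular_on ?Z (gen_functions Y H) V \<phi> \<longleftrightarrow>
    regular_on ?T (Spec_functions A const) {m \<in> topspace ?T. coord m \<in> V} (\<phi> \<circ> coord)"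
  proof
    assume L: "regular_on ?Z (gen_functions Y H) V \<phi>"
    show "regular_on ?T (Spec_functions A const) {m \<in> topspace ?T. coord m \<in> V} (\<phi> \<circ> coord)"
      unfolding regular_on_def
    proof
      fix m assume m: "m \<in> {m \<in> topspace ?T. coord m \<in> V}"
      have "coord m \<in> V" using m by simp
      from bspec[OF L[unfolded regular_on_def] this]
      obtain W f g where W: "openin ?Z W" "coord m \<in> W" "W \<subseteq> V"
        and fg: "f \<in> gen_functions Y H" "g \<in> gen_functions Y H"
        and eq: "\<forall>y\<in>W. g y \<noteq> 0 \<and> \<phi> y = f y / g y"
        by (elim exE conjE) (rule that)
      let ?W = "{m \<in> topspace ?T. coord m \<in> W}"
      have fgR: "f \<in> carrier R" "g \<in> carrier R" using fg by (simp_all add: carrier_function_algebra)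
      show "\<exists>V' f g. openin ?T V' \<and> m \<in> V' \<and> V' \<subseteq> {m \<in> topspace ?T. coord m \<in> V} \<and>
          f \<in> Spec_functions A const \<and> g \<in> Spec_functions A const \<and>
          (\<forall>y\<in>V'. g y \<noteq> 0 \<and> (\<phi> \<circ> coord) y = f y / g y)"
      proof (intro exI conjI)
        show "openin ?T ?W" using cont(1) W(1) by (simp add: continuous_map_def)
        show "m \<in> ?W" using m W by blast
        show "?W \<subseteq> {m \<in> topspace ?T. coord m \<in> V}" using W(3) by blast
        show "value_at A const (\<kappa> f) \<in> Spec_functions A const" "value_at A const (\<kappa> g) \<in> Spec_functions A const"
          using fgR \<kappa>.hom_closed by (auto simp: Spec_functions_def)
        show "\<forall>y\<in>?W. value_at A const (\<kappa> g) y \<noteq> 0 \<and>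
            (\<phi> \<circ> coord) y = value_at A const (\<kappa> f) y / value_at A const (\<kappa> g) y"
          using eq fgR by (auto simp: topspace_Spec Spec_points_eq coord_pt value_at_pt)
      qed
    qed
  next
    assume L: "regular_on ?T (Spec_functions A const) {m \<in> topspace ?T. coord m \<in> V} (\<phi> \<circ> coord)"
    show "regular_on ?Z (gen_functions Y H) V \<phi>"
      unfolding regular_on_def
    proof
      fix y assume y: "y \<in> V"
      then have "y \<in> Y" using VY by blast
      then have "pt y \<in> {m \<in> topspace ?T. coord m \<in> V}"
        using y by (simp add: topspace_Spec Spec_points_eq coord_pt)
      from bspec[OF L[unfolded regular_on_def] this]
      obtain W f' g' where W: "openin ?T W" "pt y \<in> W" "W \<subseteq> {m \<in> topspace ?T. coord m \<in> V}"
        and fg: "f' \<in> Spec_functions A const" "g' \<in> Spec_functions A const"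
        and eq: "\<forall>m\<in>W. g' m \<noteq> 0 \<and> (\<phi> \<circ> coord) m = f' m / g' m"
        by (elim exE conjE) (rule that)
      obtain f g where f: "f \<in> carrier R" "f' = value_at A const (\<kappa> f)"
        and g: "g \<in> carrier R" "g' = value_at A const (\<kappa> g)"
        using fg[THEN Spec_functions_pullback] by blast
      let ?W = "{y \<in> topspace ?Z. pt y \<in> W}"
      show "\<exists>V' f g. openin ?Z V' \<and> y \<in> V' \<and> V' \<subseteq> V \<and>
          f \<in> gen_functions Y H \<and> g \<in> gen_functions Y H \<and>
          (\<forall>y\<in>V'. g y \<noteq> 0 \<and> \<phi> y = f y / g y)"
      proof (intro exI conjI)
        show "openin ?Z ?W" using cont(2) W(1) by (simp add: continuous_map_def)
        show "y \<in> ?W" using \<open>y \<in> Y\<close> W by (simp add: topspace_zariski)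
        show "?W \<subseteq> V" using W(3) coord_pt by (auto simp: topspace_zariski)
        show "f \<in> gen_functions Y H" "g \<in> gen_functions Y H"
          using f g by (simp_all add: carrier_function_algebra)
        show "\<forall>y\<in>?W. g y \<noteq> 0 \<and> \<phi> y = f y / g y"
        proof
          fix z assume "z \<in> ?W"
          then have z: "z \<in> Y" "pt z \<in> W" by (auto simp: topspace_zariski)
          then show "g z \<noteq> 0 \<and> \<phi> z = f z / g z"
            using eq f g by (auto simp: coord_pt value_at_pt)
        qed
      qed
    qed
  qed
qed

end

section \<open>Points of the configuration space\<close>

lemma config_coords_eq:
  "config_coords = {\<lambda>p. fst p $ a | a. True} \<union> {\<lambda>p. snd p $ a | a. True} \<union>
    {\<lambda>p. inverse (fst p $ a - fst p $ c) | a c. a \<noteq> c}"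
  by (simp add: config_coords_def case_prod_beta')

lemma countable_config_coords: "countable (config_coords :: ('n::finite config_point \<Rightarrow> complex) set)"
proof -
  have eq: "config_coords = range (\<lambda>a p. fst p $ a) \<union> range (\<lambda>a p. snd p $ a) \<union>
    (\<lambda>(a, c) (p :: 'n config_point). inverse (fst p $ a - fst p $ c)) ` {(a, c). a \<noteq> c}"
    unfolding config_coords_eq by auto
  show ?thesis unfolding eq by (intro countable_finite finite_UnI finite_imageI finite)
qed

lemma config_coords_cases:
  assumes "g \<in> config_coords"
  obtains (x) a where "g = (\<lambda>p. fst p $ a)" | (y) a where "g = (\<lambda>p. snd p $ a)"
    | (gap) a c where "a \<noteq> c" "g = (\<lambda>p. inverse (fst p $ a - fst p $ c))"
  using assms unfolding config_coords_eq
  by (elim UnE CollectE exE conjE) (rule that; assumption)+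

lemma regular_config_x: "regular config_space config_coords (\<lambda>p. fst p $ a)"
  by (rule regular_gen) (auto simp: config_coords_eq)
lemma regular_config_y: "regular config_space config_coords (\<lambda>p. snd p $ a)"
  by (rule regular_gen) (auto simp: config_coords_eq)
lemma regular_config_gap: "a \<noteq> c \<Longrightarrow> regular config_space config_coords (\<lambda>p. inverse (fst p $ a - fst p $ c))"
  by (rule regular_gen) (auto simp: config_coords_eq)

lemma config_spaceD: "p \<in> config_space \<Longrightarrow> a \<noteq> c \<Longrightarrow> fst p $ a \<noteq> fst p $ c"
  by (cases p) (auto simp: config_space_def)

lemma inverse_diff_inverse_mult:
  fixes u v :: complex
  assumes "u \<noteq> 0" "v \<noteq> 0" shows "inverse u * - inverse v * (u - v) = inverse u - inverse v"
  using assms by (simp add: field_simps)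

text \<open>
  The residues of the coordinates modulo \<open>m\<close> are the coordinates of a point \<open>q\<close>. Its \<open>x\<close>-coordinates are
  distinct, since the differences \<open>x\<^sub>a - x\<^sub>c\<close> are units.
\<close>

lemma config_nullstellensatz:
  assumes m: "maximalideal m (function_algebra (config_space :: 'n::finite config_point set) config_coords)"
  shows "\<exists>y\<in>config_space. m = point_ideal config_space config_coords y"
proof -
  let ?Y = "config_space :: 'n config_point set" and ?R = "function_algebra config_space (config_coords :: ('n config_point \<Rightarrow> complex) set)"
  interpret maximalideal m ?R by (rule m)
  have id: "ideal m ?R" by (rule is_ideal)
  have unit: False if "c \<noteq> 0" "(\<lambda>p\<in>?Y. c) \<in> m" for c
  proof -
    have "\<one>\<^bsub>?R\<^esub> \<in> m"
      using ideal_mult[OF id that(2) regular_const[of _ _ "inverse c"]] that(1) by (simp add: function_ring_def)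
    then show False using one_imp_carrier I_notcarr by blast
  qed
  have "\<exists>c. (\<lambda>p\<in>?Y. g p - c) \<in> m" if "regular ?Y config_coords g" for g
    by (rule maximal_ideal_value[OF countable_config_coords m that])
  then have "\<exists>c. (\<lambda>p\<in>?Y. fst p $ a - c) \<in> m" "\<exists>c. (\<lambda>p\<in>?Y. snd p $ a - c) \<in> m" for a
    using regular_config_x regular_config_y by blast+
  then obtain x y where x: "\<And>a. (\<lambda>p\<in>?Y. fst p $ a - x a) \<in> m" and y: "\<And>a. (\<lambda>p\<in>?Y. snd p $ a - y a) \<in> m"
    by metis
  define q where "q = (\<chi> a. x a, \<chi> a. y a)"
  have xq: "(\<lambda>p\<in>?Y. fst p $ a - fst q $ a) \<in> m" and yq: "(\<lambda>p\<in>?Y. snd p $ a - snd q $ a) \<in> m" for a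
    using x y by (simp_all add: q_def)
  have "fst q $ a \<noteq> fst q $ c" if "a \<noteq> c" for a c
  proof
    assume eq: "fst q $ a = fst q $ c"
    from ideal_mult[OF id ideal_diff[OF id xq[of a] xq[of c]] regular_config_gap[OF that]]
    have "(\<lambda>p\<in>?Y. 1) \<in> m"
      by (rule restrict_mem_cong) (use config_spaceD[OF _ that] in \<open>simp add: eq\<close>)
    then show False using unit[of 1] by simp
  qed
  then have q: "q \<in> ?Y" by (cases q) (auto simp: config_space_def)
  have residue: "(\<lambda>p\<in>?Y. f p - f q) \<in> m" if "regular ?Y config_coords f" for f
    using that
  proof (induction rule: regular_induct)
    case (cong f g)
    from cong(1) show ?case by (rule restrict_mem_cong) (simp add: cong(2) q)
  next
    case (const c)
    show ?case by (rule restrict_mem_cong[OF ideal_zero[OF id]]) simp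
  next
    case (gen g)
    then show ?case
    proof (cases rule: config_coords_cases)
      case (gap a c)
      have "(\<lambda>p\<in>?Y. (inverse (fst p $ a - fst p $ c) * - inverse (fst q $ a - fst q $ c))
          * ((fst p $ a - fst q $ a) - (fst p $ c - fst q $ c))) \<in> m"
        by (intro ideal_mult[OF id] ideal_diff[OF id] xq regular_mult regular_config_gap regular_const gap(1))
      then show ?thesis
      proof (rule restrict_mem_cong)
        fix p assume "p \<in> ?Y"
        then have "fst p $ a - fst p $ c \<noteq> 0" "fst q $ a - fst q $ c \<noteq> 0"
          using config_spaceD[OF _ gap(1)] q by auto
        then have "inverse (fst p $ a - fst p $ c) * - inverse (fst q $ a - fst q $ c)
            * ((fst p $ a - fst p $ c) - (fst q $ a - fst q $ c)) = g p - g q"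
          unfolding gap(2) by (rule inverse_diff_inverse_mult)
        moreover have "(fst p $ a - fst q $ a) - (fst p $ c - fst q $ c)
            = (fst p $ a - fst p $ c) - (fst q $ a - fst q $ c)" by simp
        ultimately show "(inverse (fst p $ a - fst p $ c) * - inverse (fst q $ a - fst q $ c))
          * ((fst p $ a - fst q $ a) - (fst p $ c - fst q $ c)) = g p - g q"
          by (simp only:)
      qed
    qed (simp_all only: xq yq)
  next
    case (add f g)
    from ideal_add[OF id add.IH] show ?case by (rule restrict_mem_cong) simp
  next
    case (mult f g)
    have "(\<lambda>p\<in>?Y. g p * (f p - f q) + f q * (g p - g q)) \<in> m"
      by (intro ideal_add[OF id] ideal_mult[OF id] mult regular_const)
    then show ?case by (rule restrict_mem_cong) (simp add: algebra_simps)
  qed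
  have mem: "restrict f ?Y \<in> m \<longleftrightarrow> f q = 0" if f: "regular ?Y config_coords f" for f
  proof
    assume "restrict f ?Y \<in> m"
    from ideal_diff[OF id this residue[OF f]] have "(\<lambda>p\<in>?Y. f q) \<in> m"
      by (rule restrict_mem_cong) simp
    then show "f q = 0" using unit by blast
  next
    assume "f q = 0"
    with residue[OF f] show "restrict f ?Y \<in> m" by (intro restrict_mem_cong[OF residue[OF f]]) simp
  qed
  have "m = point_ideal config_space config_coords q"
  proof (intro equalityI subsetI)
    fix f assume "f \<in> m"
    then obtain g where "f = restrict g ?Y" "regular ?Y config_coords g" "restrict g ?Y \<in> m"
      by (rule ideal_memE[OF id])
    then show "f \<in> point_ideal config_space config_coords q" using mem q by (simp add: point_ideal_mem)
  next
    fix f assume f: "f \<in> point_ideal config_space config_coords q"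
    then have "f \<in> carrier ?R" by (simp add: point_ideal_def)
    then obtain g where g: "f = restrict g ?Y" "regular ?Y config_coords g" by (rule in_algebraE)
    then show "f \<in> m" using f q mem by (simp add: point_ideal_mem)
  qed
  then show ?thesis using q by blast
qed

section \<open>Pulling back along P and along its section\<close>

lemma reg_map_P:
  assumes "regular config_space config_coords f" shows "reg (\<lambda>x. f (map_P x))"
  using assms map_P_config
proof (rule regular_compose)
  fix g :: "'a config_point \<Rightarrow> complex" assume "g \<in> config_coords"
  then show "reg (\<lambda>x. g (map_P x))"
  proof (cases rule: config_coords_cases)
    case (x a)
    then show ?thesis by (simp add: map_P_def case_prod_beta' reg_r)
  next
    case (y a)
    have "reg (\<lambda>x. inverse_gap_product a (r_of x) * trace (l_product a (r_of x) ** s_of x))"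
      unfolding trace_def matrix_entry l_product_l_list
      by (intro regular_mult reg_inverse_gap_product regular_sum reg_l_list reg_s)
    moreover have "reg (\<lambda>x. g (map_P x)) \<longleftrightarrow> reg (\<lambda>x. inverse_gap_product a (r_of x) * trace (l_product a (r_of x) ** s_of x))"
      by (rule regular_cong)
        (simp add: y map_P_def case_prod_beta' s_prime_def trace_l_product cotangent_rssD(1) inverse_gap_product_def
          comp_def flip: prod_inversef)
    ultimately show ?thesis by simp
  next
    case (gap a c)
    then show ?thesis by (simp add: map_P_def case_prod_beta' reg_gap)
  qed
qed

lemma section_point_cotangent: "p \<in> config_space \<Longrightarrow> section_point p \<in> cotangent_rss"
  by (cases p) (auto simp: section_point_def cotangent_rss_iff config_space_def upper_tri_def lower_tri_def diag_mat_entry)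

lemma section_point_mu_zero: "p \<in> config_space \<Longrightarrow> section_point p \<in> mu_zero_rss"
  using section_point_cotangent[of p]
  by (auto simp: mu_zero_rss_def section_point_def case_prod_beta' vec_eq_iff moment_diag diag_mat_entry)

lemma map_P_section_point:
  assumes "p \<in> config_space" shows "map_P (section_point p) = p"
proof -
  have "s_prime a (diag_mat (fst p)) (diag_mat (snd p)) = snd p $ a" for a
    by (subst s_prime_diagonal) (use config_spaceD[OF assms] in \<open>auto simp: diag_mat_entry\<close>)
  then show ?thesis
    by (cases p) (simp add: map_P_def section_point_def diag_mat_entry vec_eq_iff)
qed

lemma regular_section_point:
  assumes "reg f" shows "regular config_space config_coords (\<lambda>p. f (section_point p))"
  using assms section_point_cotangent
proof (rule regular_compose)
  fix g :: "'a point \<Rightarrow> complex" assume "g \<in> cotangent_coords"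
  then show "regular config_space config_coords (\<lambda>p. g (section_point p))"
  proof (cases rule: coords_cases)
    case (r a c)
    then show ?thesis by (cases "a = c")
      (simp_all add: section_point_def case_prod_beta' diag_mat_entry regular_config_x regular_const)
  next
    case (s a c)
    then show ?thesis by (cases "a = c")
      (simp_all add: section_point_def case_prod_beta' diag_mat_entry regular_config_y regular_const)
  next
    case (gap a c)
    then show ?thesis
      by (simp add: section_point_def case_prod_beta' diag_mat_entry regular_config_gap)
  qed (simp_all add: section_point_def case_prod_beta' regular_const)
qed

section \<open>The comorphism is an isomorphism onto the invariants\<close>

lemma moment_subgroup: "abelian_subgroup moment_ideal (function_algebra cotangent_rss cotangent_coords)"
  by (intro abelian_subgroupI3 ideal.axioms(1)[OF moment_ideal_ideal]
      ring.is_abelian_group cring.axioms(1)[OF cring_function_algebra])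

lemma mem_coset:
  assumes "reg f" "reg g"
  shows "restrict g cotangent_rss \<in> moment_ideal +>\<^bsub>cotangent_ring\<^esub> restrict f cotangent_rss \<longleftrightarrow>
    null (\<lambda>x. g x - f x)"
proof -
  have "restrict g cotangent_rss \<in> moment_ideal +>\<^bsub>cotangent_ring\<^esub> restrict f cotangent_rss \<longleftrightarrow>
     restrict g cotangent_rss \<ominus>\<^bsub>cotangent_ring\<^esub> restrict f cotangent_rss \<in> moment_ideal"
    unfolding cotangent_ring_algebra
    by (rule abelian_subgroup.a_rcos_module_minus[OF moment_subgroup])
      (use assms cring.axioms(1)[OF cring_function_algebra] in \<open>auto simp: restrict_in_algebra\<close>)
  then show ?thesis
    unfolding null_def cotangent_ring_algebra algebra_minus[OF assms(2,1)] .
qed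

lemma coset_eq:
  assumes "reg f" "null (\<lambda>x. g x - f x)"
  shows "moment_ideal +>\<^bsub>cotangent_ring\<^esub> restrict f cotangent_rss =
    moment_ideal +>\<^bsub>cotangent_ring\<^esub> restrict g cotangent_rss"
proof -
  have "reg g" using regular_add[OF null_reg[OF assms(2)] assms(1)] by simp
  then have "restrict g cotangent_rss \<in> moment_ideal +>\<^bsub>cotangent_ring\<^esub> restrict f cotangent_rss"
    using assms mem_coset by blast
  then show ?thesis unfolding cotangent_ring_algebra
    by (rule abelian_subgroup.a_repr_independence'[OF moment_subgroup]) (use assms in \<open>simp add: restrict_in_algebra\<close>)
qed

lemma coset_subset:
  assumes "C = moment_ideal +>\<^bsub>cotangent_ring\<^esub> restrict f cotangent_rss" "reg f" "h \<in> C"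
  obtains g where "h = restrict g cotangent_rss" "reg g" "null (\<lambda>x. g x - f x)"
proof -
  interpret ring "function_algebra cotangent_rss cotangent_coords :: ('a point \<Rightarrow> complex) ring"
    by (rule cring.axioms(1)[OF cring_function_algebra])
  have "moment_ideal +>\<^bsub>cotangent_ring\<^esub> restrict f cotangent_rss
      \<subseteq> carrier (function_algebra cotangent_rss cotangent_coords)"
    unfolding cotangent_ring_algebra
    by (rule a_r_coset_subset_G)
      (use assms(2) ideal.Icarr[OF moment_ideal_ideal] in \<open>auto simp: restrict_in_algebra\<close>)
  then have "h \<in> carrier (function_algebra cotangent_rss cotangent_coords)"
    using assms by blast
  then obtain g where g: "h = restrict g cotangent_rss" "reg g" by (rule in_algebraE)
  then show ?thesis using that assms mem_coset by blast
qed

lemma carrier_mu_ringE: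
  assumes "C \<in> carrier mu_ring"
  obtains f where "reg f" "C = moment_ideal +>\<^bsub>cotangent_ring\<^esub> restrict f cotangent_rss"
proof -
  obtain h where h: "h \<in> carrier cotangent_ring" "C = moment_ideal +>\<^bsub>cotangent_ring\<^esub> h"
    using assms by (auto simp: mu_ring_def FactRing_def A_RCOSETS_def')
  obtain g where "h = restrict g cotangent_rss" "reg g"
    using h(1) unfolding cotangent_ring_algebra by (rule in_algebraE)
  then show ?thesis using that h by blast
qed

lemma morphism_act:
  assumes "b \<in> Borel" shows "morphism (act b)"
  unfolding morphism_def
proof (intro conjI ballI)
  show "act b x \<in> cotangent_rss" if "x \<in> cotangent_rss" for x
    by (rule act_cotangent_rss[OF assms that])
  fix g :: "'a point \<Rightarrow> complex" assume g: "g \<in> cotangent_coords"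
  show "reg (\<lambda>x. g (act b x))"
    by (rule separated_regular_fixed[OF separated_act[OF regular_gen[OF g]] assms])
qed

text \<open>
  The moment ideal is \<open>B\<close>-stable because the moment map is equivariant.
\<close>

lemma null_act:
  assumes "null f" "b \<in> Borel" shows "null (\<lambda>x. f (act b x))"
  using assms(1) morphism_act[OF assms(2)]
proof (rule null_morphism)
  fix a c
  have "null (\<lambda>x. (b ** moment x ** matrix_inv b) $ a $ c)"
    by (intro null_conj_moment regular_const)
  moreover have "null (\<lambda>x. moment (act b x) $ a $ c) \<longleftrightarrow>
     null (\<lambda>x. if c \<le> a then (b ** moment x ** matrix_inv b) $ a $ c else 0)"
    by (rule null_cong) (simp add: moment_act[OF assms(2)] dual_class_entry)
  ultimately show "null (\<lambda>x. moment (act b x) $ a $ c)" by (cases "c \<le> a") (simp_all add: null_zero)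
qed

lemma act_function_restrict:
  assumes "b \<in> Borel"
  shows "act_function b (restrict g cotangent_rss) = (\<lambda>x\<in>cotangent_rss. g (act (matrix_inv b) x))"
  unfolding act_function_def
  by (rule restrict_ext) (simp add: act_cotangent_rss matrix_inv_Borel assms)

lemma comorphism_in_mu_ring:
  assumes "regular config_space config_coords g"
  shows "comorphism_P (restrict g config_space)
     = moment_ideal +>\<^bsub>cotangent_ring\<^esub> (\<lambda>x\<in>cotangent_rss. g (map_P x))"
proof -
  have "(\<lambda>x\<in>cotangent_rss. restrict g config_space (map_P x)) = (\<lambda>x\<in>cotangent_rss. g (map_P x))"
    by (rule restrict_ext) (simp add: map_P_config)
  then show ?thesis by (simp add: comorphism_P_def)
qed

lemma comorphism_invariant:
  assumes g: "regular config_space config_coords g" and b: "b \<in> Borel"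
  defines "C \<equiv> moment_ideal +>\<^bsub>cotangent_ring\<^esub> (\<lambda>x\<in>cotangent_rss. g (map_P x))"
  shows "act_function b ` C = C"
proof -
  have sub: "act_function b h \<in> C" if b: "b \<in> Borel" and "h \<in> C" for b h
  proof -
    obtain k where k: "h = restrict k cotangent_rss" "reg k" "null (\<lambda>x. k x - g (map_P x))"
      using coset_subset[OF C_def[THEN meta_eq_to_obj_eq] reg_map_P[OF g] \<open>h \<in> C\<close>] .
    have b': "matrix_inv b \<in> Borel" using b by (rule matrix_inv_Borel)
    have "null (\<lambda>x. k (act (matrix_inv b) x) - g (map_P (act (matrix_inv b) x)))"
      by (rule null_act[OF k(3) b'])
    then have "null (\<lambda>x. k (act (matrix_inv b) x) - g (map_P x))"
      by (rule iffD1[OF null_cong, rotated]) (simp add: map_P_act[OF b'])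
    then show ?thesis
      unfolding k(1) act_function_restrict[OF b] C_def
      using mem_coset[OF reg_map_P[OF g] reg_morphism[OF k(2) morphism_act[OF b']]] by blast
  qed
  have "h \<in> act_function b ` C" if h: "h \<in> C" for h
  proof
    show "act_function (matrix_inv b) h \<in> C" by (rule sub[OF matrix_inv_Borel[OF b] h])
    obtain k where k: "h = restrict k cotangent_rss"
      using coset_subset[OF C_def[THEN meta_eq_to_obj_eq] reg_map_P[OF g] h] .
    show "h = act_function b (act_function (matrix_inv b) h)"
      unfolding k act_function_restrict[OF matrix_inv_Borel[OF b]] act_function_restrict[OF b]
      by (rule restrict_ext) (use act_matrix_inv[OF matrix_inv_Borel[OF b]] in simp)
  qed
  then show ?thesis using sub[OF b] by blast
qed

lemma invariant_coset:
  assumes "C \<in> carrier invariant_ring" "reg f" "C = moment_ideal +>\<^bsub>cotangent_ring\<^esub> restrict f cotangent_rss"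
  shows "invariant_mod_moment f"
  unfolding invariant_mod_moment_def
proof (intro conjI ballI assms)
  fix b :: "'a sqmat" assume b: "b \<in> Borel"
  have b': "matrix_inv b \<in> Borel" using b by (rule matrix_inv_Borel)
  have "null (\<lambda>x. f x - f x)" by (simp add: null_zero)
  then have "restrict f cotangent_rss \<in> C" unfolding assms(3) using mem_coset[OF assms(2,2)] by blast
  moreover have "act_function (matrix_inv b) ` C = C"
    using assms(1) b' by (simp add: invariant_ring_def)
  ultimately have "act_function (matrix_inv b) (restrict f cotangent_rss) \<in> C" by blast
  then show "null (\<lambda>x. f (act b x) - f x)"
    unfolding act_function_restrict[OF b'] BorelD(5)[OF b] assms(3)
    using mem_coset[OF assms(2) reg_morphism[OF assms(2) morphism_act[OF b]]] by blast
qed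

lemma config_ring_algebra: "config_ring = function_algebra config_space config_coords"
  by (simp add: config_ring_def config_functions_def)

text \<open>
  Injectivity holds because \<open>\<sigma>\<close> is a section with values in \<open>\<mu>\<^sup>-\<^sup>1(0)\<close>, surjectivity by
  \<open>invariant_normal_form\<close>.
\<close>

theorem comorphism_iso:
  "(comorphism_P :: _ \<Rightarrow> ('n::{finite,wellorder} point \<Rightarrow> complex) set) \<in> ring_iso config_ring invariant_ring"
proof -
  let ?\<kappa> = "comorphism_P :: _ \<Rightarrow> ('n point \<Rightarrow> complex) set"
  let ?F = "config_ring :: ('n config_point \<Rightarrow> complex) ring"
  let ?Y = "config_space :: 'n config_point set" and ?X = "cotangent_rss :: 'n point set"
  define pull where "pull f = (\<lambda>x\<in>?X. f (map_P x))" for f :: "'n config_point \<Rightarrow> complex"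
  have pull: "pull (restrict g ?Y) = (\<lambda>x\<in>?X. g (map_P x))" for g
    unfolding pull_def by (rule restrict_ext) (simp add: map_P_config)
  have "pull \<in> ring_hom ?F cotangent_ring"
    unfolding config_ring_algebra cotangent_ring_algebra
  proof (rule ring_hom_memI)
    fix f g :: "'n config_point \<Rightarrow> complex"
    assume "f \<in> carrier (function_algebra ?Y config_coords)"
    then obtain f' where f: "f = restrict f' ?Y" "regular ?Y config_coords f'" by (rule in_algebraE)
    show "pull f \<in> carrier (function_algebra ?X cotangent_coords)"
      unfolding f pull restrict_in_algebra by (rule reg_map_P[OF f(2)])
    assume "g \<in> carrier (function_algebra ?Y config_coords)"
    then obtain g' where g: "g = restrict g' ?Y" "regular ?Y config_coords g'" by (rule in_algebraE)
    show "pull (f \<otimes>\<^bsub>function_algebra ?Y config_coords\<^esub> g) = pull f \<otimes>\<^bsub>function_algebra ?X cotangent_coords\<^esub> pull g"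
      unfolding f(1) g(1) algebra_mult pull ..
    show "pull (f \<oplus>\<^bsub>function_algebra ?Y config_coords\<^esub> g) = pull f \<oplus>\<^bsub>function_algebra ?X cotangent_coords\<^esub> pull g"
      unfolding f(1) g(1) algebra_add pull ..
  next
    show "pull \<one>\<^bsub>function_algebra ?Y config_coords\<^esub> = \<one>\<^bsub>function_algebra ?X cotangent_coords\<^esub>"
      using pull[of "\<lambda>_. 1"] by (simp add: function_ring_def)
  qed
  moreover have "(+>\<^bsub>cotangent_ring\<^esub>) moment_ideal \<in> ring_hom cotangent_ring mu_ring"
    unfolding mu_ring_def cotangent_ring_algebra by (rule ideal.rcos_ring_hom[OF moment_ideal_ideal])
  ultimately have hom': "((+>\<^bsub>cotangent_ring\<^esub>) moment_ideal) \<circ> pull \<in> ring_hom ?F mu_ring"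
    by (rule ring_hom_trans)
  have eq: "?\<kappa> = ((+>\<^bsub>cotangent_ring\<^esub>) moment_ideal) \<circ> pull"
    by (rule ext) (simp add: comorphism_P_def pull_def)
  have hom: "?\<kappa> \<in> ring_hom ?F mu_ring"
    unfolding eq by (rule hom')
  have closed: "?\<kappa> f \<in> carrier invariant_ring" if f: "f \<in> carrier ?F" for f
  proof -
    obtain g where g: "f = restrict g ?Y" "regular ?Y config_coords g"
      using f unfolding config_ring_algebra by (rule in_algebraE)
    have "?\<kappa> f \<in> carrier mu_ring" using hom f by (rule ring_hom_closed)
    then show ?thesis
      using comorphism_invariant[OF g(2)] by (simp add: invariant_ring_def g comorphism_in_mu_ring)
  qed
  have inj: "inj_on ?\<kappa> (carrier ?F)"
  proof (rule inj_onI)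
    fix f g :: "'n config_point \<Rightarrow> complex"
    assume fg: "f \<in> carrier ?F" "g \<in> carrier ?F" and eq: "?\<kappa> f = ?\<kappa> g"
    obtain f' where f: "f = restrict f' ?Y" "regular ?Y config_coords f'"
      using fg(1) unfolding config_ring_algebra by (rule in_algebraE)
    obtain g' where g: "g = restrict g' ?Y" "regular ?Y config_coords g'"
      using fg(2) unfolding config_ring_algebra by (rule in_algebraE)
    have "null (\<lambda>x. f' (map_P x) - f' (map_P x))" by (simp add: null_zero)
    then have "(\<lambda>x\<in>?X. f' (map_P x)) \<in> ?\<kappa> f"
      unfolding f comorphism_in_mu_ring[OF f(2)] using mem_coset[OF reg_map_P reg_map_P, OF f(2) f(2)] by blast
    then have null: "null (\<lambda>x. f' (map_P x) - g' (map_P x))"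
      unfolding eq unfolding g comorphism_in_mu_ring[OF g(2)]
      using mem_coset[OF reg_map_P reg_map_P, OF g(2) f(2)] by blast
    show "f = g" unfolding f g
    proof (rule restrict_ext)
      fix p assume p: "p \<in> ?Y"
      show "f' p = g' p"
        using null_vanishes[OF null section_point_mu_zero[OF p]] by (simp add: map_P_section_point[OF p])
    qed
  qed
  have surj: "C \<in> ?\<kappa> ` carrier ?F" if C: "C \<in> carrier invariant_ring" for C
  proof -
    have "C \<in> carrier mu_ring" using C by (simp add: invariant_ring_def)
    then obtain f where f: "reg f" "C = moment_ideal +>\<^bsub>cotangent_ring\<^esub> restrict f ?X"
      by (rule carrier_mu_ringE)
    have nf: "null (\<lambda>x. f x - f (section_point (map_P x)))"
      by (rule invariant_normal_form[OF invariant_coset[OF C f]])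
    let ?g = "\<lambda>p. f (section_point p)"
    have g: "regular ?Y config_coords ?g" by (rule regular_section_point[OF f(1)])
    have "C = ?\<kappa> (restrict ?g ?Y)"
      unfolding f(2) comorphism_in_mu_ring[OF g] by (rule coset_eq[OF f(1) null_sym[OF nf]])
    moreover have "restrict ?g ?Y \<in> carrier ?F"
      unfolding config_ring_algebra restrict_in_algebra by (rule g)
    ultimately show ?thesis by blast
  qed
  have "?\<kappa> \<in> ring_hom ?F invariant_ring"
  proof (rule ring_hom_memI)
    fix f g :: "'n config_point \<Rightarrow> complex" assume "f \<in> carrier ?F"
    then show "?\<kappa> f \<in> carrier invariant_ring" by (rule closed)
    assume "g \<in> carrier ?F"
    then show "?\<kappa> (f \<otimes>\<^bsub>?F\<^esub> g) = ?\<kappa> f \<otimes>\<^bsub>invariant_ring\<^esub> ?\<kappa> g"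
      "?\<kappa> (f \<oplus>\<^bsub>?F\<^esub> g) = ?\<kappa> f \<oplus>\<^bsub>invariant_ring\<^esub> ?\<kappa> g"
      using ring_hom_mult[OF hom \<open>f \<in> carrier ?F\<close>] ring_hom_add[OF hom \<open>f \<in> carrier ?F\<close>]
      by (simp_all add: invariant_ring_def)
  next
    show "?\<kappa> \<one>\<^bsub>?F\<^esub> = \<one>\<^bsub>invariant_ring\<^esub>"
      using ring_hom_one[OF hom] by (simp add: invariant_ring_def)
  qed
  moreover have "bij_betw ?\<kappa> (carrier ?F) (carrier invariant_ring)"
    using inj closed surj by (auto simp: bij_betw_def)
  ultimately show ?thesis by (simp add: ring_iso_def)
qed

lemma ring_invariant_ring: "ring (invariant_ring :: ('n::{finite,wellorder} point \<Rightarrow> complex) set ring)"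
proof -
  have R: "cring (config_ring :: ('n config_point \<Rightarrow> complex) ring)" unfolding config_ring_algebra by (rule cring_function_algebra)
  have "(\<lambda>p\<in>(config_space :: 'n config_point set). 0 :: complex) = \<zero>\<^bsub>config_ring\<^esub>" by (simp add: config_ring_def function_ring_def)
  moreover have "comorphism_P (\<lambda>p\<in>config_space. 0) = (moment_ideal :: ('n point \<Rightarrow> complex) set)"
    unfolding comorphism_in_mu_ring[OF regular_const] unfolding cotangent_ring_algebra
    by (rule abelian_subgroup.a_rcos_const[OF moment_subgroup ideal_zero[OF moment_ideal_ideal]])
  ultimately have "comorphism_P \<zero>\<^bsub>config_ring\<^esub> = \<zero>\<^bsub>invariant_ring :: ('n point \<Rightarrow> complex) set ring\<^esub>"
    by (simp add: invariant_ring_def mu_ring_def FactRing_def)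
  then show ?thesis
    using ring.ring_iso_imp_img_ring[OF cring.axioms(1)[OF R] comorphism_iso] by simp
qed

theorem theorem1p6:
  shows "(map_P :: 'n::{finite,wellorder} point \<Rightarrow> _) \<in> mu_zero_rss \<rightarrow> config_space
    \<and> quotient_map_pt ` (mu_zero_rss :: 'n point set) = quotient_points
    \<and> (\<forall>x \<in> (mu_zero_rss :: 'n point set). \<forall>y \<in> orbit_closure x.
          quotient_map_pt y = quotient_map_pt x)
    \<and> (\<exists>p. (\<forall>x \<in> (mu_zero_rss :: 'n point set). p (quotient_map_pt x) = map_P x)
          \<and> bij_betw p quotient_points config_space
          \<and> homeomorphic_map quotient_topology config_topology p
          \<and> variety_isomorphism quotient_topology quotient_functions
               config_topology config_functions p)
    \<and> (comorphism_P :: _ \<Rightarrow> ('n point \<Rightarrow> complex) set) \<in> ring_iso config_ring invariant_ring"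
proof -
  let ?A = "invariant_ring :: ('n point \<Rightarrow> complex) set ring" and ?Y = "config_space :: 'n config_point set"
  have mu_cot: "x \<in> cotangent_rss" if "x \<in> mu_zero_rss" for x :: "'n point"
    using that by (simp add: mu_zero_rss_def)
  interpret spectrum_iso ?Y config_coords ?A comorphism_P invariant_const
  proof (rule spectrum_iso.intro)
    show "ring ?A" by (rule ring_invariant_ring)
    show "comorphism_P \<in> ring_iso (function_algebra ?Y config_coords) ?A"
      using comorphism_iso unfolding config_ring_algebra .
    show "invariant_const c = comorphism_P (\<lambda>y\<in>?Y. c)" for c
      unfolding comorphism_in_mu_ring[OF regular_const] invariant_const_def ..
    show "\<exists>y\<in>?Y. m = point_ideal ?Y config_coords y"
      if "maximalideal m (function_algebra ?Y config_coords)" for m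
      by (rule config_nullstellensatz[OF that])
    fix y z :: "'n config_point"
    assume "\<And>f. regular ?Y config_coords f \<Longrightarrow> f y = f z"
    then have "fst y $ a = fst z $ a" "snd y $ a = snd z $ a" for a
      using regular_config_x[of a] regular_config_y[of a] by blast+
    then show "y = z" by (simp add: prod_eq_iff vec_eq_iff)
  qed
  have point: "quotient_map_pt x = pt (map_P x)" if x: "x \<in> mu_zero_rss" for x
  proof -
    have "(\<forall>f\<in>comorphism_P g. f x = 0) \<longleftrightarrow> g (map_P x) = 0" if g: "g \<in> carrier R" for g
    proof -
      obtain h where h: "g = restrict h ?Y" "regular ?Y config_coords h" using g by (rule in_algebraE)
      have C: "comorphism_P g = moment_ideal +>\<^bsub>cotangent_ring\<^esub> (\<lambda>x\<in>cotangent_rss. h (map_P x))"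
        unfolding h(1) by (rule comorphism_in_mu_ring[OF h(2)])
      have "f x = h (map_P x)" if f: "f \<in> comorphism_P g" for f
      proof -
        obtain k where k: "f = restrict k cotangent_rss" "null (\<lambda>x. k x - h (map_P x))"
          using coset_subset[OF C reg_map_P[OF h(2)] f] .
        then show ?thesis using null_vanishes[OF k(2) x] mu_cot[OF x] by simp
      qed
      moreover have "null (\<lambda>x :: 'n point. h (map_P x) - h (map_P x))" by (simp add: null_zero)
      then have "(\<lambda>x\<in>cotangent_rss. h (map_P x)) \<in> comorphism_P g"
        unfolding C using mem_coset[OF reg_map_P reg_map_P, OF h(2) h(2)] by blast
      ultimately have "(\<forall>f\<in>comorphism_P g. f x = 0) \<longleftrightarrow> h (map_P x) = 0" by metis
      then show ?thesis using map_P_config[OF mu_cot[OF x]] by (simp add: h)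
    qed
    then show ?thesis
      unfolding quotient_map_pt_def pt_def point_ideal_def bij_betw_imp_surj_on[OF bij, symmetric]
      by auto
  qed
  have surj: "map_P ` (mu_zero_rss :: 'n point set) = ?Y"
  proof
    show "map_P ` (mu_zero_rss :: 'n point set) \<subseteq> ?Y" using map_P_config mu_cot by blast
    show "?Y \<subseteq> map_P ` (mu_zero_rss :: 'n point set)"
      using map_P_section_point section_point_mu_zero by (metis imageI subsetI)
  qed
  \<comment> \<open>Functions of \<open>P\<close> are constant on the orbit, so their level sets are closed sets that contain its closure.\<close>
  have closure: "map_P y = map_P x" if x: "x \<in> mu_zero_rss" and y: "y \<in> orbit_closure x" for x y :: "'n point"
  proof (rule separates)
    let ?T = "zariski (cotangent_rss :: 'n point set) cotangent_functions"
    have y: "y \<in> mu_zero_rss" and meets: "\<And>U. y \<in> U \<Longrightarrow> openin ?T U \<Longrightarrow> \<exists>b\<in>Borel. act b x \<in> U"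
      using y unfolding orbit_closure_def in_closure_of topspace_subtopology openin_subtopology by blast+
    show "map_P y \<in> ?Y" "map_P x \<in> ?Y" using x y by (simp_all add: map_P_config mu_cot)
    fix f assume f: "regular ?Y config_coords f"
    show "f (map_P y) = f (map_P x)"
    proof (rule ccontr)
      assume neq: "f (map_P y) \<noteq> f (map_P x)"
      let ?h = "\<lambda>z\<in>cotangent_rss. f (map_P z) - f (map_P x)"
      let ?U = "{z \<in> cotangent_rss. ?h z \<noteq> 0}"
      have "reg (\<lambda>z. f (map_P z) - f (map_P x))"
        by (intro regular_diff reg_map_P[OF f] regular_const)
      then have "?h \<in> cotangent_functions" by (simp add: regular_def cotangent_functions_def)
      then have U: "openin ?T ?U" unfolding zariski_def by (intro topology_generated_by_Basis) blast
      have "y \<in> ?U" using neq mu_cot[OF y] by simp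
      from meets[OF this U] obtain b where b: "b \<in> Borel" "act b x \<in> ?U" by (rule bexE)
      then show False using map_P_act[OF b(1) mu_cot[OF x]] by (simp split: if_splits)
    qed
  qed
  show ?thesis
  proof (intro conjI ballI)
    show "map_P \<in> (mu_zero_rss :: 'n point set) \<rightarrow> config_space" using surj by blast
    have "quotient_map_pt ` (mu_zero_rss :: 'n point set) = pt ` map_P ` (mu_zero_rss :: 'n point set)"
      using point by (auto simp: image_iff)
    then show "quotient_map_pt ` (mu_zero_rss :: 'n point set) = quotient_points"
      unfolding surj Spec_points_eq .
    show "quotient_map_pt y = quotient_map_pt x"
      if "x \<in> mu_zero_rss" "y \<in> orbit_closure x" for x y :: "'n point"
    proof -
      have "y \<in> mu_zero_rss" using that(2) unfolding orbit_closure_def in_closure_of by simp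
      then show ?thesis using closure[OF that] point that(1) by simp
    qed
    show "comorphism_P \<in> ring_iso config_ring ?A" by (rule comorphism_iso)
    show "\<exists>p. (\<forall>x \<in> (mu_zero_rss :: 'n point set). p (quotient_map_pt x) = map_P x)
          \<and> bij_betw p quotient_points config_space
          \<and> homeomorphic_map quotient_topology config_topology p
          \<and> variety_isomorphism quotient_topology quotient_functions
               config_topology config_functions p"
    proof (intro exI conjI ballI)
      show "coord (quotient_map_pt x) = map_P x" if "x \<in> mu_zero_rss" for x
        by (simp only: point[OF that] coord_pt[OF map_P_config[OF mu_cot[OF that]]])
      show "bij_betw coord quotient_points config_space" by (rule bij_coord)
      show "homeomorphic_map quotient_topology config_topology coord"
        unfolding config_functions_def using homeomorphic_maps_coord homeomorphic_map_maps by blast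
      show "variety_isomorphism quotient_topology quotient_functions config_topology config_functions coord"
        unfolding config_functions_def by (rule variety_isomorphism_coord)
    qed
  qed
qed

end
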